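(* Let $G$ be a compact metric tree of total length $L>0$. If there exists an eigenfunction $u_2$ associated with $\lambda_2(G,0)$, the second eigenvalue of the Laplacian ($q=0$) on $G$, and a vertex $v$ of $G$ with $\deg(v)=1$ such that $$u_2^2(v)<\frac{1}{L}\int_G u_2^2(x)\,dx,$$ then, for any $M>0$, the potential $q=0$ is not a minimizer of $\Gamma[q]$ in $C_{G,M}$. In particular, this conclusion holds if $u_2(v)=0$ for some vertex $v$ with $\deg(v)=1$.
   Context: A compact metric graph consists of finitely many edges, each identified with a compact interval $[0,|e|]$, $|e|>0$, whose endpoints are partitioned into finitely many classes (vertices) and glued accordingly; it is always assumed connected. Its total length is the sum of its edge lengths. A tree is a connected metric graph without cycles; a leaf is a vertex of degree one, and the boundary of a tree is the set of its leaves. For a real potential $q$ on $G$, $H u=-u''+qu$ is the self-adjoint Schrödinger operator on $L^2(G)$ with standard (Kirchhoff) vertex conditions: continuity at each vertex and, at each vertex, the sum of the normal derivatives along all incident edges equals $0$. Its eigenvalues counted with multiplicity are $\lambda_1(G,q)<\lambda_2(G,q)\le\dots$, and $\Gamma[q]=\lambda_2(G,q)-\lambda_1(G,q)$. For a tree $G$ and $M>0$, $C_{G,M}$ is the set of functions $q:G\to\mathbb{R}$ with $0\le q(x)\le M$ for all $x\in G$ such that $q$ is convex on every path in $G$ from one boundary vertex (leaf) to another, each path being regarded as an interval. *)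

theory Defs
  imports "HOL-Analysis.Analysis" "HOL-Library.Function_Algebras"
begin

section \<open>Compact metric graphs\<close>

text \<open>
  Each edge \<open>e\<close> is the interval \<open>[0, elen e]\<close>; the vertices \<open>esrc e\<close> and \<open>etgt e\<close> name the
  classes of its endpoints \<open>0\<close> and \<open>elen e\<close>. Loops and parallel edges are possible. The direction
  of an edge is only part of its parametrization.
\<close>

record ('v, 'e) metric_graph =
  edges :: "'e set"
  elen :: "'e \<Rightarrow> real"
  esrc :: "'e \<Rightarrow> 'v"
  etgt :: "'e \<Rightarrow> 'v"

definition vertices :: "('v, 'e) metric_graph \<Rightarrow> 'v set" where
  "vertices G = esrc G ` edges G \<union> etgt G ` edges G"

definition vertex_degree :: "('v, 'e) metric_graph \<Rightarrow> 'v \<Rightarrow> nat" where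
  "vertex_degree G v = card {e \<in> edges G. esrc G e = v} + card {e \<in> edges G. etgt G e = v}"

definition leaves :: "('v, 'e) metric_graph \<Rightarrow> 'v set" where
  "leaves G = {v \<in> vertices G. vertex_degree G v = 1}"

definition total_length :: "('v, 'e) metric_graph \<Rightarrow> real" where
  "total_length G = (\<Sum>e\<in>edges G. elen G e)"

text \<open>A dart \<open>(e, b)\<close> is the edge \<open>e\<close> traversed from \<open>esrc e\<close> to \<open>etgt e\<close> if \<open>b\<close>, backwards otherwise.\<close>

type_synonym 'e dart = "'e \<times> bool"

definition dart_tail :: "('v, 'e) metric_graph \<Rightarrow> 'e dart \<Rightarrow> 'v" where
  "dart_tail G d = (if snd d then esrc G (fst d) else etgt G (fst d))"

definition dart_head :: "('v, 'e) metric_graph \<Rightarrow> 'e dart \<Rightarrow> 'v" where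
  "dart_head G d = (if snd d then etgt G (fst d) else esrc G (fst d))"

fun walk :: "('v, 'e) metric_graph \<Rightarrow> 'v \<Rightarrow> 'e dart list \<Rightarrow> 'v \<Rightarrow> bool" where
  "walk G v [] w \<longleftrightarrow> v = w"
| "walk G v (d # ds) w \<longleftrightarrow> fst d \<in> edges G \<and> dart_tail G d = v \<and> walk G (dart_head G d) ds w"

definition simple_route :: "('v, 'e) metric_graph \<Rightarrow> 'v \<Rightarrow> 'e dart list \<Rightarrow> 'v \<Rightarrow> bool" where
  "simple_route G v ds w \<longleftrightarrow> walk G v ds w \<and> distinct (v # map (dart_head G) ds)"

text \<open>Loops and pairs of parallel edges are cycles; going back and forth along one edge is not.\<close>

definition is_cycle :: "('v, 'e) metric_graph \<Rightarrow> 'e dart list \<Rightarrow> bool" where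
  "is_cycle G ds \<longleftrightarrow> ds \<noteq> [] \<and> (\<exists>v. walk G v ds v) \<and>
     distinct (map (dart_head G) ds) \<and> distinct (map fst ds)"

definition compact_metric_graph :: "('v, 'e) metric_graph \<Rightarrow> bool" where
  "compact_metric_graph G \<longleftrightarrow> finite (edges G) \<and> (\<forall>e\<in>edges G. 0 < elen G e) \<and>
     (\<forall>v\<in>vertices G. \<forall>w\<in>vertices G. \<exists>ds. walk G v ds w)"

definition metric_tree :: "('v, 'e) metric_graph \<Rightarrow> bool" where
  "metric_tree G \<longleftrightarrow> compact_metric_graph G \<and> \<not> (\<exists>ds. is_cycle G ds)"


section \<open>Points of the glued space and functions on it\<close>

datatype ('v, 'e) point = Vertex 'v | Interior 'e real

definition points :: "('v, 'e) metric_graph \<Rightarrow> ('v, 'e) point set" where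
  "points G = Vertex ` vertices G \<union> {Interior e x | e x. e \<in> edges G \<and> 0 < x \<and> x < elen G e}"

text \<open>The point with coordinate \<open>x \<in> [0, elen e]\<close> on the edge \<open>e\<close> (the quotient map).\<close>

definition pt :: "('v, 'e) metric_graph \<Rightarrow> 'e \<Rightarrow> real \<Rightarrow> ('v, 'e) point" where
  "pt G e x = (if x = 0 then Vertex (esrc G e)
               else if x = elen G e then Vertex (etgt G e) else Interior e x)"

definition graph_integral :: "('v, 'e) metric_graph \<Rightarrow> (('v, 'e) point \<Rightarrow> real) \<Rightarrow> real" where
  "graph_integral G f = (\<Sum>e\<in>edges G. LBINT x:{0..elen G e}. f (pt G e x))"

text \<open>Arc-length parametrization of a walk by \<open>[0, route_length ds]\<close>.\<close>

definition dart_point :: "('v, 'e) metric_graph \<Rightarrow> 'e dart \<Rightarrow> real \<Rightarrow> ('v, 'e) point" where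
  "dart_point G d s = pt G (fst d) (if snd d then s else elen G (fst d) - s)"

definition route_length :: "('v, 'e) metric_graph \<Rightarrow> 'e dart list \<Rightarrow> real" where
  "route_length G ds = (\<Sum>d\<leftarrow>ds. elen G (fst d))"

fun route_point :: "('v, 'e) metric_graph \<Rightarrow> 'e dart list \<Rightarrow> real \<Rightarrow> ('v, 'e) point" where
  "route_point G [] s = undefined"
| "route_point G (d # ds) s =
     (if ds = [] \<or> s \<le> elen G (fst d) then dart_point G d s
      else route_point G ds (s - elen G (fst d)))"

definition convex_potentials ::
    "('v, 'e) metric_graph \<Rightarrow> real \<Rightarrow> (('v, 'e) point \<Rightarrow> real) set" where
  "convex_potentials G M =
     {q. (\<forall>x\<in>points G. 0 \<le> q x \<and> q x \<le> M) \<and>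
         (\<forall>v\<in>leaves G. \<forall>w\<in>leaves G. \<forall>ds. v \<noteq> w \<and> simple_route G v ds w \<longrightarrow>
            convex_on {0..route_length G ds} (\<lambda>s. q (route_point G ds s)))}"


section \<open>The Schroedinger operator with standard vertex conditions\<close>

text \<open>
  \<open>f\<close> lies in the Sobolev space \<open>H\<^sup>2(0, l)\<close>, with \<open>f'\<close> its classical first derivative on \<open>[0, l]\<close>
  (one-sided at the endpoints) and \<open>f''\<close> a representative of its weak second derivative.
\<close>

definition sobolev2 ::
    "real \<Rightarrow> (real \<Rightarrow> real) \<Rightarrow> (real \<Rightarrow> real) \<Rightarrow> (real \<Rightarrow> real) \<Rightarrow> bool" where
  "sobolev2 l f f' f'' \<longleftrightarrow>
     (\<forall>x\<in>{0..l}. (f has_real_derivative f' x) (at x within {0..l})) \<and>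
     set_borel_measurable lborel {0..l} f'' \<and>
     set_integrable lborel {0..l} (\<lambda>x. (f'' x)\<^sup>2) \<and>
     (\<forall>x\<in>{0..l}. f' x = f' 0 + (LBINT t:{0..x}. f'' t))"

text \<open>\<open>u' e\<close> is the derivative of \<open>u\<close> in the coordinate of \<open>e\<close>; derivatives are taken away from the vertex.\<close>

definition kirchhoff :: "('v, 'e) metric_graph \<Rightarrow> ('e \<Rightarrow> real \<Rightarrow> real) \<Rightarrow> bool" where
  "kirchhoff G u' \<longleftrightarrow> (\<forall>v\<in>vertices G.
     (\<Sum>e\<in>{e \<in> edges G. esrc G e = v}. u' e 0) +
     (\<Sum>e\<in>{e \<in> edges G. etgt G e = v}. - u' e (elen G e)) = 0)"

text \<open>
  The graph of the operator \<open>H\<close> for a bounded measurable potential \<open>q\<close>: \<open>u\<close> lies in the domain of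
  \<open>H\<close> and \<open>H u = w\<close> in \<open>L\<^sup>2(G)\<close>. Continuity at the vertices is built in: all edge restrictions
  \<open>u \<circ> pt G e\<close> are continuous and take the common value \<open>u (Vertex v)\<close> at their endpoints in \<open>v\<close>.
\<close>

definition schroedinger ::
    "('v, 'e) metric_graph \<Rightarrow> (('v, 'e) point \<Rightarrow> real) \<Rightarrow> (('v, 'e) point \<Rightarrow> real) \<Rightarrow>
     (('v, 'e) point \<Rightarrow> real) \<Rightarrow> bool" where
  "schroedinger G q u w \<longleftrightarrow> (\<exists>u' u''.
     (\<forall>e\<in>edges G. sobolev2 (elen G e) (\<lambda>x. u (pt G e x)) (u' e) (u'' e)) \<and>
     kirchhoff G u' \<and>
     (\<forall>e\<in>edges G. AE x in lborel. x \<in> {0..elen G e} \<longrightarrow>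
        w (pt G e x) = - u'' e x + q (pt G e x) * u (pt G e x)))"

text \<open>
  Elements of the domain are represented by their continuous representatives, extended by \<open>0\<close> to
  elements of the type \<open>point\<close> outside the graph, so that distinct elements of the eigenspace are
  distinct functions on the graph.
\<close>

definition eigenspace ::
    "('v, 'e) metric_graph \<Rightarrow> (('v, 'e) point \<Rightarrow> real) \<Rightarrow> real \<Rightarrow> (('v, 'e) point \<Rightarrow> real) set" where
  "eigenspace G q \<mu> =
     {u. (\<forall>x. x \<notin> points G \<longrightarrow> u x = 0) \<and> schroedinger G q u (\<lambda>x. \<mu> * u x)}"

definition eigenfunction ::
    "('v, 'e) metric_graph \<Rightarrow> (('v, 'e) point \<Rightarrow> real) \<Rightarrow> real \<Rightarrow> (('v, 'e) point \<Rightarrow> real) \<Rightarrow> bool" where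
  "eigenfunction G q \<mu> u \<longleftrightarrow> u \<in> eigenspace G q \<mu> \<and> u \<noteq> 0"

interpretation fun_space: vector_space "\<lambda>(c::real) (f::'a \<Rightarrow> real) x. c * f x"
  by unfold_locales (auto simp: fun_eq_iff algebra_simps)

definition multiplicity ::
    "('v, 'e) metric_graph \<Rightarrow> (('v, 'e) point \<Rightarrow> real) \<Rightarrow> real \<Rightarrow> nat" where
  "multiplicity G q \<mu> = fun_space.dim (eigenspace G q \<mu>)"

text \<open>
  The set summed over is finite for bounded measurable \<open>q\<close>, since the spectrum of \<open>H\<close> is discrete
  and bounded below, and each eigenspace has dimension at most twice the number of edges.
\<close>

definition eigenvalue_count ::
    "('v, 'e) metric_graph \<Rightarrow> (('v, 'e) point \<Rightarrow> real) \<Rightarrow> real \<Rightarrow> nat" where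
  "eigenvalue_count G q c =
     (\<Sum>\<mu>\<in>{\<mu>. \<mu> \<le> c \<and> (\<exists>u. eigenfunction G q \<mu> u)}. multiplicity G q \<mu>)"

text \<open>The \<open>k\<close>-th eigenvalue in increasing order, counted with multiplicity, starting from \<open>k = 1\<close>.\<close>

definition eigval :: "('v, 'e) metric_graph \<Rightarrow> (('v, 'e) point \<Rightarrow> real) \<Rightarrow> nat \<Rightarrow> real" where
  "eigval G q k = (LEAST c. k \<le> eigenvalue_count G q c)"

definition spectral_gap :: "('v, 'e) metric_graph \<Rightarrow> (('v, 'e) point \<Rightarrow> real) \<Rightarrow> real" where
  "spectral_gap G q = eigval G q 2 - eigval G q 1"

end

theory Submission
  imports Defs
begin

text \<open>
  The competitor is \<open>t \<psi>\<close>, where \<open>\<psi>\<close> is a tent of small width on the pendant edge at the leaf \<open>v\<close>,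
  with its peak at \<open>v\<close>, and \<open>t > 0\<close> is small. To first order in \<open>t\<close> it raises \<open>\<lambda>\<^sub>1\<close> by the mean of \<open>\<psi>\<close>
  and an eigenvalue with eigenfunction \<open>u\<close> by the mean of \<open>\<psi>\<close> with respect to the normalized
  weight \<open>u\<^sup>2\<close>, which is smaller because \<open>u\<^sup>2\<close> is below its average near \<open>v\<close>; so the gap decreases.

  Perturbation theory is replaced by a shooting argument. Dropping the Kirchhoff condition at \<open>v\<close> leaves
  a nonzero solution of the eigenvalue equation for every spectral parameter. Near an eigenvalue with
  no nonzero eigenfunction vanishing at \<open>v\<close>, this solution, normalized to \<open>1\<close> at \<open>v\<close>, is close to the
  unperturbed one by compactness. By Green's identity its flux at \<open>v\<close> is Lipschitz in the spectral
  parameter and changes sign between \<open>\<mu> + a t\<close> and \<open>\<mu> + b t\<close> whenever \<open>a\<close> and \<open>b\<close> enclose the weighted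
  mean of \<open>\<psi>\<close>. An eigenfunction vanishing at \<open>v\<close> vanishes on the whole pendant edge and is not affected
  by the perturbation. The branch from \<open>\<lambda>\<^sub>1 = 0\<close> has a positive eigenfunction, so by Picone's identity it
  is the lowest eigenvalue.
\<close>

section \<open>Linear second order equations on an interval\<close>

text \<open>The obstacle is that \<open>\<lambda>\<^sub>2\<close> may be multiple, and a multiple
  eigenvalue can split under perturbation. Testing at the leaf \<open>v\<close> avoids following the
  splitting: either some nonzero eigenfunction vanishes at \<open>v\<close> and the old eigenvalue
  survives, or evaluation at \<open>v\<close> is injective on the eigenspace, which is then a line.
  In both cases it is enough to exhibit one small eigenvalue strictly above the lowest one: it
  bounds the second eigenvalue from above, whether or not it is the second. The strict gap between
  the two first order rates absorbs all errors, so continuity of solutions in the parameters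
  suffices and no derivative of an eigenvalue is ever taken.

  A second obstacle is the counting function behind \<open>eigval\<close>. Sums over infinite sets
  and cardinalities of infinite bases are 0 by convention, so eigenspaces must be shown
  finite-dimensional and eigenvalues finite in number on bounded intervals before any eigenvalue can
  be identified.\<close>

definition lin_ode :: "real \<Rightarrow> (real \<Rightarrow> real) \<Rightarrow> (real \<Rightarrow> real) \<Rightarrow> (real \<Rightarrow> real) \<Rightarrow> bool" where
  "lin_ode l p f f' \<longleftrightarrow> (\<forall>x\<in>{0..l}.
     (f has_real_derivative f' x) (at x within {0..l}) \<and>
     (f' has_real_derivative p x * f x) (at x within {0..l}))"

lemma lin_odeD:
  assumes "lin_ode l p f f'" "x \<in> {0..l}"
  shows "(f has_real_derivative f' x) (at x within {0..l})"
    "(f' has_real_derivative p x * f x) (at x within {0..l})"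
  using assms by (auto simp: lin_ode_def)

lemma lin_ode_continuous:
  assumes "lin_ode l p f f'"
  shows "continuous_on {0..l} f" "continuous_on {0..l} f'"
  by (rule DERIV_continuous_on, erule lin_odeD[OF assms])+

lemma lin_ode_combine:
  assumes "lin_ode l p f f'" "lin_ode l p g g'"
  shows "lin_ode l p (\<lambda>x. a * f x + b * g x) (\<lambda>x. a * f' x + b * g' x)"
  unfolding lin_ode_def
proof (intro ballI conjI)
  fix x assume x: "x \<in> {0..l}"
  note d = lin_odeD[OF assms(1) x] lin_odeD[OF assms(2) x]
  show "((\<lambda>x. a * f x + b * g x) has_real_derivative a * f' x + b * g' x) (at x within {0..l})"
    by (intro DERIV_add DERIV_cmult d)
  have "((\<lambda>x. a * f' x + b * g' x) has_real_derivative a * (p x * f x) + b * (p x * g x)) (at x within {0..l})"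
    by (intro DERIV_add DERIV_cmult d)
  then show "((\<lambda>x. a * f' x + b * g' x) has_real_derivative p x * (a * f x + b * g x)) (at x within {0..l})"
    by (simp add: algebra_simps)
qed

text \<open>A Gronwall estimate: the energy f^2 + g^2, damped by exp (-(K + 2) y) and corrected by
  \<eta>^2 y, is nonincreasing. The term \<eta> makes it applicable to the difference of two
  solutions with different potentials.\<close>

lemma ode_energy_bound:
  fixes f g h :: "real \<Rightarrow> real"
  assumes f: "\<And>x. x \<in> {0..l} \<Longrightarrow> (f has_real_derivative g x) (at x within {0..l})"
    and g: "\<And>x. x \<in> {0..l} \<Longrightarrow> (g has_real_derivative h x) (at x within {0..l})"
    and h: "\<And>x. x \<in> {0..l} \<Longrightarrow> \<bar>h x\<bar> \<le> K * \<bar>f x\<bar> + \<eta>"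
    and K: "K \<ge> 0" and x: "x \<in> {0..l}"
  shows "(f x)\<^sup>2 + (g x)\<^sup>2 \<le> exp ((K + 2) * x) * ((f 0)\<^sup>2 + (g 0)\<^sup>2 + \<eta>\<^sup>2 * x)"
proof (cases "x = 0")
  case False
  define F where "F = (\<lambda>y. exp (-(K + 2) * y) * ((f y)\<^sup>2 + (g y)\<^sup>2) - \<eta>\<^sup>2 * y)"
  have "F x \<le> F 0"
  proof (rule DERIV_nonpos_imp_decreasing_open[where f = F and a = 0 and b = x])
    show "0 \<le> x" using x by auto
    show "continuous_on {0..x} F"
    proof -
      have "continuous_on {0..l} f" "continuous_on {0..l} g"
        by (rule DERIV_continuous_on, erule f g)+
      then have "continuous_on {0..x} f" "continuous_on {0..x} g"
        using x by (auto elim: continuous_on_subset)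
      then show ?thesis unfolding F_def by (intro continuous_intros)
    qed
    fix y assume y: "0 < y" "y < x"
    then have yl: "y \<in> {0..l}" "y \<in> {0<..<l}" using x by auto
    have at: "at y within {0..l} = at y"
      using yl(2) by (intro at_within_interior) (auto simp: interior_atLeastAtMost_real)
    define D where "D = exp (-(K + 2) * y) * (2 * f y * g y + 2 * g y * h y
       - (K + 2) * ((f y)\<^sup>2 + (g y)\<^sup>2)) - \<eta>\<^sup>2"
    have "(F has_real_derivative D) (at y)"
      unfolding F_def D_def using f[OF yl(1)] g[OF yl(1)] unfolding at
      by (auto intro!: derivative_eq_intros simp: algebra_simps)
    moreover have "D \<le> 0"
    proof -
      \<comment> \<open>Used with X = f^2, Y = g^2 and k = K (X + Y). Of the 2 in the rate K + 2,
        one unit absorbs 2 f g and the other the square of g split off from 2 |g| \<eta>.\<close>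
      have arith: "a + b - c \<le> e" if "a \<le> X + Y" "b \<le> k + (Y + e)" "0 \<le> X" "c = k + 2 * (X + Y)"
        for a b c e k X Y :: real
        using that by (simp add: distrib_left)
      have 1: "2 * f y * g y \<le> (f y)\<^sup>2 + (g y)\<^sup>2"
        using sum_squares_bound[of "f y" "g y"] by simp
      have "2 * g y * h y \<le> 2 * \<bar>g y\<bar> * \<bar>h y\<bar>"
        by (metis abs_ge_self abs_mult abs_numeral)
      also have "\<dots> \<le> 2 * \<bar>g y\<bar> * (K * \<bar>f y\<bar> + \<eta>)"
        using h[OF yl(1)] by (intro mult_left_mono) auto
      also have "\<dots> = K * (2 * \<bar>f y\<bar> * \<bar>g y\<bar>) + 2 * \<bar>g y\<bar> * \<eta>"
        by (simp add: algebra_simps)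
      also have "\<dots> \<le> K * ((f y)\<^sup>2 + (g y)\<^sup>2) + ((g y)\<^sup>2 + \<eta>\<^sup>2)"
        using sum_squares_bound[of "\<bar>f y\<bar>" "\<bar>g y\<bar>"] sum_squares_bound[of "\<bar>g y\<bar>" \<eta>] K
        by (intro add_mono mult_left_mono) auto
      finally have "2 * f y * g y + 2 * g y * h y - (K + 2) * ((f y)\<^sup>2 + (g y)\<^sup>2) \<le> \<eta>\<^sup>2"
        by (rule arith[OF 1 _ zero_le_power2 distrib_right])
      then have "D \<le> exp (-(K + 2) * y) * \<eta>\<^sup>2 - \<eta>\<^sup>2"
        unfolding D_def by (simp add: mult_left_mono)
      also have "\<dots> \<le> 1 * \<eta>\<^sup>2 - \<eta>\<^sup>2"
        using K y by (intro diff_right_mono mult_right_mono) (auto simp: mult_nonpos_nonneg)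
      finally show ?thesis by simp
    qed
    ultimately show "\<exists>y'. (F has_real_derivative y') (at y) \<and> y' \<le> 0" by blast
  qed
  then have "exp (-(K + 2) * x) * ((f x)\<^sup>2 + (g x)\<^sup>2) \<le> (f 0)\<^sup>2 + (g 0)\<^sup>2 + \<eta>\<^sup>2 * x"
    by (simp add: F_def)
  then have "exp ((K + 2) * x) * (exp (-(K + 2) * x) * ((f x)\<^sup>2 + (g x)\<^sup>2))
     \<le> exp ((K + 2) * x) * ((f 0)\<^sup>2 + (g 0)\<^sup>2 + \<eta>\<^sup>2 * x)"
    by (intro mult_left_mono) auto
  moreover have "exp ((K + 2) * x) * (exp (-(K + 2) * x) * y) = y" for y
    unfolding mult.assoc[symmetric] exp_add[symmetric] by (simp add: algebra_simps)
  ultimately show ?thesis by metis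
qed simp

text \<open>Each Picard step integrates twice. One integration gains the factor x / n, the other is
  estimated by the length \<open>l\<close>, so the terms are dominated by an exponential series. The
  series of first and second derivatives converge uniformly as well, which justifies differentiating
  term by term twice.\<close>

lemma lin_ode_exists:
  fixes p :: "real \<Rightarrow> real"
  assumes l: "0 < l" and p: "continuous_on {0..l} p"
  shows "\<exists>f f'. lin_ode l p f f' \<and> f 0 = a \<and> f' 0 = b"
proof -
  obtain K where K: "\<And>x. x \<in> {0..l} \<Longrightarrow> \<bar>p x\<bar> \<le> K" "K \<ge> 0"
  proof -
    have "bounded (p ` {0..l})"
      using p compact_continuous_image compact_imp_bounded by blast
    then obtain K where "\<forall>x\<in>{0..l}. \<bar>p x\<bar> \<le> K" by (auto simp: bounded_iff)
    then show ?thesis using that[of "max K 0"] by force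
  qed
  \<comment> \<open>The summands of the Picard series for \<open>f\<close> are \<open>c n\<close>, those for \<open>f'\<close> are \<open>g n\<close>.\<close>
  define st where "st = (\<lambda>c :: real \<Rightarrow> real. (\<lambda>x. integral {0..x} (\<lambda>y. p y * c y)))"
  define c :: "nat \<Rightarrow> real \<Rightarrow> real" where
    "c = rec_nat (\<lambda>x. a + b * x) (\<lambda>_ d x. integral {0..x} (st d))"
  define g where "g = (\<lambda>n. case n of 0 \<Rightarrow> (\<lambda>_. b) | Suc m \<Rightarrow> st (c m))"
  have c0: "c 0 = (\<lambda>x. a + b * x)" and cS: "c (Suc n) = (\<lambda>x. integral {0..x} (g (Suc n)))" for n
    by (simp_all add: c_def g_def)
  have g0: "g 0 = (\<lambda>_. b)" and gS: "g (Suc n) = (\<lambda>x. integral {0..x} (\<lambda>y. p y * c n y))" for n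
    by (simp_all add: g_def st_def)
  have int: "((\<lambda>x. integral {0..x} h) has_real_derivative h x) (at x within {0..l})"
    if "continuous_on {0..l} h" "x \<in> {0..l}" for h :: "real \<Rightarrow> real" and x
    using integral_has_real_derivative[OF that] .
  have cont: "continuous_on {0..l} (c n) \<and> continuous_on {0..l} (g n)" for n
  proof (induction n)
    case 0
    show ?case by (auto simp: c0 g0 intro!: continuous_intros)
  next
    case (Suc n)
    have *: "continuous_on {0..l} (\<lambda>y. p y * c n y)" using Suc p by (auto intro!: continuous_intros)
    have gs: "continuous_on {0..l} (g (Suc n))"
      unfolding gS by (rule DERIV_continuous_on) (rule int[OF *])
    have "continuous_on {0..l} (c (Suc n))"
      unfolding cS by (rule DERIV_continuous_on) (rule int[OF gs])
    with gs show ?case by blast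
  qed
  have dc: "(c n has_real_derivative g n x) (at x within {0..l})" if "x \<in> {0..l}" for n x
  proof (cases n)
    case 0
    show ?thesis unfolding 0 c0 g0 by (auto intro!: derivative_eq_intros)
  next
    case (Suc m)
    show ?thesis unfolding Suc cS using int that cont by blast
  qed
  \<comment> \<open>The second derivatives of the summands. The index is shifted: the affine term
    \<open>c 0\<close> contributes 0 and \<open>c (Suc m)\<close> contributes p times
    \<open>c m\<close>, so the whole series sums to p f.\<close>
  define r where "r = (\<lambda>n. case n of 0 \<Rightarrow> (\<lambda>_. 0) | Suc m \<Rightarrow> (\<lambda>x. p x * c m x))"
  have dg: "(g n has_real_derivative r n x) (at x within {0..l})" if "x \<in> {0..l}" for n x
  proof (cases n)
    case 0
    show ?thesis unfolding 0 g0 r_def by (auto intro!: derivative_eq_intros)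
  next
    case (Suc m)
    show ?thesis unfolding Suc gS r_def using p cont[of m] that
      by (auto intro!: int continuous_intros)
  qed
  define A where "A = \<bar>a\<bar> + \<bar>b\<bar> * l"
  have A: "A \<ge> 0" using l by (simp add: A_def)
  have ipow: "((\<lambda>y. C * y ^ n / fact n) has_integral C * x ^ Suc n / fact (Suc n)) {0..x}"
    if "0 \<le> x" for C x :: real and n
  proof -
    have "((\<lambda>y. C * y ^ n / fact n) has_integral C * x ^ Suc n / fact (Suc n) - C * 0 ^ Suc n / fact (Suc n)) {0..x}"
    proof (rule fundamental_theorem_of_calculus[OF that])
      fix y assume "y \<in> {0..x}"
      have eq: "C * (real (Suc n) * y ^ n) / fact (Suc n) = C * y ^ n / fact n"
        by (simp add: divide_simps)
      have "((\<lambda>y. C * y ^ Suc n / fact (Suc n)) has_real_derivative C * (real (Suc n) * y ^ n) / fact (Suc n)) (at y within {0..x})"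
        by (intro DERIV_cdivide DERIV_cmult)
          (use DERIV_pow[of "Suc n" y "{0..x}"] in simp)
      then have "((\<lambda>y. C * y ^ Suc n / fact (Suc n)) has_real_derivative C * y ^ n / fact n) (at y within {0..x})"
        unfolding eq .
      then show "((\<lambda>y. C * y ^ Suc n / fact (Suc n)) has_vector_derivative C * y ^ n / fact n) (at y within {0..x})"
        by (simp only: has_real_derivative_iff_has_vector_derivative)
    qed
    then show ?thesis by simp
  qed
  have ibound: "\<bar>integral {0..x} h\<bar> \<le> C * x ^ Suc n / fact (Suc n)"
    if "continuous_on {0..l} h" "x \<in> {0..l}" "\<And>y. y \<in> {0..x} \<Longrightarrow> \<bar>h y\<bar> \<le> C * y ^ n / fact n"
    for h :: "real \<Rightarrow> real" and C x n
  proof -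
    have "h integrable_on {0..x}"
      using that(1,2) by (intro integrable_continuous_real) (auto elim: continuous_on_subset)
    then have "norm (integral {0..x} h) \<le> integral {0..x} (\<lambda>y. C * y ^ n / fact n)"
      using ipow[of x C n] that by (intro integral_norm_bound_integral) auto
    moreover have "integral {0..x} (\<lambda>y. C * y ^ n / fact n) = C * x ^ Suc n / fact (Suc n)"
      using ipow[of x C n] that(2) by (intro integral_unique) auto
    ultimately show ?thesis by simp
  qed
  have cb: "\<bar>c n x\<bar> \<le> A * (K * l) ^ n * x ^ n / fact n" 
   and gb: "\<bar>g (Suc n) x\<bar> \<le> A * (K * l) ^ Suc n * x ^ n / fact n" if "x \<in> {0..l}" for n x
  proof -
    have "(\<forall>x\<in>{0..l}. \<bar>c n x\<bar> \<le> A * (K * l) ^ n * x ^ n / fact n) \<and>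
      (\<forall>x\<in>{0..l}. \<bar>g (Suc n) x\<bar> \<le> A * (K * l) ^ Suc n * x ^ n / fact n)"
    proof (induction n)
      case 0
      have c: "\<bar>c 0 x\<bar> \<le> A" if "x \<in> {0..l}" for x
      proof -
        have "\<bar>a + b * x\<bar> \<le> \<bar>a\<bar> + \<bar>b\<bar> * \<bar>x\<bar>" by (metis abs_mult abs_triangle_ineq)
        also have "\<dots> \<le> A" unfolding A_def using that by (intro add_mono mult_left_mono) auto
        finally show ?thesis by (simp add: c0)
      qed
      have "\<bar>g (Suc 0) x\<bar> \<le> A * (K * l)" if x: "x \<in> {0..l}" for x
      proof -
        have "\<bar>integral {0..x} (\<lambda>y. p y * c 0 y)\<bar> \<le> (K * A) * x ^ Suc 0 / fact (Suc 0)"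
        proof (rule ibound)
          show "continuous_on {0..l} (\<lambda>y. p y * c 0 y)" using p cont by (auto intro!: continuous_intros)
          fix y assume "y \<in> {0..x}"
          then have "y \<in> {0..l}" using x by auto
          then show "\<bar>p y * c 0 y\<bar> \<le> K * A * y ^ 0 / fact 0"
            using K c by (simp add: abs_mult mult_mono)
        qed (use x in auto)
        also have "\<dots> \<le> (K * A) * l" using x K A by (auto intro!: mult_left_mono)
        finally show ?thesis by (simp add: gS mult_ac)
      qed
      with c show ?case by simp
    next
      case (Suc n)
      have c: "\<bar>c (Suc n) x\<bar> \<le> A * (K * l) ^ Suc n * x ^ Suc n / fact (Suc n)" if "x \<in> {0..l}" for x
        unfolding cS using Suc cont that by (intro ibound) auto
      have "\<bar>g (Suc (Suc n)) x\<bar> \<le> A * (K * l) ^ Suc (Suc n) * x ^ Suc n / fact (Suc n)"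
        if x: "x \<in> {0..l}" for x
      proof -
        have "\<bar>integral {0..x} (\<lambda>y. p y * c (Suc n) y)\<bar>
            \<le> integral {0..x} (\<lambda>y. K * (A * (K * l) ^ Suc n * x ^ Suc n / fact (Suc n)))"
        proof -
          have *: "continuous_on {0..x} (\<lambda>y. p y * c (Suc n) y)" 
            by (rule continuous_on_subset[of "{0..l}"])
              (use p cont x in \<open>auto intro!: continuous_intros\<close>)
          have "norm (integral {0..x} (\<lambda>y. p y * c (Suc n) y))
            \<le> integral {0..x} (\<lambda>y. K * (A * (K * l) ^ Suc n * x ^ Suc n / fact (Suc n)))"
          proof (rule integral_norm_bound_integral)
            fix y assume y: "y \<in> {0..x}"
            then have y': "y \<in> {0..l}" using x by auto
            have "\<bar>c (Suc n) y\<bar> \<le> A * (K * l) ^ Suc n * y ^ Suc n / fact (Suc n)" using c[OF y'] .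
            also have "\<dots> \<le> A * (K * l) ^ Suc n * x ^ Suc n / fact (Suc n)"
              using y A K l x by (intro divide_right_mono mult_left_mono power_mono) (auto simp del: power_Suc fact_Suc)
            finally show "norm (p y * c (Suc n) y) \<le> K * (A * (K * l) ^ Suc n * x ^ Suc n / fact (Suc n))"
              unfolding real_norm_def abs_mult using K y' by (intro mult_mono) auto
          qed (use integrable_continuous_real[OF *] in auto)
          then show ?thesis by simp
        qed
        also have "\<dots> = x * (K * (A * (K * l) ^ Suc n * x ^ Suc n / fact (Suc n)))"
          using x by simp
        also have "\<dots> \<le> l * (K * (A * (K * l) ^ Suc n * x ^ Suc n / fact (Suc n)))"
          using x A K l by (intro mult_right_mono) (auto simp del: power_Suc fact_Suc)
        also have "\<dots> = A * (K * l) ^ Suc (Suc n) * x ^ Suc n / fact (Suc n)" by (simp del: fact_Suc)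
        finally show ?thesis unfolding gS[of "Suc n"] .
      qed
      with c show ?case by blast
    qed
    then show "\<bar>c n x\<bar> \<le> A * (K * l) ^ n * x ^ n / fact n" 
      "\<bar>g (Suc n) x\<bar> \<le> A * (K * l) ^ Suc n * x ^ n / fact n" using that by auto
  qed
  have mono: "A * (K * l) ^ n * x ^ k / fact k \<le> A * (K * l) ^ n * l ^ k / fact k"
    if "x \<in> {0..l}" for x n k
    using that A K l by (intro divide_right_mono mult_left_mono power_mono) auto
  have "summable (\<lambda>n. inverse (fact n) * (K * l * l) ^ n)" by (rule summable_exp)
  then have "summable (\<lambda>n. A * (inverse (fact n) * (K * l * l) ^ n))" by (rule summable_mult)
  then have sumA: "summable (\<lambda>n. A * (K * l) ^ n * l ^ n / fact n)"
    by (simp add: field_simps power_mult_distrib)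
  have sumB: "summable (\<lambda>n. (K * l) * (A * (K * l) ^ n * l ^ n / fact n))"
    using sumA by (rule summable_mult)
  define f where "f = (\<lambda>x. \<Sum>n. c n x)"
  define f' where "f' = (\<lambda>x. \<Sum>n. g n x)"
  have uc: "uniform_limit {0..l} (\<lambda>n x. \<Sum>i<n. c i x) f sequentially"
    unfolding f_def
    by (rule Weierstrass_m_test[OF _ sumA]) (use cb mono in \<open>fastforce intro: order_trans\<close>)
  have ug: "uniform_limit {0..l} (\<lambda>n x. \<Sum>i<n. g i x) f' sequentially"
    unfolding f'_def
  proof (rule Weierstrass_m_test)
    \<comment> \<open>The majorant inherits the index shift; the constant term \<open>g 0\<close>
      gets its own bound.\<close>
    show "summable (\<lambda>n. case n of 0 \<Rightarrow> \<bar>b\<bar> | Suc n \<Rightarrow> (K * l) * (A * (K * l) ^ n * l ^ n / fact n))"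
      by (subst summable_Suc_iff[symmetric]) (use sumB in simp)
    fix n x assume x: "x \<in> {0..l}"
    show "norm (g n x) \<le> (case n of 0 \<Rightarrow> \<bar>b\<bar> | Suc n \<Rightarrow> (K * l) * (A * (K * l) ^ n * l ^ n / fact n))"
    proof (cases n)
      case (Suc k)
      have "\<bar>g (Suc k) x\<bar> \<le> A * (K * l) ^ Suc k * l ^ k / fact k"
        using gb[OF x, of k] mono[OF x, of "Suc k" k] by linarith
      then show ?thesis using Suc by (simp add: mult_ac)
    qed (simp add: g0)
  qed
  have ur: "uniform_limit {0..l} (\<lambda>n x. \<Sum>i<n. r i x) (\<lambda>x. \<Sum>n. r n x) sequentially"
  proof (rule Weierstrass_m_test)
    show "summable (\<lambda>n. case n of 0 \<Rightarrow> 0 | Suc n \<Rightarrow> K * (A * (K * l) ^ n * l ^ n / fact n))"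
      by (subst summable_Suc_iff[symmetric]) (use summable_mult[OF sumA, of K] in simp)
    fix n x assume x: "x \<in> {0..l}"
    show "norm (r n x) \<le> (case n of 0 \<Rightarrow> 0 | Suc n \<Rightarrow> K * (A * (K * l) ^ n * l ^ n / fact n))"
    proof (cases n)
      case (Suc k)
      have "\<bar>c k x\<bar> \<le> A * (K * l) ^ k * l ^ k / fact k"
        using cb[OF x, of k] mono[OF x, of k k] by linarith
      then show ?thesis using Suc K x by (auto simp: r_def abs_mult intro!: mult_mono simp flip: times_divide_eq_right)
    qed (simp add: r_def)
  qed
  have rsum: "(\<Sum>n. r n x) = p x * f x" if x: "x \<in> {0..l}" for x
  proof -
    have "summable (\<lambda>n. c n x)"
    proof (rule summable_comparison_test'[OF sumA, of 0])
      fix n show "norm (c n x) \<le> A * (K * l) ^ n * l ^ n / fact n"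
        using cb[OF x, of n] mono[OF x, of n n] by simp
    qed
    then have "(\<lambda>n. p x * c n x) sums (p x * f x)" unfolding f_def by (intro sums_mult summable_sums)
    then have "(\<lambda>n. r (Suc n) x) sums (p x * f x)" by (simp add: r_def)
    then have "(\<lambda>n. r n x) sums (p x * f x + r 0 x)" by (subst (asm) sums_Suc_iff)
    then show ?thesis by (simp add: r_def sums_iff)
  qed
  have c00: "c n 0 = (if n = 0 then a else 0)" for n
    by (cases n) (auto simp: c0 cS)
  have g00: "g n 0 = (if n = 0 then b else 0)" for n
    by (cases n) (auto simp: g0 gS)
  have "summable (\<lambda>n. c n 0)" "summable (\<lambda>n. g n 0)"
    unfolding c00 g00 by (rule summable_finite[of "{0}"]; simp)+
  then obtain F H where
    F: "\<And>x. x \<in> {0..l} \<Longrightarrow> (\<lambda>n. c n x) sums F x \<and> (F has_field_derivative f' x) (at x within {0..l})" and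
    H: "\<And>x. x \<in> {0..l} \<Longrightarrow> (\<lambda>n. g n x) sums H x \<and> (H has_field_derivative (\<Sum>n. r n x)) (at x within {0..l})"
    using has_field_derivative_series[OF convex_real_interval(5) dc ug, of 0]
      has_field_derivative_series[OF convex_real_interval(5) dg ur, of 0] l
    by (metis atLeastAtMost_iff order.refl less_imp_le)
  have FH: "F x = f x" "H x = f' x" if "x \<in> {0..l}" for x
    using F[OF that] H[OF that] by (auto simp: f_def f'_def sums_iff)
  have "lin_ode l p F H"
    unfolding lin_ode_def using F H FH rsum by auto
  moreover have "F 0 = a" "H 0 = b"
    using F[of 0] H[of 0] l c00 g00 sums_If_finite[of "\<lambda>n. n = 0" "\<lambda>_. a"]
      sums_If_finite[of "\<lambda>n. n = 0" "\<lambda>_. b"] by (auto dest: sums_unique2)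
  ultimately show ?thesis by blast
qed

text \<open>Gaussian elimination: an equation with a nonzero coefficient at \<open>k\<close> is used
  to remove the unknown \<open>k\<close> from the others, which leaves one equation and one unknown
  fewer.\<close>

lemma underdetermined_system:
  fixes A :: "'j \<Rightarrow> 'i \<Rightarrow> real"
  assumes "finite J" "finite I" "card J < card I"
  shows "\<exists>x. (\<exists>i\<in>I. x i \<noteq> 0) \<and> (\<forall>j\<in>J. (\<Sum>i\<in>I. A j i * x i) = 0)"
  using assms
proof (induction J arbitrary: I A rule: finite_induct)
  case empty
  then obtain i where "i \<in> I" by (metis all_not_in_conv card.empty less_irrefl)
  then show ?case by (intro exI[of _ "\<lambda>_. 1"]) auto
next
  case (insert j J)
  show ?case
  proof (cases "\<forall>i\<in>I. A j i = 0")
    case True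
    obtain x where "\<exists>i\<in>I. x i \<noteq> 0" "\<forall>j\<in>J. (\<Sum>i\<in>I. A j i * x i) = 0"
      using insert.IH[of I A] insert.prems insert.hyps by auto
    then show ?thesis using True by (intro exI[of _ x]) auto
  next
    case False
    then obtain k where k: "k \<in> I" "A j k \<noteq> 0" by blast
    obtain x where x: "\<exists>i\<in>I - {k}. x i \<noteq> 0"
      "\<forall>j'\<in>J. (\<Sum>i\<in>I - {k}. (A j' i - A j' k * A j i / A j k) * x i) = 0"
    proof -
      have "card J < card (I - {k})" "finite (I - {k})"
        using insert.prems insert.hyps k by (auto simp: card_Diff_singleton)
      from insert.IH[OF this(2,1), of "\<lambda>j' i. A j' i - A j' k * A j i / A j k"]
      show ?thesis using that by blast
    qed
    \<comment> \<open>Back substitution: the value at \<open>k\<close> is the one that solves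
      equation \<open>j\<close>.\<close>
    define y where "y = x(k := - (\<Sum>i\<in>I - {k}. A j i * x i) / A j k)"
    have y: "(\<Sum>i\<in>I. A j' i * y i) = A j' k * y k + (\<Sum>i\<in>I - {k}. A j' i * x i)" for j'
      using k insert.prems by (simp add: sum.remove[of I k] y_def)
    have "(\<Sum>i\<in>I. A j' i * y i) = 0" if "j' \<in> J" for j'
    proof -
      have "0 = (\<Sum>i\<in>I - {k}. A j' i * x i) - A j' k / A j k * (\<Sum>i\<in>I - {k}. A j i * x i)"
        using x(2)[rule_format, OF that]
        by (simp add: sum_distrib_left sum_subtractf algebra_simps)
      then show ?thesis unfolding y by (simp add: y_def)
    qed
    moreover have "(\<Sum>i\<in>I. A j i * y i) = 0"
      unfolding y using k by (simp add: y_def)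
    moreover have "\<exists>i\<in>I. y i \<noteq> 0" using x(1) by (auto simp: y_def)
    ultimately show ?thesis by blast
  qed
qed

text \<open>The difference \<open>fn n - f\<close> solves the equation with potential
  \<open>pn n\<close> and inhomogeneity \<open>(pn n - p) * f\<close>, so the energy bound applies
  with error \<open>\<delta> n * F\<close>.\<close>

lemma lin_ode_limit:
  assumes l: "0 < l" and p: "continuous_on {0..l} p" and f: "lin_ode l p f f'"
    and fn: "\<And>n. lin_ode l (pn n) (fn n) (fn' n)"
    and pn: "\<And>n x. x \<in> {0..l} \<Longrightarrow> \<bar>pn n x - p x\<bar> \<le> \<delta> n" and \<delta>: "\<delta> \<longlonglongrightarrow> 0"
    and init: "(\<lambda>n. fn n 0) \<longlonglongrightarrow> f 0" "(\<lambda>n. fn' n 0) \<longlonglongrightarrow> f' 0"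
    and \<epsilon>: "\<epsilon> > 0"
  shows "\<forall>\<^sub>F n in sequentially. \<forall>x\<in>{0..l}. \<bar>fn n x - f x\<bar> < \<epsilon> \<and> \<bar>fn' n x - f' x\<bar> < \<epsilon>"
proof -
  have "bounded (p ` {0..l})" "bounded (f ` {0..l})"
    using p lin_ode_continuous(1)[OF f] compact_continuous_image compact_imp_bounded by blast+
  then obtain P F where P: "\<And>x. x \<in> {0..l} \<Longrightarrow> \<bar>p x\<bar> \<le> P" and F: "\<And>x. x \<in> {0..l} \<Longrightarrow> \<bar>f x\<bar> \<le> F"
    by (fastforce simp: bounded_iff)
  have P0: "P \<ge> 0" and F0: "F \<ge> 0" using P[of 0] F[of 0] l by auto
  \<comment> \<open>The energy bound at the right end of the interval; P + 1 bounds
    \<open>pn n\<close> as soon as \<open>\<delta> n < 1\<close>.\<close>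
  define E where "E = (\<lambda>n. exp ((P + 1 + 2) * l) * ((fn n 0 - f 0)\<^sup>2 + (fn' n 0 - f' 0)\<^sup>2 + (\<delta> n * F)\<^sup>2 * l))"
  have "E \<longlonglongrightarrow> exp ((P + 1 + 2) * l) * ((f 0 - f 0)\<^sup>2 + (f' 0 - f' 0)\<^sup>2 + (0 * F)\<^sup>2 * l)"
    unfolding E_def by (intro tendsto_intros init \<delta>)
  then have "\<forall>\<^sub>F n in sequentially. E n < \<epsilon>\<^sup>2"
    using \<epsilon> by (intro order_tendstoD) auto
  moreover have "\<forall>\<^sub>F n in sequentially. \<delta> n < 1"
    using \<delta> by (intro order_tendstoD) auto
  ultimately show ?thesis
  proof eventually_elim
    case (elim n)
    show ?case
    proof
      fix x assume x: "x \<in> {0..l}"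
      have "(fn n x - f x)\<^sup>2 + (fn' n x - f' x)\<^sup>2
        \<le> exp ((P + 1 + 2) * x) * ((fn n 0 - f 0)\<^sup>2 + (fn' n 0 - f' 0)\<^sup>2 + (\<delta> n * F)\<^sup>2 * x)"
      proof (rule ode_energy_bound[where h = "\<lambda>y. pn n y * fn n y - p y * f y"])
        fix y assume y: "y \<in> {0..l}"
        show "((\<lambda>x. fn n x - f x) has_real_derivative fn' n y - f' y) (at y within {0..l})"
          "((\<lambda>x. fn' n x - f' x) has_real_derivative pn n y * fn n y - p y * f y) (at y within {0..l})"
          using lin_odeD[OF f y] lin_odeD[OF fn y] by (auto intro: DERIV_diff)
        have "\<bar>pn n y\<bar> \<le> P + 1"
          using pn[OF y, of n] P[OF y] elim(2) by linarith
        then have "\<bar>pn n y * (fn n y - f y)\<bar> \<le> (P + 1) * \<bar>fn n y - f y\<bar>"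
          unfolding abs_mult by (intro mult_right_mono) auto
        moreover have "\<bar>(pn n y - p y) * f y\<bar> \<le> \<delta> n * F"
          unfolding abs_mult using pn[OF y, of n] F[OF y] by (intro mult_mono) auto
        moreover have "pn n y * fn n y - p y * f y = pn n y * (fn n y - f y) + (pn n y - p y) * f y"
          by (simp add: algebra_simps)
        ultimately show "\<bar>pn n y * fn n y - p y * f y\<bar> \<le> (P + 1) * \<bar>fn n y - f y\<bar> + \<delta> n * F"
          by linarith
      qed (use x P0 in auto)
      also have "\<dots> \<le> E n"
        unfolding E_def using x P0 by (intro mult_mono add_mono mult_left_mono order.refl) auto
      finally have "(fn n x - f x)\<^sup>2 + (fn' n x - f' x)\<^sup>2 < \<epsilon>\<^sup>2" using elim by simp
      then have "\<bar>fn n x - f x\<bar>\<^sup>2 < \<epsilon>\<^sup>2" "\<bar>fn' n x - f' x\<bar>\<^sup>2 < \<epsilon>\<^sup>2"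
        using zero_le_power2[of "fn n x - f x"] zero_le_power2[of "fn' n x - f' x"] 
        unfolding power2_abs by linarith+
      then show "\<bar>fn n x - f x\<bar> < \<epsilon> \<and> \<bar>fn' n x - f' x\<bar> < \<epsilon>"
        using \<epsilon> power2_less_imp_less by (metis less_imp_le)
    qed
  qed
qed

text \<open>Uniqueness as a special case of continuous dependence: the constant sequence
  \<open>f\<close> has the initial data of the zero solution and therefore converges to it.\<close>

lemma lin_ode_zero:
  assumes l: "0 < l" and p: "continuous_on {0..l} p" and f: "lin_ode l p f f'"
    and init: "f 0 = 0" "f' 0 = 0" and x: "x \<in> {0..l}"
  shows "f x = 0" "f' x = 0"
proof -
  have "lin_ode l p (\<lambda>_. 0) (\<lambda>_. 0)" by (auto simp: lin_ode_def)
  note lim = lin_ode_limit[OF l p this, where pn = "\<lambda>_. p" and fn = "\<lambda>_. f" and fn' = "\<lambda>_. f'" and \<delta> = "\<lambda>_. 0"]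
  have "\<forall>\<^sub>F n in sequentially. \<forall>x\<in>{0..l}. \<bar>f x - 0\<bar> < \<epsilon> \<and> \<bar>f' x - 0\<bar> < \<epsilon>" if "\<epsilon> > 0" for \<epsilon>
    by (rule lim) (use f init that in simp_all)
  then have "\<bar>f x\<bar> < \<epsilon> \<and> \<bar>f' x\<bar> < \<epsilon>" if "\<epsilon> > 0" for \<epsilon>
    using that x by simp
  from this[of "\<bar>f x\<bar>"] this[of "\<bar>f' x\<bar>"] show "f x = 0" "f' x = 0" by auto
qed

lemma lin_ode_reflect:
  assumes "lin_ode l p f f'"
  shows "lin_ode l (\<lambda>x. p (l - x)) (\<lambda>x. f (l - x)) (\<lambda>x. - f' (l - x))"
  unfolding lin_ode_def
proof (intro ballI conjI)
  fix x assume "x \<in> {0..l}"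
  then have y: "l - x \<in> {0..l}" by auto
  have im: "(\<lambda>x. l - x) ` {0..l} = {0..l}"
    by (simp add: image_diff_atLeastAtMost)
  have d: "((\<lambda>x. l - x) has_real_derivative -1) (at x within {0..l})"
    by (auto intro!: derivative_eq_intros)
  have 1: "((f \<circ> (\<lambda>x. l - x)) has_real_derivative f' (l - x) * -1) (at x within {0..l})"
    by (rule DERIV_image_chain[OF _ d]) (use lin_odeD(1)[OF assms y] im in simp)
  have 2: "((f' \<circ> (\<lambda>x. l - x)) has_real_derivative (p (l - x) * f (l - x)) * -1) (at x within {0..l})"
    by (rule DERIV_image_chain[OF _ d]) (use lin_odeD(2)[OF assms y] im in simp)
  show "((\<lambda>x. f (l - x)) has_real_derivative - f' (l - x)) (at x within {0..l})"
    using 1 by (simp add: o_def)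
  show "((\<lambda>x. - f' (l - x)) has_real_derivative p (l - x) * f (l - x)) (at x within {0..l})"
    using DERIV_minus[OF 2] by (simp add: o_def)
qed

text \<open>Reversing the parametrization moves the data to the left end. This serves leaves that
  are targets of their edge.\<close>

lemma lin_ode_zero_right:
  assumes l: "0 < l" and p: "continuous_on {0..l} p" and f: "lin_ode l p f f'"
    and init: "f l = 0" "f' l = 0" and x: "x \<in> {0..l}"
  shows "f x = 0"
proof -
  have "continuous_on {0..l} (\<lambda>x. p (l - x))"
    by (rule continuous_on_compose2[OF p]) (auto intro!: continuous_intros)
  from lin_ode_zero(1)[OF l this lin_ode_reflect[OF f], of "l - x"] show ?thesis
    using init x by auto
qed

lemma finite_bounded_subsequence:
  fixes x :: "nat \<Rightarrow> 'i \<Rightarrow> real"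
  assumes "finite I" "\<And>n i. i \<in> I \<Longrightarrow> \<bar>x n i\<bar> \<le> B"
  shows "\<exists>r z. strict_mono (r :: nat \<Rightarrow> nat) \<and> (\<forall>i\<in>I. (\<lambda>n. x (r n) i) \<longlonglongrightarrow> z i)"
  using assms
proof (induction I rule: finite_induct)
  case empty
  show ?case by (intro exI[of _ id]) (auto simp: strict_mono_def)
next
  case (insert i I)
  then obtain r z where r: "strict_mono (r :: nat \<Rightarrow> nat)" "\<forall>i\<in>I. (\<lambda>n. x (r n) i) \<longlonglongrightarrow> z i"
    by auto
  have "bounded (range (\<lambda>n. x (r n) i))"
    unfolding bounded_iff using insert.prems by (intro exI[of _ B]) auto
  then obtain y s where s: "strict_mono s" "((\<lambda>n. x (r n) i) \<circ> s) \<longlonglongrightarrow> y"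
    using bounded_imp_convergent_subsequence by blast
  have "(\<lambda>n. x ((r \<circ> s) n) j) \<longlonglongrightarrow> (z(i := y)) j" if "j \<in> insert i I" for j
  proof (cases "j = i")
    case True
    then show ?thesis using s by (simp add: o_def)
  next
    case False
    then have "(\<lambda>n. x (r n) j) \<longlonglongrightarrow> z j" using r that by auto
    from LIMSEQ_subseq_LIMSEQ[OF this s(1)] show ?thesis using False by (simp add: o_def)
  qed
  then show ?case using strict_mono_o[OF r(1) s(1)] by blast
qed

section \<open>Linear equations on a metric graph\<close>

text \<open>The Kirchhoff sum at a single vertex, so that the condition can be imposed everywhere
  except at \<open>v\<close> and its defect at \<open>v\<close> can be measured.\<close>

definition flux :: "('v, 'e) metric_graph \<Rightarrow> ('e \<Rightarrow> real \<Rightarrow> real) \<Rightarrow> 'v \<Rightarrow> real" where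
  "flux G u' v = (\<Sum>e\<in>{e \<in> edges G. esrc G e = v}. u' e 0) +
     (\<Sum>e\<in>{e \<in> edges G. etgt G e = v}. - u' e (elen G e))"

lemma kirchhoff_iff_flux: "kirchhoff G u' \<longleftrightarrow> (\<forall>v\<in>vertices G. flux G u' v = 0)"
  by (simp add: kirchhoff_def flux_def)

lemma flux_combine:
  "flux G (\<lambda>e x. a * f e x + b * g e x) v = a * flux G f v + b * flux G g v"
  unfolding flux_def sum_negf by (simp add: sum.distrib sum_distrib_left algebra_simps)

text \<open>The vertex values \<open>h\<close> are kept as separate data: continuity at the vertices
  becomes two linear equations per edge, and solutions can be handled before any function on the
  glued space exists.\<close>

definition graph_ode :: "('v, 'e) metric_graph \<Rightarrow> ('e \<Rightarrow> real \<Rightarrow> real) \<Rightarrow> ('v \<Rightarrow> real) \<Rightarrow>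
    ('e \<Rightarrow> real \<Rightarrow> real) \<Rightarrow> ('e \<Rightarrow> real \<Rightarrow> real) \<Rightarrow> bool" where
  "graph_ode G p h f f' \<longleftrightarrow> (\<forall>e\<in>edges G. lin_ode (elen G e) (p e) (f e) (f' e) \<and>
     f e 0 = h (esrc G e) \<and> f e (elen G e) = h (etgt G e))"

lemma graph_ode_combine:
  assumes "graph_ode G p h f f'" "graph_ode G p k g g'"
  shows "graph_ode G p (\<lambda>v. a * h v + b * k v) (\<lambda>e x. a * f e x + b * g e x)
    (\<lambda>e x. a * f' e x + b * g' e x)"
  using assms by (auto simp: graph_ode_def intro!: lin_ode_combine)

lemma lborel_integral_continuous:
  fixes f :: "real \<Rightarrow> real"
  assumes "continuous_on {a..b} f"
  shows "(LBINT x:{a..b}. f x) = integral {a..b} f"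
  by (rule set_borel_integral_eq_integral(2)[OF borel_integrable_atLeastAtMost'[OF assms]])

section \<open>Integrals over the edges, summation by parts and Green's identity\<close>

definition edge_integral :: "('v, 'e) metric_graph \<Rightarrow> ('e \<Rightarrow> real \<Rightarrow> real) \<Rightarrow> real" where
  "edge_integral G F = (\<Sum>e\<in>edges G. integral {0..elen G e} (F e))"

definition edge_continuous :: "('v, 'e) metric_graph \<Rightarrow> ('e \<Rightarrow> real \<Rightarrow> real) \<Rightarrow> bool" where
  "edge_continuous G F \<longleftrightarrow> (\<forall>e\<in>edges G. continuous_on {0..elen G e} (F e))"

lemma edge_continuous_intros:
  assumes "edge_continuous G F" "edge_continuous G H"
  shows "edge_continuous G (\<lambda>e x. F e x + H e x)" "edge_continuous G (\<lambda>e x. F e x - H e x)"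
    "edge_continuous G (\<lambda>e x. F e x * H e x)" 
  using assms unfolding edge_continuous_def by (auto intro!: continuous_intros)

lemma edge_continuous_const: "edge_continuous G (\<lambda>e x. c)"
  unfolding edge_continuous_def by auto

lemma edge_continuous_power:
  assumes "edge_continuous G F"
  shows "edge_continuous G (\<lambda>e x. (F e x) ^ n)"
  using assms unfolding edge_continuous_def by (auto intro!: continuous_intros)

lemma graph_ode_continuous:
  assumes "graph_ode G p h f f'"
  shows "edge_continuous G f" "edge_continuous G f'"
  using assms lin_ode_continuous unfolding graph_ode_def edge_continuous_def by blast+

lemmas edge_cont = edge_continuous_intros edge_continuous_const edge_continuous_power

lemma edge_integral_cmult: "edge_integral G (\<lambda>e x. c * F e x) = c * edge_integral G F"
  by (simp add: edge_integral_def sum_distrib_left)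

lemma edge_integral_diff:
  assumes "edge_continuous G F" "edge_continuous G H"
  shows "edge_integral G (\<lambda>e x. F e x - H e x) = edge_integral G F - edge_integral G H"
  using assms unfolding edge_integral_def edge_continuous_def sum_subtractf[symmetric]
  by (intro sum.cong integral_diff refl) (auto intro: integrable_continuous_real)

lemma edge_integral_mono:
  assumes "edge_continuous G F" "edge_continuous G H"
    "\<And>e x. e \<in> edges G \<Longrightarrow> x \<in> {0..elen G e} \<Longrightarrow> F e x \<le> H e x"
  shows "edge_integral G F \<le> edge_integral G H"
  using assms unfolding edge_integral_def edge_continuous_def
  by (intro sum_mono integral_le) (auto intro: integrable_continuous_real)

lemma edge_integral_cong:
  assumes "\<And>e x. e \<in> edges G \<Longrightarrow> x \<in> {0..elen G e} \<Longrightarrow> F e x = H e x"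
  shows "edge_integral G F = edge_integral G H"
  using assms unfolding edge_integral_def by (intro sum.cong integral_cong) auto

locale connected_graph =
  fixes G :: "('v, 'e) metric_graph"
  assumes compact_metric_graph: "compact_metric_graph G"
begin

lemma finite_edges: "finite (edges G)" and elen_pos: "e \<in> edges G \<Longrightarrow> 0 < elen G e"
  using compact_metric_graph by (auto simp: compact_metric_graph_def)

lemma finite_vertices: "finite (vertices G)"
  using finite_edges by (simp add: vertices_def)

lemma endpoint_vertices: "e \<in> edges G \<Longrightarrow> esrc G e \<in> vertices G" "e \<in> edges G \<Longrightarrow> etgt G e \<in> vertices G"
  by (auto simp: vertices_def)

lemma edge_integral_const: "edge_integral G (\<lambda>e x. c) = c * total_length G"
  unfolding edge_integral_def total_length_def sum_distrib_left
  using elen_pos by (intro sum.cong) (auto simp: less_imp_le)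

lemma graph_integral_eq_edge_integral:
  assumes "edge_continuous G (\<lambda>e x. F (pt G e x))"
  shows "graph_integral G F = edge_integral G (\<lambda>e x. F (pt G e x))"
  using assms unfolding graph_integral_def edge_integral_def
  by (intro sum.cong refl) (simp add: lborel_integral_continuous edge_continuous_def)

lemma edge_integral_abs_bound:
  assumes "edge_continuous G F" "\<And>e x. e \<in> edges G \<Longrightarrow> x \<in> {0..elen G e} \<Longrightarrow> \<bar>F e x\<bar> \<le> B"
  shows "\<bar>edge_integral G F\<bar> \<le> B * total_length G"
proof -
  have B: "F e x \<le> B" "- B \<le> F e x" if "e \<in> edges G" "x \<in> {0..elen G e}" for e x
    using assms(2)[OF that] by linarith+
  have "edge_integral G F \<le> edge_integral G (\<lambda>_ _. B)"
    by (rule edge_integral_mono[OF assms(1) edge_continuous_const B(1)])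
  moreover have "edge_integral G (\<lambda>_ _. - B) \<le> edge_integral G F"
    by (rule edge_integral_mono[OF edge_continuous_const assms(1) B(2)])
  ultimately show ?thesis unfolding edge_integral_const by simp
qed

lemma edge_integral_pos:
  assumes F: "edge_continuous G F" and nonneg: "\<And>e x. e \<in> edges G \<Longrightarrow> x \<in> {0..elen G e} \<Longrightarrow> 0 \<le> F e x"
    and e: "e \<in> edges G" "x \<in> {0..elen G e}" "F e x \<noteq> 0"
  shows "0 < edge_integral G F"
  unfolding edge_integral_def
proof (rule sum_pos2[OF finite_edges e(1)])
  have i: "0 \<le> integral {0..elen G e} (F e)" if "e \<in> edges G" for e
    using F nonneg that by (intro integral_nonneg integrable_continuous_real) (auto simp: edge_continuous_def)
  moreover have "integral {0..elen G e} (F e) \<noteq> 0"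
    using integral_eq_0_iff[of 0 "elen G e" "F e"] F nonneg e elen_pos by (auto simp: edge_continuous_def)
  ultimately show "0 < integral {0..elen G e} (F e)" using e(1) by fastforce
  show "0 \<le> integral {0..elen G e} (F e)" if "e \<in> edges G" for e using i that .
qed

text \<open>Regroups the edge ends by the vertex they belong to; a loop contributes two terms at its
  vertex. The minus sign arises because \<open>flux\<close> takes derivatives away from the
  vertex.\<close>

lemma boundary_sum:
  "(\<Sum>e\<in>edges G. g e (elen G e) * h (etgt G e) - g e 0 * h (esrc G e))
    = - (\<Sum>w\<in>vertices G. flux G g w * h w)"
proof -
  have 1: "(\<Sum>e\<in>edges G. g e 0 * h (esrc G e))
      = (\<Sum>w\<in>vertices G. \<Sum>e\<in>{e \<in> edges G. esrc G e = w}. g e 0 * h w)"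
    using sum.group[OF finite_edges finite_vertices, of "esrc G" "\<lambda>e. g e 0 * h (esrc G e)"]
    by (auto simp: vertices_def)
  have 2: "(\<Sum>e\<in>edges G. g e (elen G e) * h (etgt G e))
      = (\<Sum>w\<in>vertices G. \<Sum>e\<in>{e \<in> edges G. etgt G e = w}. g e (elen G e) * h w)"
    using sum.group[OF finite_edges finite_vertices, of "etgt G" "\<lambda>e. g e (elen G e) * h (etgt G e)"]
    by (auto simp: vertices_def)
  show ?thesis
    unfolding sum_subtractf 1 2
    by (simp add: flux_def sum_negf sum_distrib_right distrib_right left_diff_distrib sum_subtractf sum.distrib)
qed

lemma edge_integral_derivative:
  assumes "\<And>e x. e \<in> edges G \<Longrightarrow> x \<in> {0..elen G e} \<Longrightarrow>
    (F e has_real_derivative F' e x) (at x within {0..elen G e})"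
  shows "edge_integral G F' = (\<Sum>e\<in>edges G. F e (elen G e) - F e 0)"
  unfolding edge_integral_def
proof (intro sum.cong refl integral_unique fundamental_theorem_of_calculus)
  fix e assume e: "e \<in> edges G"
  then show "0 \<le> elen G e" using elen_pos by (simp add: less_imp_le)
  fix x assume "x \<in> {0..elen G e}"
  then show "(F e has_vector_derivative F' e x) (at x within {0..elen G e})"
    using assms e by (simp add: has_real_derivative_iff_has_vector_derivative)
qed

text \<open>The Wronskian f' g - g' f has derivative (p - q) f g. If both functions satisfy all
  Kirchhoff conditions, this yields orthogonality; if a condition is dropped at one vertex, it
  computes the flux there.\<close>

lemma green:
  assumes 1: "graph_ode G p h f f'" and 2: "graph_ode G q k g g'"
  shows "edge_integral G (\<lambda>e x. (p e x - q e x) * f e x * g e x)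
    = (\<Sum>w\<in>vertices G. flux G g' w * h w) - (\<Sum>w\<in>vertices G. flux G f' w * k w)"
proof -
  have "edge_integral G (\<lambda>e x. (p e x - q e x) * f e x * g e x)
    = (\<Sum>e\<in>edges G. (f' e (elen G e) * g e (elen G e) - g' e (elen G e) * f e (elen G e))
        - (f' e 0 * g e 0 - g' e 0 * f e 0))"
  proof (rule edge_integral_derivative)
    fix e x assume e: "e \<in> edges G" and x: "x \<in> {0..elen G e}"
    have l: "lin_ode (elen G e) (p e) (f e) (f' e)" "lin_ode (elen G e) (q e) (g e) (g' e)"
      using 1 2 e by (auto simp: graph_ode_def)
    note d = lin_odeD[OF l(1) x] lin_odeD[OF l(2) x]
    show "((\<lambda>x. f' e x * g e x - g' e x * f e x) has_real_derivative
        (p e x - q e x) * f e x * g e x) (at x within {0..elen G e})"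
      by (rule DERIV_cong[OF DERIV_diff[OF DERIV_mult[OF d(2) d(3)] DERIV_mult[OF d(4) d(1)]]])
        (simp add: algebra_simps)
  qed
  also have "\<dots> = (\<Sum>e\<in>edges G. f' e (elen G e) * k (etgt G e) - f' e 0 * k (esrc G e))
     - (\<Sum>e\<in>edges G. g' e (elen G e) * h (etgt G e) - g' e 0 * h (esrc G e))"
    using 1 2 unfolding sum_subtractf[symmetric]
    by (intro sum.cong refl) (simp add: graph_ode_def mult.commute)
  finally show ?thesis unfolding boundary_sum by simp
qed

text \<open>By uniqueness on each edge, the vertex values and the initial slopes are a complete
  finite set of coordinates for a solution. Nonvanishing functions and nonvanishing data can thus be
  exchanged.\<close>

lemma graph_ode_zero_iff:
  assumes p: "edge_continuous G p" and s: "graph_ode G p h f f'"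
  shows "(\<forall>w\<in>vertices G. h w = 0) \<and> (\<forall>e\<in>edges G. f' e 0 = 0) \<longleftrightarrow> 
    (\<forall>e\<in>edges G. \<forall>x\<in>{0..elen G e}. f e x = 0)" (is "?L \<longleftrightarrow> ?R")
proof
  assume L: ?L
  show ?R
  proof (intro ballI)
    fix e x assume e: "e \<in> edges G" and x: "x \<in> {0..elen G e}"
    show "f e x = 0"
      by (rule lin_ode_zero(1)[OF elen_pos[OF e], of "p e" "f e" "f' e"])
        (use s p e x L endpoint_vertices in \<open>auto simp: graph_ode_def edge_continuous_def\<close>)
  qed
next
  assume R: ?R
  have "h w = 0" if "w \<in> vertices G" for w
    using that R s elen_pos by (force simp: vertices_def graph_ode_def less_imp_le)
  moreover have "f' e 0 = 0" if e: "e \<in> edges G" for e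
  proof -
    have l: "lin_ode (elen G e) (p e) (f e) (f' e)" and pos: "0 < elen G e" using s e elen_pos by (auto simp: graph_ode_def)
    have "(f e has_real_derivative f' e 0) (at 0 within {0..elen G e})" using lin_odeD[OF l] pos by auto
    moreover have "(f e has_real_derivative 0) (at 0 within {0..elen G e})"
      by (rule has_field_derivative_transform_within[of "\<lambda>_. 0" _ _ _ 1]) (use R e pos in auto)
    moreover have "at 0 within {0..elen G e} \<noteq> bot"
      using pos by (simp add: at_within_Icc_at_right)
    ultimately show ?thesis by (rule has_field_derivative_unique)
  qed
  ultimately show ?L by blast
qed

end

section \<open>Solutions with one Kirchhoff condition dropped, and their compactness\<close>

context connected_graph
begin

lemma edge_continuous_bounded:
  assumes "edge_continuous G F"
  shows "\<exists>B>0. \<forall>e\<in>edges G. \<forall>x\<in>{0..elen G e}. \<bar>F e x\<bar> \<le> B"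
proof -
  have "\<exists>B. \<forall>x\<in>{0..elen G e}. \<bar>F e x\<bar> \<le> B" if "e \<in> edges G" for e
  proof -
    have "bounded (F e ` {0..elen G e})"
      using assms that compact_continuous_image compact_imp_bounded
      unfolding edge_continuous_def by blast
    then show ?thesis by (auto simp: bounded_iff)
  qed
  then obtain B where B: "\<And>e x. e \<in> edges G \<Longrightarrow> x \<in> {0..elen G e} \<Longrightarrow> \<bar>F e x\<bar> \<le> B e"
    by metis
  have "\<bar>F e x\<bar> \<le> 1 + (\<Sum>e\<in>edges G. \<bar>B e\<bar>)" if "e \<in> edges G" "x \<in> {0..elen G e}" for e x
    using B[OF that] member_le_sum[OF that(1) _ finite_edges, of "\<lambda>e. \<bar>B e\<bar>"] by auto
  then show ?thesis
    by (intro exI[of _ "1 + (\<Sum>e\<in>edges G. \<bar>B e\<bar>)"]) (auto intro: add_pos_nonneg sum_nonneg)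
qed

text \<open>
  The unknowns are the values at the vertices and the derivatives at the start of each edge; the equations
  are the matching condition at the end of each edge and the Kirchhoff conditions. Without the condition
  at \<open>v\<close> there is one equation fewer than there are unknowns.
\<close>

lemma exists_nontrivial_solution:
  assumes p: "edge_continuous G p" and v: "v \<in> vertices G"
  obtains h f f' where "graph_ode G p h f f'" "\<And>w. w \<in> vertices G - {v} \<Longrightarrow> flux G f' w = 0"
    "(\<exists>w\<in>vertices G. h w \<noteq> 0) \<or> (\<exists>e\<in>edges G. f' e 0 \<noteq> 0)"
proof -
  let ?E = "edges G" and ?V = "vertices G"
  have "\<forall>e\<in>?E. \<exists>c c'. lin_ode (elen G e) (p e) c c' \<and> c 0 = 1 \<and> c' 0 = 0"
    "\<forall>e\<in>?E. \<exists>c c'. lin_ode (elen G e) (p e) c c' \<and> c 0 = 0 \<and> c' 0 = 1"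
    using lin_ode_exists elen_pos p unfolding edge_continuous_def by blast+
  then obtain C C' D D' where
    C: "\<And>e. e \<in> ?E \<Longrightarrow> lin_ode (elen G e) (p e) (C e) (C' e) \<and> C e 0 = 1 \<and> C' e 0 = 0" and
    D: "\<And>e. e \<in> ?E \<Longrightarrow> lin_ode (elen G e) (p e) (D e) (D' e) \<and> D e 0 = 0 \<and> D' e 0 = 1"
    by metis
  \<comment> \<open>Columns are the unknowns: vertex values (\<open>Inl\<close>) and initial slopes
    (\<open>Inr\<close>). Row \<open>Inl e\<close> says that the combination of the fundamental
    solutions \<open>C e\<close> and \<open>D e\<close> reaches the value prescribed at the target;
    row \<open>Inr w\<close> is the flux at \<open>w\<close>. Writing the entries as differences of
    conditionals also covers loops.\<close>
  define A :: "'e + 'v \<Rightarrow> 'v + 'e \<Rightarrow> real" where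
    "A = (\<lambda>j i. case j of
       Inl e \<Rightarrow> (case i of
         Inl w \<Rightarrow> (if w = esrc G e then C e (elen G e) else 0) - (if w = etgt G e then 1 else 0)
       | Inr e' \<Rightarrow> (if e' = e then D e (elen G e) else 0))
     | Inr w \<Rightarrow> (case i of
         Inl w' \<Rightarrow> - (\<Sum>e\<in>{e \<in> ?E. etgt G e = w}. if w' = esrc G e then C' e (elen G e) else 0)
       | Inr e \<Rightarrow> (if esrc G e = w then 1 else 0) - (if etgt G e = w then D' e (elen G e) else 0)))"
  have "card (?E <+> (?V - {v})) < card (?V <+> ?E)"
    using finite_edges finite_vertices v card_gt_0_iff[of ?V]
    by (auto simp: card_Plus card_Diff_singleton)
  moreover have "finite (?E <+> (?V - {v}))" "finite (?V <+> ?E)"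
    using finite_edges finite_vertices by auto
  ultimately obtain x where x0: "\<exists>i\<in>?V <+> ?E. x i \<noteq> 0"
    and x: "\<And>j. j \<in> ?E <+> (?V - {v}) \<Longrightarrow> (\<Sum>i\<in>?V <+> ?E. A j i * x i) = 0"
    using underdetermined_system[of "?E <+> (?V - {v})" "?V <+> ?E" A] by blast
  define h b where "h = (\<lambda>w. x (Inl w))" and "b = (\<lambda>e. x (Inr e))"
  define f where "f = (\<lambda>e y. h (esrc G e) * C e y + b e * D e y)"
  define f' where "f' = (\<lambda>e y. h (esrc G e) * C' e y + b e * D' e y)"
  have S: "(\<Sum>i\<in>?V <+> ?E. A j i * x i) = (\<Sum>w\<in>?V. A j (Inl w) * h w) + (\<Sum>e\<in>?E. A j (Inr e) * b e)" for j
    using finite_edges finite_vertices by (simp add: sum.Plus h_def b_def)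
  have "f e (elen G e) = h (etgt G e)" if e: "e \<in> ?E" for e
  proof -
    have "(\<Sum>w\<in>?V. A (Inl e) (Inl w) * h w) = C e (elen G e) * h (esrc G e) - h (etgt G e)"
      using endpoint_vertices[OF e] finite_vertices
      by (simp add: A_def left_diff_distrib sum_subtractf if_distrib[of "\<lambda>c. c * _"] cong: if_cong)
    moreover have "(\<Sum>e'\<in>?E. A (Inl e) (Inr e') * b e') = D e (elen G e) * b e"
      using e finite_edges by (simp add: A_def if_distrib[of "\<lambda>c. c * _"] cong: if_cong)
    ultimately show ?thesis
      using x[OF InlI[OF e]] unfolding S by (simp add: f_def algebra_simps)
  qed
  then have sol: "graph_ode G p h f f'"
    unfolding graph_ode_def f_def f'_def using C D by (auto intro!: lin_ode_combine)
  have "flux G f' w = 0" if w: "w \<in> ?V - {v}" for w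
  proof -
    have "(\<Sum>w'\<in>?V. A (Inr w) (Inl w') * h w')
        = - (\<Sum>e\<in>{e \<in> ?E. etgt G e = w}. \<Sum>w'\<in>?V. if w' = esrc G e then C' e (elen G e) * h w' else 0)"
      by (subst sum.swap) (auto simp: A_def sum_distrib_right sum_negf intro!: sum.cong)
    also have "\<dots> = - (\<Sum>e\<in>{e \<in> ?E. etgt G e = w}. C' e (elen G e) * h (esrc G e))"
      using endpoint_vertices finite_vertices by (auto intro!: sum.cong)
    finally have 1: "(\<Sum>w'\<in>?V. A (Inr w) (Inl w') * h w') = \<dots>" .
    have 2: "(\<Sum>e\<in>?E. A (Inr w) (Inr e) * b e) = (\<Sum>e\<in>{e \<in> ?E. esrc G e = w}. b e)
        - (\<Sum>e\<in>{e \<in> ?E. etgt G e = w}. D' e (elen G e) * b e)"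
      using finite_edges
      by (simp add: A_def left_diff_distrib sum_subtractf sum.inter_filter if_distrib[of "\<lambda>c. c * _"] cong: if_cong)
    have "flux G f' w = (\<Sum>e\<in>{e \<in> ?E. esrc G e = w}. b e)
        - (\<Sum>e\<in>{e \<in> ?E. etgt G e = w}. C' e (elen G e) * h (esrc G e) + D' e (elen G e) * b e)"
    proof -
      have "(\<Sum>e\<in>{e \<in> ?E. esrc G e = w}. f' e 0) = (\<Sum>e\<in>{e \<in> ?E. esrc G e = w}. b e)"
        using C D by (intro sum.cong) (auto simp: f'_def)
      then show ?thesis unfolding flux_def sum_negf by (simp add: f'_def mult.commute)
    qed
    then show ?thesis
      using x[OF InrI[OF w]] unfolding S 1 2 by (simp add: sum.distrib)
  qed
  moreover have "f' e 0 = b e" if "e \<in> ?E" for e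
    using C D that by (simp add: f'_def)
  then have "(\<exists>w\<in>?V. h w \<noteq> 0) \<or> (\<exists>e\<in>?E. f' e 0 \<noteq> 0)"
    using x0 by (auto simp: h_def b_def)
  ultimately show thesis using that sol by blast
qed

text \<open>The squared Euclidean norm of the data that determine a solution. Normalizing it to 1
  keeps limits of solutions from degenerating to 0.\<close>

definition data_norm :: "('v \<Rightarrow> real) \<Rightarrow> ('e \<Rightarrow> real \<Rightarrow> real) \<Rightarrow> real" where
  "data_norm h f' = (\<Sum>w\<in>vertices G. (h w)\<^sup>2) + (\<Sum>e\<in>edges G. (f' e 0)\<^sup>2)"

lemma data_norm_nonneg: "data_norm h f' \<ge> 0"
  by (auto simp: data_norm_def intro!: add_nonneg_nonneg sum_nonneg)

lemma data_norm_eq_0_iff: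
  "data_norm h f' = 0 \<longleftrightarrow> (\<forall>w\<in>vertices G. h w = 0) \<and> (\<forall>e\<in>edges G. f' e 0 = 0)"
  using finite_edges finite_vertices
  by (auto simp: data_norm_def add_nonneg_eq_0_iff sum_nonneg sum_nonneg_eq_0_iff)

lemma normalize_solution:
  assumes "graph_ode G p h f f'" "data_norm h f' \<noteq> 0"
  obtains c where "graph_ode G p (\<lambda>w. c * h w) (\<lambda>e x. c * f e x) (\<lambda>e x. c * f' e x)"
    "data_norm (\<lambda>w. c * h w) (\<lambda>e x. c * f' e x) = 1"
proof
  define c where "c = 1 / sqrt (data_norm h f')"
  show "graph_ode G p (\<lambda>w. c * h w) (\<lambda>e x. c * f e x) (\<lambda>e x. c * f' e x)"
    using graph_ode_combine[OF assms(1) assms(1), of c 0] by simp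
  have "data_norm (\<lambda>w. c * h w) (\<lambda>e x. c * f' e x) = c\<^sup>2 * data_norm h f'"
    by (simp add: data_norm_def power_mult_distrib sum_distrib_left distrib_left)
  also have "\<dots> = 1"
    using assms(2) data_norm_nonneg[of h f'] by (simp add: c_def power_divide)
  finally show "data_norm (\<lambda>w. c * h w) (\<lambda>e x. c * f' e x) = 1" .
qed

text \<open>The data lie on the unit sphere of a finite-dimensional space, so a subsequence of them
  converges, and continuous dependence upgrades this to uniform convergence of the solutions and
  their derivatives.\<close>

lemma solution_subsequence:
  assumes p: "edge_continuous G p"
    and sol: "\<And>n. graph_ode G (pn n) (hn n) (fn n) (fn' n)"
    and norm: "\<And>n. data_norm (hn n) (fn' n) = 1"
    and pn: "\<And>n e x. e \<in> edges G \<Longrightarrow> x \<in> {0..elen G e} \<Longrightarrow> \<bar>pn n e x - p e x\<bar> \<le> \<delta> n"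
    and \<delta>: "\<delta> \<longlonglongrightarrow> 0"
  obtains r h f f' where "strict_mono (r :: nat \<Rightarrow> nat)" "graph_ode G p h f f'" "data_norm h f' = 1"
    "\<And>w. w \<in> vertices G \<Longrightarrow> (\<lambda>n. hn (r n) w) \<longlonglongrightarrow> h w"
    "\<And>\<epsilon>. \<epsilon> > 0 \<Longrightarrow> \<forall>\<^sub>F n in sequentially. \<forall>e\<in>edges G. \<forall>x\<in>{0..elen G e}.
        \<bar>fn (r n) e x - f e x\<bar> < \<epsilon> \<and> \<bar>fn' (r n) e x - f' e x\<bar> < \<epsilon>"
proof -
  define X where "X = (\<lambda>n. case_sum (hn n) (\<lambda>e. fn' n e 0))"
  have "\<bar>X n i\<bar> \<le> 1" if i: "i \<in> vertices G <+> edges G" for n i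
  proof -
    have "(X n i)\<^sup>2 \<le> (\<Sum>i\<in>vertices G <+> edges G. (X n i)\<^sup>2)"
      using finite_vertices finite_edges i by (intro member_le_sum) auto
    also have "\<dots> = data_norm (hn n) (fn' n)"
      using finite_vertices finite_edges by (simp add: sum.Plus data_norm_def X_def)
    finally show ?thesis using norm by (simp add: abs_square_le_1)
  qed
  then have "\<exists>r z. strict_mono (r :: nat \<Rightarrow> nat) \<and> (\<forall>i\<in>vertices G <+> edges G. (\<lambda>n. X (r n) i) \<longlonglongrightarrow> z i)"
    by (intro finite_bounded_subsequence finite_Plus finite_vertices finite_edges)
  then obtain r z where r: "strict_mono (r :: nat \<Rightarrow> nat)"
    and z: "\<forall>i\<in>vertices G <+> edges G. (\<lambda>n. X (r n) i) \<longlonglongrightarrow> z i"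
    by (elim exE conjE)
  define h where "h = (\<lambda>w. z (Inl w))"
  have h: "(\<lambda>n. hn (r n) w) \<longlonglongrightarrow> h w" if "w \<in> vertices G" for w
    using bspec[OF z InlI[OF that]] by (simp add: h_def X_def)
  have "\<forall>e\<in>edges G. \<exists>f f'. lin_ode (elen G e) (p e) f f' \<and> f 0 = h (esrc G e) \<and> f' 0 = z (Inr e)"
    using lin_ode_exists elen_pos p unfolding edge_continuous_def by blast
  then obtain f f' where f: "\<And>e. e \<in> edges G \<Longrightarrow>
      lin_ode (elen G e) (p e) (f e) (f' e) \<and> f e 0 = h (esrc G e) \<and> f' e 0 = z (Inr e)"
    by metis
  have b: "(\<lambda>n. fn' (r n) e 0) \<longlonglongrightarrow> f' e 0" if "e \<in> edges G" for e
    using bspec[OF z InrI[OF that]] that f by (simp add: X_def)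
  have edge: "\<forall>\<^sub>F n in sequentially. \<forall>x\<in>{0..elen G e}.
        \<bar>fn (r n) e x - f e x\<bar> < \<epsilon> \<and> \<bar>fn' (r n) e x - f' e x\<bar> < \<epsilon>"
    if e: "e \<in> edges G" and "\<epsilon> > 0" for e \<epsilon>
  proof (rule lin_ode_limit[OF elen_pos[OF e], where \<delta> = "\<delta> \<circ> r"])
    show "(\<delta> \<circ> r) \<longlonglongrightarrow> 0" using LIMSEQ_subseq_LIMSEQ[OF \<delta> r] .
    show "(\<lambda>n. fn (r n) e 0) \<longlonglongrightarrow> f e 0"
      using sol e f h[OF endpoint_vertices(1)[OF e]] by (simp add: graph_ode_def)
    show "lin_ode (elen G e) (pn (r n) e) (fn (r n) e) (fn' (r n) e)" for n
      using sol e by (simp add: graph_ode_def)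
  qed (use p f b e pn that in \<open>auto simp: edge_continuous_def\<close>)
  \<comment> \<open>The limit functions were built from data at the starts of the edges only;
    matching at the far ends is inherited from the approximants.\<close>
  have "f e (elen G e) = h (etgt G e)" if e: "e \<in> edges G" for e
  proof (rule LIMSEQ_unique)
    show "(\<lambda>n. fn (r n) e (elen G e)) \<longlonglongrightarrow> h (etgt G e)"
      using sol e h[OF endpoint_vertices(2)[OF e]] by (simp add: graph_ode_def)
    show "(\<lambda>n. fn (r n) e (elen G e)) \<longlonglongrightarrow> f e (elen G e)"
    proof (rule tendstoI)
      fix \<epsilon> :: real assume "\<epsilon> > 0"
      from edge[OF e this] show "\<forall>\<^sub>F n in sequentially. dist (fn (r n) e (elen G e)) (f e (elen G e)) < \<epsilon>"
        by eventually_elim (use elen_pos[OF e] in \<open>auto simp: dist_real_def less_imp_le\<close>)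
    qed
  qed
  then have "graph_ode G p h f f'" using f by (simp add: graph_ode_def)
  moreover have "data_norm h f' = 1"
  proof (rule LIMSEQ_unique)
    show "(\<lambda>n. data_norm (hn (r n)) (fn' (r n))) \<longlonglongrightarrow> data_norm h f'"
      unfolding data_norm_def by (intro tendsto_intros h b)
    show "(\<lambda>n. data_norm (hn (r n)) (fn' (r n))) \<longlonglongrightarrow> 1" by (simp add: norm)
  qed
  moreover have "\<forall>\<^sub>F n in sequentially. \<forall>e\<in>edges G. \<forall>x\<in>{0..elen G e}.
        \<bar>fn (r n) e x - f e x\<bar> < \<epsilon> \<and> \<bar>fn' (r n) e x - f' e x\<bar> < \<epsilon>" if "\<epsilon> > 0" for \<epsilon>
    using edge that finite_edges by (intro eventually_ball_finite) auto
  ultimately show thesis using that r h by blast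
qed

lemma flux_tendsto:
  assumes "\<And>\<epsilon>. \<epsilon> > 0 \<Longrightarrow> \<forall>\<^sub>F n in sequentially. \<forall>e\<in>edges G. \<forall>x\<in>{0..elen G e}.
      \<bar>gn n e x - g e x\<bar> < \<epsilon>"
  shows "(\<lambda>n. flux G (gn n) w) \<longlonglongrightarrow> flux G g w"
proof -
  have "(\<lambda>n. gn n e x) \<longlonglongrightarrow> g e x" if "e \<in> edges G" "x \<in> {0..elen G e}" for e x
  proof (rule tendstoI)
    fix \<epsilon> :: real assume "\<epsilon> > 0"
    from assms[OF this] show "\<forall>\<^sub>F n in sequentially. dist (gn n e x) (g e x) < \<epsilon>"
      by eventually_elim (use that in \<open>auto simp: dist_real_def\<close>)
  qed
  then show ?thesis unfolding flux_def
    using elen_pos by (intro tendsto_intros) (auto simp: less_imp_le)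
qed

end

section \<open>Eigenvalue branches\<close>

text \<open>The assumption \<open>nondegenerate\<close> makes the value at \<open>v\<close> a
  coordinate on the eigenspace of \<open>\<mu>\<close>, which is therefore spanned by
  \<open>g\<close>. It takes the place of simplicity of the eigenvalue.\<close>

locale perturbation = connected_graph G for G :: "('v, 'e) metric_graph" +
  fixes \<psi> :: "'e \<Rightarrow> real \<Rightarrow> real" and \<mu> :: real and v :: 'v and k :: "'v \<Rightarrow> real"
    and g g' :: "'e \<Rightarrow> real \<Rightarrow> real"
  assumes \<psi>: "edge_continuous G \<psi>" and v: "v \<in> vertices G"
    and unperturbed: "graph_ode G (\<lambda>e x. - \<mu>) k g g'" "\<And>w. w \<in> vertices G \<Longrightarrow> flux G g' w = 0" "k v = 1"
    and nondegenerate: "\<And>h f f'. graph_ode G (\<lambda>e x. - \<mu>) h f f' \<Longrightarrow>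
      (\<And>w. w \<in> vertices G \<Longrightarrow> flux G f' w = 0) \<Longrightarrow> h v = 0 \<Longrightarrow>
      (\<forall>e\<in>edges G. \<forall>x\<in>{0..elen G e}. f e x = 0)"
begin

abbreviation potential :: "real \<Rightarrow> real \<Rightarrow> 'e \<Rightarrow> real \<Rightarrow> real" where
  "potential t s \<equiv> (\<lambda>e x. t * \<psi> e x - (\<mu> + s))"

lemma potential_continuous: "edge_continuous G (potential t s)"
  by (intro edge_cont \<psi>)

text \<open>At the unperturbed parameter, dropping the condition at \<open>v\<close> adds no
  solutions: Green's identity against \<open>g\<close>, where \<open>k v = 1\<close>, forces the
  flux at \<open>v\<close> to vanish. Subtracting \<open>h v\<close> times \<open>g\<close> then
  leaves an eigenfunction that is 0 at \<open>v\<close>.\<close>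

lemma solution_unique_up_to_scaling:
  assumes s: "graph_ode G (\<lambda>e x. - \<mu>) h f f'" and fl: "\<And>w. w \<in> vertices G - {v} \<Longrightarrow> flux G f' w = 0"
    and e: "e \<in> edges G" "x \<in> {0..elen G e}"
  shows "f e x = h v * g e x"
proof -
  define c where "c = h v"
  have d: "graph_ode G (\<lambda>e x. - \<mu>) (\<lambda>w. 1 * h w + (-c) * k w) (\<lambda>e x. 1 * f e x + (-c) * g e x)
      (\<lambda>e x. 1 * f' e x + (-c) * g' e x)"
    by (rule graph_ode_combine[OF s unperturbed(1)])
  have dfl: "flux G (\<lambda>e x. 1 * f' e x + (-c) * g' e x) w = (if w = v then flux G f' v else 0)"
    if "w \<in> vertices G" for w
    unfolding flux_combine using that fl unperturbed(2) by auto
  have "flux G f' v = 0"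
    using green[OF d unperturbed(1)] dfl unperturbed(2,3) finite_vertices v
    by (simp add: edge_integral_def if_distrib[of "\<lambda>c. c * _"] cong: if_cong)
  then have "\<forall>e\<in>edges G. \<forall>x\<in>{0..elen G e}. 1 * f e x + (-c) * g e x = 0"
    using dfl unperturbed(3) by (intro nondegenerate[OF d]) (auto simp: c_def)
  then show ?thesis using e by (auto simp: c_def)
qed

text \<open>By contradiction: solutions for parameters tending to 0, normalized in
  \<open>data_norm\<close>, subconverge to a multiple of \<open>g\<close>. The multiple is nonzero,
  so they can be rescaled to have value 1 at \<open>v\<close>, and then they converge to
  \<open>g\<close>.\<close>

lemma perturbed_solution_close:
  assumes \<epsilon>: "\<epsilon> > 0"
  shows "\<exists>\<eta>>0. \<forall>s t. \<bar>s\<bar> < \<eta> \<longrightarrow> \<bar>t\<bar> < \<eta> \<longrightarrow> (\<exists>h f f'. graph_ode G (potential t s) h f f' \<and>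
     (\<forall>w\<in>vertices G - {v}. flux G f' w = 0) \<and> h v = 1 \<and>
     (\<forall>e\<in>edges G. \<forall>x\<in>{0..elen G e}. \<bar>f e x - g e x\<bar> \<le> \<epsilon>))" (is "\<exists>\<eta>>0. \<forall>s t. _ \<longrightarrow> _ \<longrightarrow> ?P s t")
proof (rule ccontr)
  assume "\<not> ?thesis"
  moreover define P where "P = (\<lambda>s t. ?P s t)"
  ultimately have neg: "\<not> (\<exists>\<eta>>0. \<forall>s t. \<bar>s\<bar> < \<eta> \<longrightarrow> \<bar>t\<bar> < \<eta> \<longrightarrow> P s t)"
    by simp
  have "\<exists>s t. \<bar>s\<bar> < inverse (real (Suc n)) \<and> \<bar>t\<bar> < inverse (real (Suc n)) \<and> \<not> P s t" for n
    using neg by (metis inverse_positive_iff_positive of_nat_0_less_iff zero_less_Suc)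
  then obtain s t where s: "\<And>n. \<bar>s n\<bar> < inverse (real (Suc n))"
    and t: "\<And>n. \<bar>t n\<bar> < inverse (real (Suc n))" and no: "\<And>n. \<not> P (s n) (t n)"
    by metis
  have "\<exists>h f f'. graph_ode G (potential (t n) (s n)) h f f' \<and>
      (\<forall>w\<in>vertices G - {v}. flux G f' w = 0) \<and> data_norm h f' = 1" for n
  proof -
    obtain h f f' where 1: "graph_ode G (potential (t n) (s n)) h f f'"
      "\<And>w. w \<in> vertices G - {v} \<Longrightarrow> flux G f' w = 0"
      "(\<exists>w\<in>vertices G. h w \<noteq> 0) \<or> (\<exists>e\<in>edges G. f' e 0 \<noteq> 0)"
      by (rule exists_nontrivial_solution[OF potential_continuous[of "t n" "s n"] v]) (rule that)
    then have "data_norm h f' \<noteq> 0" by (auto simp: data_norm_eq_0_iff)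
    then obtain c where c: "graph_ode G (potential (t n) (s n)) (\<lambda>w. c * h w) (\<lambda>e x. c * f e x) (\<lambda>e x. c * f' e x)"
      "data_norm (\<lambda>w. c * h w) (\<lambda>e x. c * f' e x) = 1"
      by (rule normalize_solution[OF 1(1)]) (rule that)
    moreover have "flux G (\<lambda>e x. c * f' e x) w = 0" if "w \<in> vertices G - {v}" for w
      using flux_combine[of G c f' 0 f' w] 1(2)[OF that] by simp
    ultimately show ?thesis by blast
  qed
  then obtain hn fn fn' where sol: "\<And>n. graph_ode G (potential (t n) (s n)) (hn n) (fn n) (fn' n)"
    and fl: "\<And>n w. w \<in> vertices G - {v} \<Longrightarrow> flux G (fn' n) w = 0"
    and norm: "\<And>n. data_norm (hn n) (fn' n) = 1"
    by metis
  obtain \<Psi> where \<Psi>: "\<Psi> > 0" "\<And>e x. e \<in> edges G \<Longrightarrow> x \<in> {0..elen G e} \<Longrightarrow> \<bar>\<psi> e x\<bar> \<le> \<Psi>"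
    using edge_continuous_bounded[OF \<psi>] by auto
  obtain B where B: "B > 0" "\<And>e x. e \<in> edges G \<Longrightarrow> x \<in> {0..elen G e} \<Longrightarrow> \<bar>g e x\<bar> \<le> B"
    using edge_continuous_bounded[OF graph_ode_continuous(1)[OF unperturbed(1)]] by auto
  have bound: "\<bar>potential (t n) (s n) e x - (- \<mu>)\<bar> \<le> inverse (real (Suc n)) * (\<Psi> + 1)"
    if "e \<in> edges G" "x \<in> {0..elen G e}" for n e x
  proof -
    have "\<bar>t n * \<psi> e x\<bar> \<le> inverse (real (Suc n)) * \<Psi>"
      unfolding abs_mult using t[of n] \<Psi>(2)[OF that] by (intro mult_mono) auto
    then show ?thesis using s[of n] by (simp add: distrib_left)
  qed
  have "(\<lambda>n. inverse (real (Suc n)) * (\<Psi> + 1)) \<longlonglongrightarrow> 0 * (\<Psi> + 1)"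
    by (intro tendsto_intros LIMSEQ_inverse_real_of_nat)
  then have lim: "(\<lambda>n. inverse (real (Suc n)) * (\<Psi> + 1)) \<longlonglongrightarrow> 0" by simp
  obtain r h f f' where r: "strict_mono (r :: nat \<Rightarrow> nat)" and lsol: "graph_ode G (\<lambda>e x. - \<mu>) h f f'"
    and lnorm: "data_norm h f' = 1" and hlim: "\<And>w. w \<in> vertices G \<Longrightarrow> (\<lambda>n. hn (r n) w) \<longlonglongrightarrow> h w"
    and flim: "\<And>\<epsilon>. \<epsilon> > 0 \<Longrightarrow> \<forall>\<^sub>F n in sequentially. \<forall>e\<in>edges G. \<forall>x\<in>{0..elen G e}.
        \<bar>fn (r n) e x - f e x\<bar> < \<epsilon> \<and> \<bar>fn' (r n) e x - f' e x\<bar> < \<epsilon>"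
    by (rule solution_subsequence[OF edge_continuous_const sol norm _ lim]) (erule (1) bound, rule that)
  have "flux G f' w = 0" if w: "w \<in> vertices G - {v}" for w
  proof (rule LIMSEQ_unique)
    show "(\<lambda>n. flux G (fn' (r n)) w) \<longlonglongrightarrow> flux G f' w"
    proof (rule flux_tendsto)
      fix \<epsilon> :: real assume "\<epsilon> > 0"
      from flim[OF this] show "\<forall>\<^sub>F n in sequentially. \<forall>e\<in>edges G. \<forall>x\<in>{0..elen G e}. \<bar>fn' (r n) e x - f' e x\<bar> < \<epsilon>"
        by eventually_elim auto
    qed
    show "(\<lambda>n. flux G (fn' (r n)) w) \<longlonglongrightarrow> 0" using fl[OF w] by simp
  qed
  then have scale: "f e x = h v * g e x" if "e \<in> edges G" "x \<in> {0..elen G e}" for e x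
    by (rule solution_unique_up_to_scaling[OF lsol _ that])
  define c where "c = h v"
  \<comment> \<open>If the limit vanished at \<open>v\<close>, it would vanish everywhere, which its
    data norm 1 forbids.\<close>
  have c: "c \<noteq> 0"
  proof
    assume "c = 0"
    then have "data_norm h f' = 0"
      using scale graph_ode_zero_iff[OF edge_continuous_const lsol] by (simp add: data_norm_eq_0_iff c_def)
    with lnorm show False by simp
  qed
  \<comment> \<open>Chosen so that the total error \<open>\<delta> + \<delta> * B\<close> is
    \<epsilon> |c| / 2; division by a value at \<open>v\<close> of modulus above |c| / 2 turns it
    into at most \<epsilon>.\<close>
  define \<delta> where "\<delta> = \<epsilon> * (\<bar>c\<bar> / 2) / (B + 1)"
  have "\<delta> > 0" using c \<epsilon> B(1) by (simp add: \<delta>_def)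
  have "\<forall>\<^sub>F n in sequentially. \<bar>hn (r n) v - c\<bar> < min \<delta> (\<bar>c\<bar> / 2)"
    using tendstoD[OF hlim[OF v, folded c_def], of "min \<delta> (\<bar>c\<bar> / 2)"] \<open>\<delta> > 0\<close> c
    unfolding dist_real_def by (simp del: min_less_iff_conj)
  moreover note flim[OF \<open>\<delta> > 0\<close>]
  ultimately have "\<forall>\<^sub>F n in sequentially. P (s (r n)) (t (r n))"
  proof eventually_elim
    case (elim n)
    define a where "a = hn (r n) v"
    have a: "\<bar>a - c\<bar> < \<delta>" "\<bar>a\<bar> > \<bar>c\<bar> / 2" using elim(1) unfolding a_def by linarith+
    have a0: "a \<noteq> 0" using a(2) c by auto
    have close: "\<bar>fn (r n) e x / a - g e x\<bar> \<le> \<epsilon>" if e: "e \<in> edges G" "x \<in> {0..elen G e}" for e x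
    proof -
      have "\<bar>fn (r n) e x - a * g e x\<bar> = \<bar>(fn (r n) e x - f e x) + (c - a) * g e x\<bar>"
        using scale[OF e] by (simp add: c_def algebra_simps)
      also have "\<dots> \<le> \<bar>fn (r n) e x - f e x\<bar> + \<bar>c - a\<bar> * \<bar>g e x\<bar>"
        by (metis abs_mult abs_triangle_ineq)
      also have "\<dots> \<le> \<delta> + \<delta> * B"
        using bspec[OF bspec[OF elim(2) e(1)] e(2)] a B(2)[OF e] by (intro add_mono mult_mono) auto
      also have "\<dots> = \<delta> * (B + 1)" by (simp add: distrib_left)
      also have "\<dots> = \<epsilon> * (\<bar>c\<bar> / 2)"
        using B(1) by (intro iffD1[OF nonzero_eq_divide_eq _] \<delta>_def) auto
      also have "\<dots> \<le> \<epsilon> * \<bar>a\<bar>" using a \<epsilon> by (intro mult_left_mono) auto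
      finally have "\<bar>fn (r n) e x - a * g e x\<bar> / \<bar>a\<bar> \<le> \<epsilon>" using a0 by (simp add: divide_le_eq)
      moreover have "\<bar>fn (r n) e x - a * g e x\<bar> / \<bar>a\<bar> = \<bar>fn (r n) e x / a - g e x\<bar>"
        using a0 by (simp add: diff_divide_distrib flip: abs_divide)
      ultimately show ?thesis by simp
    qed
    have "graph_ode G (potential (t (r n)) (s (r n))) (\<lambda>w. hn (r n) w / a) (\<lambda>e x. fn (r n) e x / a) (\<lambda>e x. fn' (r n) e x / a)"
      using graph_ode_combine[OF sol[of "r n"] sol[of "r n"], of "1 / a" 0] by simp
    moreover have "flux G (\<lambda>e x. fn' (r n) e x / a) w = 0" if "w \<in> vertices G - {v}" for w
      using flux_combine[of G "1 / a" "fn' (r n)" 0 "fn' (r n)" w] fl[OF that] by simp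
    moreover have "hn (r n) v / a = 1" using a0 by (simp add: a_def)
    ultimately show ?case unfolding P_def using close by blast
  qed
  then show False using no by simp
qed

lemma eigenvalue_branch:
  assumes a: "a * edge_integral G (\<lambda>e x. (g e x)\<^sup>2) < edge_integral G (\<lambda>e x. \<psi> e x * (g e x)\<^sup>2)"
    and b: "edge_integral G (\<lambda>e x. \<psi> e x * (g e x)\<^sup>2) < b * edge_integral G (\<lambda>e x. (g e x)\<^sup>2)"
    and ab: "a \<le> b" and \<epsilon>: "\<epsilon> > 0"
  shows "\<exists>\<eta>>0. \<forall>t. 0 < t \<longrightarrow> t < \<eta> \<longrightarrow> (\<exists>s h f f'. a * t \<le> s \<and> s \<le> b * t \<and>
     graph_ode G (potential t s) h f f' \<and> (\<forall>w\<in>vertices G. flux G f' w = 0) \<and> h v = 1 \<and>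
     (\<forall>e\<in>edges G. \<forall>x\<in>{0..elen G e}. \<bar>f e x - g e x\<bar> \<le> \<epsilon>))"
proof -
  note gc = graph_ode_continuous(1)[OF unperturbed(1)]
  \<comment> \<open>To leading order the flux at \<open>v\<close> for the parameter shift c t is -t
    \<open>I c\<close>, so the signs of \<open>I a\<close> and \<open>I b\<close> decide the signs
    at the two ends.\<close>
  define I where "I = (\<lambda>c. edge_integral G (\<lambda>e x. (\<psi> e x - c) * (g e x)\<^sup>2))"
  have I: "I c = edge_integral G (\<lambda>e x. \<psi> e x * (g e x)\<^sup>2) - c * edge_integral G (\<lambda>e x. (g e x)\<^sup>2)" for c
    unfolding I_def left_diff_distrib
    by (subst edge_integral_diff) (auto intro!: edge_cont \<psi> gc simp: edge_integral_cmult)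
  have Ia: "I a > 0" and Ib: "I b < 0" using a b by (simp_all add: I)
  obtain B where B: "B > 0" "\<And>e x. e \<in> edges G \<Longrightarrow> x \<in> {0..elen G e} \<Longrightarrow> \<bar>g e x\<bar> \<le> B"
    using edge_continuous_bounded[OF gc] by auto
  have "\<exists>C>0. \<forall>e\<in>edges G. \<forall>x\<in>{0..elen G e}. \<bar>(\<psi> e x - c) * g e x\<bar> \<le> C" for c
    by (intro edge_continuous_bounded edge_cont \<psi> gc)
  then obtain C where C0: "\<And>c. C c > 0"
    and C: "\<And>c e x. e \<in> edges G \<Longrightarrow> x \<in> {0..elen G e} \<Longrightarrow> \<bar>(\<psi> e x - c) * g e x\<bar> \<le> C c"
    by metis
  define L where "L = total_length G"
  have L: "L \<ge> 0" unfolding L_def total_length_def using elen_pos by (auto intro!: sum_nonneg simp: less_imp_le)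
  define m where "m = min (I a) (- I b)"
  have m: "m > 0" "m \<le> I a" "m \<le> - I b" using Ia Ib by (auto simp: m_def)
  \<comment> \<open>Replacing one factor \<open>g\<close> by the perturbed solution changes
    \<open>I c\<close> by at most \<open>\<epsilon>' * C c * L\<close>. As \<open>K\<close>
    dominates \<open>C c * L\<close> for both rates, the choice of \<open>\<epsilon>'\<close> below
    keeps this error within half of the margin \<open>m\<close>.\<close>
  define K where "K = (C a + C b) * (L + 1)"
  have K: "K > 0" using C0[of a] C0[of b] L by (auto simp: K_def)
  define \<epsilon>' where "\<epsilon>' = min \<epsilon> (m / (2 * K))"
  have \<epsilon>': "\<epsilon>' > 0" "\<epsilon>' \<le> \<epsilon>" "\<epsilon>' \<le> m / (2 * K)" using \<epsilon> m K by (auto simp: \<epsilon>'_def)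
  have \<epsilon>'L: "\<epsilon>' * C c * L < m" if "c = a \<or> c = b" for c
  proof -
    have "C c \<le> C a + C b" using that C0[of a] C0[of b] by auto
    then have "\<epsilon>' * (C c * L) \<le> \<epsilon>' * K"
      unfolding K_def using \<epsilon>' L C0[of a] C0[of b] by (intro mult_left_mono mult_mono) auto
    also have "\<dots> \<le> m / (2 * K) * K"
      using \<epsilon>' K by (intro mult_right_mono) auto
    also have "\<dots> = m / 2" using K by simp
    also have "\<dots> < m" using m by simp
    finally show ?thesis by (simp add: mult.assoc)
  qed
  obtain \<eta> where \<eta>: "\<eta> > 0" and sol: "\<And>s t. \<bar>s\<bar> < \<eta> \<Longrightarrow> \<bar>t\<bar> < \<eta> \<Longrightarrow> (\<exists>h f f'. graph_ode G (potential t s) h f f' \<and>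
     (\<forall>w\<in>vertices G - {v}. flux G f' w = 0) \<and> h v = 1 \<and>
     (\<forall>e\<in>edges G. \<forall>x\<in>{0..elen G e}. \<bar>f e x - g e x\<bar> \<le> \<epsilon>'))"
    using perturbed_solution_close[OF \<epsilon>'(1)] by auto
  have "\<exists>s h f f'. a * t \<le> s \<and> s \<le> b * t \<and>
     graph_ode G (potential t s) h f f' \<and> (\<forall>w\<in>vertices G. flux G f' w = 0) \<and> h v = 1 \<and>
     (\<forall>e\<in>edges G. \<forall>x\<in>{0..elen G e}. \<bar>f e x - g e x\<bar> \<le> \<epsilon>)"
    if t: "0 < t" "t < \<eta> / (\<bar>a\<bar> + \<bar>b\<bar> + 1)" for t
  proof -
    \<comment> \<open>The divisor |a| + |b| + 1 keeps t itself and every s between a t and b t below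
      \<eta> in modulus.\<close>
    have t\<eta>: "t * (\<bar>a\<bar> + \<bar>b\<bar> + 1) < \<eta>" using t(2) by (simp add: pos_less_divide_eq)
    then have t': "t * \<bar>a\<bar> + t * \<bar>b\<bar> + t < \<eta>" by (simp add: distrib_left)
    have nn: "0 \<le> t * \<bar>a\<bar>" "0 \<le> t * \<bar>b\<bar>" using t(1) by auto
    have s: "\<bar>s\<bar> < \<eta>" if "s \<in> {a * t..b * t}" for s
    proof -
      have "- (t * \<bar>a\<bar>) \<le> a * t" "b * t \<le> t * \<bar>b\<bar>"
        using t(1) abs_ge_minus_self[of a] abs_ge_self[of b] mult_left_mono[of "-a" "\<bar>a\<bar>" t] mult_left_mono[of b "\<bar>b\<bar>" t]
        by (auto simp: mult.commute)
      moreover have "a * t \<le> s" "s \<le> b * t" using that by auto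
      ultimately show ?thesis using t' nn t(1) unfolding abs_less_iff by linarith
    qed
    have "\<bar>t\<bar> < \<eta>" using t' nn t(1) by linarith
    have "\<forall>s\<in>{a * t..b * t}. \<exists>h f f'. graph_ode G (potential t s) h f f' \<and>
       (\<forall>w\<in>vertices G - {v}. flux G f' w = 0) \<and> h v = 1 \<and>
       (\<forall>e\<in>edges G. \<forall>x\<in>{0..elen G e}. \<bar>f e x - g e x\<bar> \<le> \<epsilon>')"
      using sol[OF s \<open>\<bar>t\<bar> < \<eta>\<close>] by blast
    then obtain H F F' where HF: "\<forall>s\<in>{a * t..b * t}. graph_ode G (potential t s) (H s) (F s) (F' s) \<and>
       (\<forall>w\<in>vertices G - {v}. flux G (F' s) w = 0) \<and> H s v = 1 \<and>
       (\<forall>e\<in>edges G. \<forall>x\<in>{0..elen G e}. \<bar>F s e x - g e x\<bar> \<le> \<epsilon>')"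
      unfolding bchoice_iff by (elim exE)
    have H: "graph_ode G (potential t s) (H s) (F s) (F' s)"
      and fl: "w \<in> vertices G - {v} \<Longrightarrow> flux G (F' s) w = 0"
      and Hv: "H s v = 1"
      and close: "e \<in> edges G \<Longrightarrow> x \<in> {0..elen G e} \<Longrightarrow> \<bar>F s e x - g e x\<bar> \<le> \<epsilon>'"
      if "s \<in> {a * t..b * t}" for s w e x
      using bspec[OF HF that] by blast+
    define N where "N = (\<lambda>s. flux G (F' s) v)"
    have sumv: "(\<Sum>w\<in>vertices G. flux G (F' s) w * m w) = N s * m v" if "s \<in> {a * t..b * t}" for s m
      using fl[OF that] finite_vertices v sum.remove[of "vertices G" v "\<lambda>w. flux G (F' s) w * m w"] by (simp add: N_def)
    have cF: "edge_continuous G (F s)" if "s \<in> {a * t..b * t}" for s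
      using graph_ode_continuous(1)[OF H[OF that]] .
    \<comment> \<open>The solutions \<open>F s\<close> are chosen independently for each
      \<open>s\<close>, with no continuity built in. Green's identity between two of them makes
      their fluxes at \<open>v\<close> comparable all the same, because both have value 1
      there.\<close>
    have diff: "N s' - N s = (s' - s) * edge_integral G (\<lambda>e x. F s e x * F s' e x)"
      if ss: "s \<in> {a * t..b * t}" "s' \<in> {a * t..b * t}" for s s'
    proof -
      have "edge_integral G (\<lambda>e x. (potential t s e x - potential t s' e x) * F s e x * F s' e x)
          = edge_integral G (\<lambda>e x. (s' - s) * (F s e x * F s' e x))"
        by (intro edge_integral_cong) (simp add: algebra_simps)
      then show ?thesis
        using green[OF H[OF ss(1)] H[OF ss(2)]] sumv ss Hv by (simp add: edge_integral_cmult)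
    qed
    have lip: "\<bar>N s' - N s\<bar> \<le> ((B + \<epsilon>) * (B + \<epsilon>) * L) * \<bar>s' - s\<bar>"
      if ss: "s \<in> {a * t..b * t}" "s' \<in> {a * t..b * t}" for s s'
    proof -
      have bd: "\<bar>F s e x\<bar> \<le> B + \<epsilon>" if "s \<in> {a * t..b * t}" "e \<in> edges G" "x \<in> {0..elen G e}" for s e x
        using close[OF that] B(2)[OF that(2,3)] \<epsilon>'(2) by linarith
      have "\<bar>edge_integral G (\<lambda>e x. F s e x * F s' e x)\<bar> \<le> ((B + \<epsilon>) * (B + \<epsilon>)) * total_length G"
        using ss by (intro edge_integral_abs_bound edge_cont cF) (auto simp: abs_mult intro!: mult_mono bd add_nonneg_nonneg B(1)[THEN less_imp_le] \<epsilon>[THEN less_imp_le])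
      then have "\<bar>s' - s\<bar> * \<bar>edge_integral G (\<lambda>e x. F s e x * F s' e x)\<bar> \<le> \<bar>s' - s\<bar> * (((B + \<epsilon>) * (B + \<epsilon>)) * L)"
        unfolding L_def by (intro mult_left_mono) auto
      then show ?thesis unfolding diff[OF ss] abs_mult by (simp add: mult.commute)
    qed
    have cont: "continuous_on {a * t..b * t} N"
    proof (rule lipschitz_on_continuous_on)
      show "((B + \<epsilon>) * (B + \<epsilon>) * L)-lipschitz_on {a * t..b * t} N"
      proof (rule lipschitz_onI)
        show "0 \<le> (B + \<epsilon>) * (B + \<epsilon>) * L" using B(1) \<epsilon> L by auto
      qed (use lip in \<open>auto simp: dist_real_def\<close>)
    qed
    \<comment> \<open>Green's identity against the unperturbed \<open>g\<close>, whose fluxes all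
      vanish: \<open>\<mu>\<close> cancels and only the perturbation and the shift remain.\<close>
    have Nval: "N s = - edge_integral G (\<lambda>e x. (t * \<psi> e x - s) * F s e x * g e x)" if ss: "s \<in> {a * t..b * t}" for s
      using green[OF H[OF ss] unperturbed(1)] sumv[OF ss] unperturbed(2,3) by simp
    have Nc: "\<bar>edge_integral G (\<lambda>e x. (\<psi> e x - c) * F s e x * g e x) - I c\<bar> \<le> \<epsilon>' * C c * L"
      if ss: "s \<in> {a * t..b * t}" for s c
    proof -
      have "edge_integral G (\<lambda>e x. (\<psi> e x - c) * F s e x * g e x) - I c
          = edge_integral G (\<lambda>e x. (\<psi> e x - c) * F s e x * g e x - (\<psi> e x - c) * (g e x)\<^sup>2)"
        unfolding I_def by (rule edge_integral_diff[symmetric]) (intro edge_cont \<psi> gc cF ss)+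
      moreover have "\<bar>\<dots>\<bar> \<le> (C c * \<epsilon>') * total_length G"
      proof (rule edge_integral_abs_bound)
        show "edge_continuous G (\<lambda>e x. (\<psi> e x - c) * F s e x * g e x - (\<psi> e x - c) * (g e x)\<^sup>2)"
          by (intro edge_cont \<psi> gc cF ss)
        fix e x assume e: "e \<in> edges G" "x \<in> {0..elen G e}"
        have "\<bar>((\<psi> e x - c) * g e x) * (F s e x - g e x)\<bar> \<le> C c * \<epsilon>'"
          unfolding abs_mult[of "(\<psi> e x - c) * g e x"] using C[OF e] close[OF ss e] C0[of c] by (intro mult_mono) auto
        then show "\<bar>(\<psi> e x - c) * F s e x * g e x - (\<psi> e x - c) * (g e x)\<^sup>2\<bar> \<le> C c * \<epsilon>'"
          by (simp add: power2_eq_square algebra_simps)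
      qed
      ultimately show ?thesis by (simp add: L_def mult_ac)
    qed
    have Nscale: "N (c * t) = - t * edge_integral G (\<lambda>e x. (\<psi> e x - c) * F (c * t) e x * g e x)"
      if "c * t \<in> {a * t..b * t}" for c
    proof -
      have "edge_integral G (\<lambda>e x. (t * \<psi> e x - c * t) * F (c * t) e x * g e x)
          = edge_integral G (\<lambda>e x. t * ((\<psi> e x - c) * F (c * t) e x * g e x))"
        by (intro edge_integral_cong) (simp add: algebra_simps)
      then show ?thesis unfolding Nval[OF that] by (simp add: edge_integral_cmult)
    qed
    have in_a: "a * t \<in> {a * t..b * t}" and in_b: "b * t \<in> {a * t..b * t}"
      using ab t(1) by auto
    have "N (a * t) \<le> 0"
      using Nc[OF in_a, of a] \<epsilon>'L[of a] m(2) t(1) unfolding Nscale[OF in_a]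
      by (auto intro!: mult_nonneg_nonneg)
    moreover have "0 \<le> N (b * t)"
      using Nc[OF in_b, of b] \<epsilon>'L[of b] m(3) t(1) unfolding Nscale[OF in_b]
      by (auto intro!: mult_nonneg_nonpos)
    ultimately obtain s where s: "a * t \<le> s" "s \<le> b * t" "N s = 0"
      using IVT'[of N "a * t" 0 "b * t"] cont ab t(1) by auto
    then have ss: "s \<in> {a * t..b * t}" by simp
    have "\<forall>w\<in>vertices G. flux G (F' s) w = 0" using fl[OF ss] s(3) by (auto simp: N_def)
    moreover have "\<bar>F s e x - g e x\<bar> \<le> \<epsilon>" if "e \<in> edges G" "x \<in> {0..elen G e}" for e x
      using close[OF ss that] \<epsilon>'(2) by linarith
    ultimately show ?thesis using s H[OF ss] Hv[OF ss] by blast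
  qed
  then show ?thesis using \<eta> by (intro exI[of _ "\<eta> / (\<bar>a\<bar> + \<bar>b\<bar> + 1)"]) auto
qed

end

section \<open>Eigenvalues of the Schroedinger operator\<close>

lemma lin_ode_cong:
  assumes "lin_ode l p f f'" "\<And>x. x \<in> {0..l} \<Longrightarrow> f x = g x"
  shows "lin_ode l p g f'"
  unfolding lin_ode_def
proof (intro ballI conjI)
  fix x assume x: "x \<in> {0..l}"
  show "(g has_real_derivative f' x) (at x within {0..l})"
    by (rule has_field_derivative_transform_within[OF lin_odeD(1)[OF assms(1) x], of 1])
      (use x assms(2) in auto)
  show "(f' has_real_derivative p x * g x) (at x within {0..l})"
    using lin_odeD(2)[OF assms(1) x] assms(2)[OF x] by simp
qed

text \<open>Regularity: by the equation the weak second derivative equals a continuous function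
  almost everywhere, so \<open>f'\<close> is an integral of a continuous function and is classically
  differentiable.\<close>

lemma sobolev2_imp_lin_ode:
  assumes s: "sobolev2 l f f' f''" and q: "continuous_on {0..l} q"
    and eq: "AE x in lborel. x \<in> {0..l} \<longrightarrow> \<mu> * f x = - f'' x + q x * f x"
  shows "lin_ode l (\<lambda>x. q x - \<mu>) f f'"
proof -
  have d: "(f has_real_derivative f' x) (at x within {0..l})" if "x \<in> {0..l}" for x
    using s that unfolding sobolev2_def by blast
  have m: "set_borel_measurable lborel {0..l} f''"
    and i: "\<forall>x\<in>{0..l}. f' x = f' 0 + (LBINT t:{0..x}. f'' t)"
    using s unfolding sobolev2_def by blast+
  have "continuous_on {0..l} f" by (rule DERIV_continuous_on) (erule d)
  then have c: "continuous_on {0..l} (\<lambda>x. (q x - \<mu>) * f x)"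
    using q by (intro continuous_intros)
  have f': "f' x = f' 0 + integral {0..x} (\<lambda>x. (q x - \<mu>) * f x)" if x: "x \<in> {0..l}" for x
  proof -
    have cx: "continuous_on {0..x} (\<lambda>x. (q x - \<mu>) * f x)"
      using c x by (auto elim: continuous_on_subset)
    have "(LBINT t:{0..x}. f'' t) = (LBINT t:{0..x}. (q t - \<mu>) * f t)"
      unfolding set_lebesgue_integral_def
    proof (rule integral_cong_AE)
      have "(\<lambda>t. indicator {0..l} t *\<^sub>R f'' t) \<in> borel_measurable lborel"
        using m by (simp add: set_borel_measurable_def)
      then have "(\<lambda>t. indicator {0..x} t *\<^sub>R (indicator {0..l} t *\<^sub>R f'' t)) \<in> borel_measurable lborel"
        by measurable
      moreover have "(\<lambda>t. indicator {0..x} t *\<^sub>R (indicator {0..l} t *\<^sub>R f'' t)) = (\<lambda>t. indicator {0..x} t *\<^sub>R f'' t)"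
        using x by (auto simp: indicator_def fun_eq_iff)
      ultimately show "(\<lambda>t. indicator {0..x} t *\<^sub>R f'' t) \<in> borel_measurable lborel" by simp
      show "(\<lambda>t. indicator {0..x} t *\<^sub>R ((q t - \<mu>) * f t)) \<in> borel_measurable lborel"
        using borel_integrable_atLeastAtMost'[OF cx] by (auto simp: set_integrable_def)
      show "AE t in lborel. indicator {0..x} t *\<^sub>R f'' t = indicator {0..x} t *\<^sub>R ((q t - \<mu>) * f t)"
        using eq by eventually_elim (use x in \<open>auto simp: indicator_def algebra_simps\<close>)
    qed
    also have "\<dots> = integral {0..x} (\<lambda>x. (q x - \<mu>) * f x)"
      by (rule lborel_integral_continuous[OF cx])
    finally show ?thesis using bspec[OF i x] by simp
  qed
  show ?thesis
    unfolding lin_ode_def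
  proof (intro ballI conjI d)
    fix x assume x: "x \<in> {0..l}"
    have "((\<lambda>x. f' 0 + integral {0..x} (\<lambda>x. (q x - \<mu>) * f x)) has_real_derivative 0 + (q x - \<mu>) * f x) (at x within {0..l})"
      by (intro DERIV_add DERIV_const integral_has_real_derivative c x)
    then have "((\<lambda>x. f' 0 + integral {0..x} (\<lambda>x. (q x - \<mu>) * f x)) has_real_derivative (q x - \<mu>) * f x) (at x within {0..l})"
      by simp
    then show "(f' has_real_derivative (q x - \<mu>) * f x) (at x within {0..l})"
      by (rule has_field_derivative_transform_within[OF _ zero_less_one x]) (rule f'[symmetric])
  qed
qed

lemma lin_ode_imp_sobolev2:
  assumes "lin_ode l p f f'" and p: "continuous_on {0..l} p"
  shows "sobolev2 l f f' (\<lambda>x. p x * f x)"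
  unfolding sobolev2_def
proof (intro conjI ballI)
  have c: "continuous_on {0..l} (\<lambda>x. p x * f x)"
    using lin_ode_continuous(1)[OF assms(1)] p by (intro continuous_intros)
  then show "set_borel_measurable lborel {0..l} (\<lambda>x. p x * f x)"
    using borel_integrable_atLeastAtMost'[OF c] by (auto simp: set_integrable_def set_borel_measurable_def)
  show "set_integrable lborel {0..l} (\<lambda>x. (p x * f x)\<^sup>2)"
    by (intro borel_integrable_atLeastAtMost' continuous_intros c)
  fix x assume x: "x \<in> {0..l}"
  show "(f has_real_derivative f' x) (at x within {0..l})" by (rule lin_odeD(1)[OF assms(1) x])
  have "((\<lambda>t. p t * f t) has_integral f' x - f' 0) {0..x}"
  proof (rule fundamental_theorem_of_calculus)
    fix y assume "y \<in> {0..x}"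
    then have y: "y \<in> {0..l}" "{0..x} \<subseteq> {0..l}" using x by auto
    show "(f' has_vector_derivative p y * f y) (at y within {0..x})"
      using DERIV_subset[OF lin_odeD(2)[OF assms(1) y(1)] y(2)]
      by (simp add: has_real_derivative_iff_has_vector_derivative)
  qed (use x in auto)
  moreover have "continuous_on {0..x} (\<lambda>x. p x * f x)"
    using c x by (auto elim: continuous_on_subset)
  ultimately show "f' x = f' 0 + (LBINT t:{0..x}. p t * f t)"
    by (simp add: lborel_integral_continuous integral_unique)
qed

lemma walk_constant:
  assumes "walk G a ds b" "\<And>e. e \<in> edges G \<Longrightarrow> h (esrc G e) = h (etgt G e)"
  shows "h a = h b"
  using assms(1)
proof (induction ds arbitrary: a)
  case (Cons d ds)
  then have "h (dart_head G d) = h b" "fst d \<in> edges G" "dart_tail G d = a" by auto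
  then show ?case using assms(2)[of "fst d"] by (auto simp: dart_head_def dart_tail_def split: if_splits)
qed simp

lemma graph_ode_sum:
  assumes "finite B" "\<And>u. u \<in> B \<Longrightarrow> graph_ode G p (h u) (f u) (f' u)"
  shows "graph_ode G p (\<lambda>w. \<Sum>u\<in>B. c u * h u w) (\<lambda>e x. \<Sum>u\<in>B. c u * f u e x) (\<lambda>e x. \<Sum>u\<in>B. c u * f' u e x)"
  using assms
proof (induction B rule: finite_induct)
  case empty
  show ?case by (auto simp: graph_ode_def lin_ode_def)
next
  case (insert u B)
  have "graph_ode G p (\<lambda>w. c u * h u w + 1 * (\<Sum>u\<in>B. c u * h u w)) (\<lambda>e x. c u * f u e x + 1 * (\<Sum>u\<in>B. c u * f u e x))
     (\<lambda>e x. c u * f' u e x + 1 * (\<Sum>u\<in>B. c u * f' u e x))"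
    by (rule graph_ode_combine) (use insert in auto)
  then show ?case using insert by simp
qed

section \<open>Eigenfunctions as classical solutions, and comparison of eigenvalues\<close>

context connected_graph
begin

lemma points_eq_pt: "y \<in> points G \<Longrightarrow> \<exists>e\<in>edges G. \<exists>x\<in>{0..elen G e}. y = pt G e x"
proof -
  assume "y \<in> points G"
  then consider w where "w \<in> vertices G" "y = Vertex w"
    | e x where "y = Interior e x" "e \<in> edges G" "0 < x" "x < elen G e"
    by (auto simp: points_def)
  then show ?thesis
  proof cases
    case 1
    then obtain e where e: "e \<in> edges G" "w = esrc G e \<or> w = etgt G e" by (auto simp: vertices_def)
    have "y = pt G e 0 \<or> y = pt G e (elen G e)"
      using 1 e elen_pos[OF e(1)] by (auto simp: pt_def)
    then show ?thesis using e(1) elen_pos[OF e(1)] by (metis atLeastAtMost_iff less_imp_le order.refl)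
  next
    case 2
    then have "y = pt G e x" by (simp add: pt_def)
    moreover have "x \<in> {0..elen G e}" using 2 by simp
    ultimately show ?thesis using 2(2) by blast
  qed
qed

lemma eigenspace_imp_graph_ode:
  assumes q: "edge_continuous G (\<lambda>e x. q (pt G e x))" and u: "u \<in> eigenspace G q \<mu>"
  shows "\<exists>u'. graph_ode G (\<lambda>e x. q (pt G e x) - \<mu>) (\<lambda>w. u (Vertex w)) (\<lambda>e x. u (pt G e x)) u' \<and>
    (\<forall>w\<in>vertices G. flux G u' w = 0)"
proof -
  obtain u' u'' where u': "\<forall>e\<in>edges G. sobolev2 (elen G e) (\<lambda>x. u (pt G e x)) (u' e) (u'' e)"
    "kirchhoff G u'" "\<forall>e\<in>edges G. AE x in lborel. x \<in> {0..elen G e} \<longrightarrow>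
        \<mu> * u (pt G e x) = - u'' e x + q (pt G e x) * u (pt G e x)"
    using u unfolding eigenspace_def schroedinger_def mem_Collect_eq by (elim exE conjE)
  have "lin_ode (elen G e) (\<lambda>x. q (pt G e x) - \<mu>) (\<lambda>x. u (pt G e x)) (u' e)" if "e \<in> edges G" for e
    by (rule sobolev2_imp_lin_ode[OF bspec[OF u'(1) that] _ bspec[OF u'(3) that]])
      (use q that in \<open>simp add: edge_continuous_def\<close>)
  moreover have "u (pt G e 0) = u (Vertex (esrc G e))" "u (pt G e (elen G e)) = u (Vertex (etgt G e))"
    if "e \<in> edges G" for e using elen_pos[OF that] by (auto simp: pt_def)
  ultimately have "graph_ode G (\<lambda>e x. q (pt G e x) - \<mu>) (\<lambda>w. u (Vertex w)) (\<lambda>e x. u (pt G e x)) u'"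
    by (simp add: graph_ode_def)
  then show ?thesis using u'(2) by (auto simp: kirchhoff_iff_flux)
qed

lemma graph_ode_imp_eigenspace:
  assumes q: "edge_continuous G (\<lambda>e x. q (pt G e x))"
    and s: "graph_ode G (\<lambda>e x. q (pt G e x) - \<mu>) h f f'" and fl: "\<forall>w\<in>vertices G. flux G f' w = 0"
  obtains u where "u \<in> eigenspace G q \<mu>"
    "\<And>e x. e \<in> edges G \<Longrightarrow> x \<in> {0..elen G e} \<Longrightarrow> u (pt G e x) = f e x"
    "\<And>w. w \<in> vertices G \<Longrightarrow> u (Vertex w) = h w"
proof
  define u where "u = (\<lambda>y. case y of Vertex w \<Rightarrow> if w \<in> vertices G then h w else 0
    | Interior e x \<Rightarrow> if e \<in> edges G \<and> 0 < x \<and> x < elen G e then f e x else 0)"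
  show uf: "u (pt G e x) = f e x" if "e \<in> edges G" "x \<in> {0..elen G e}" for e x
    using that s endpoint_vertices by (auto simp: u_def pt_def graph_ode_def)
  show "u (Vertex w) = h w" if "w \<in> vertices G" for w using that by (simp add: u_def)
  have out: "u y = 0" if "y \<notin> points G" for y
    using that by (auto simp: u_def points_def split: point.splits)
  have l: "lin_ode (elen G e) (\<lambda>x. q (pt G e x) - \<mu>) (\<lambda>x. u (pt G e x)) (f' e)" if "e \<in> edges G" for e
    by (rule lin_ode_cong[of _ _ "f e"]) (use s that uf in \<open>auto simp: graph_ode_def\<close>)
  have "schroedinger G q u (\<lambda>x. \<mu> * u x)"
    unfolding schroedinger_def
  proof (intro exI conjI ballI)
    show "sobolev2 (elen G e) (\<lambda>x. u (pt G e x)) (f' e) ((\<lambda>e x. (q (pt G e x) - \<mu>) * u (pt G e x)) e)"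
      if "e \<in> edges G" for e
      by (rule lin_ode_imp_sobolev2[OF l[OF that]])
        (use q that in \<open>auto simp: edge_continuous_def intro!: continuous_intros\<close>)
    show "kirchhoff G f'" using fl by (simp add: kirchhoff_iff_flux)
  qed (auto simp: algebra_simps)
  with out show "u \<in> eigenspace G q \<mu>" by (simp add: eigenspace_def)
qed

lemma eigenfunction_nonzero:
  assumes u: "u \<in> eigenspace G q \<mu>"
  shows "u \<noteq> 0 \<longleftrightarrow> (\<exists>e\<in>edges G. \<exists>x\<in>{0..elen G e}. u (pt G e x) \<noteq> 0)"
proof
  assume "u \<noteq> 0"
  then obtain y where y: "u y \<noteq> 0" by (auto simp: fun_eq_iff)
  then have "y \<in> points G" using u by (auto simp: eigenspace_def)
  with y show "\<exists>e\<in>edges G. \<exists>x\<in>{0..elen G e}. u (pt G e x) \<noteq> 0" using points_eq_pt by metis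
qed auto

lemma eigenvalue_iff:
  assumes q: "edge_continuous G (\<lambda>e x. q (pt G e x))"
  shows "(\<exists>u. eigenfunction G q \<mu> u) \<longleftrightarrow> (\<exists>h f f'. graph_ode G (\<lambda>e x. q (pt G e x) - \<mu>) h f f' \<and>
    (\<forall>w\<in>vertices G. flux G f' w = 0) \<and> (\<exists>e\<in>edges G. \<exists>x\<in>{0..elen G e}. f e x \<noteq> 0))" (is "?L \<longleftrightarrow> ?R")
proof
  assume ?L
  then obtain u where u: "u \<in> eigenspace G q \<mu>" "u \<noteq> 0" by (auto simp: eigenfunction_def)
  then show ?R
    using eigenspace_imp_graph_ode[OF q u(1)] eigenfunction_nonzero[OF u(1)] by blast
next
  assume ?R
  then obtain h f f' where s: "graph_ode G (\<lambda>e x. q (pt G e x) - \<mu>) h f f'"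
    "\<forall>w\<in>vertices G. flux G f' w = 0" "\<exists>e\<in>edges G. \<exists>x\<in>{0..elen G e}. f e x \<noteq> 0" by blast
  obtain u where u: "u \<in> eigenspace G q \<mu>"
    "\<And>e x. e \<in> edges G \<Longrightarrow> x \<in> {0..elen G e} \<Longrightarrow> u (pt G e x) = f e x"
    by (rule graph_ode_imp_eigenspace[OF q s(1,2)]) (rule that)
  have "u \<noteq> 0" unfolding eigenfunction_nonzero[OF u(1)] using u(2) s(3) by auto
  then show ?L using u(1) by (auto simp: eigenfunction_def)
qed

text \<open>Picone's identity: \<open>(f f' - f\<^sup>2 y' / y)' = (f' - f y' / y)\<^sup>2 + (\<nu> - \<mu>) f\<^sup>2\<close>,
  and the boundary terms cancel by the Kirchhoff conditions.\<close>

lemma positive_solution_lowest: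
  assumes q: "edge_continuous G q"
    and f: "graph_ode G (\<lambda>e x. q e x - \<mu>) h f f'" "\<forall>w\<in>vertices G. flux G f' w = 0"
    and nz: "e0 \<in> edges G" "x0 \<in> {0..elen G e0}" "f e0 x0 \<noteq> 0"
    and y: "graph_ode G (\<lambda>e x. q e x - \<nu>) k y y'" "\<forall>w\<in>vertices G. flux G y' w = 0"
    and pos: "\<And>e x. e \<in> edges G \<Longrightarrow> x \<in> {0..elen G e} \<Longrightarrow> y e x > 0"
  shows "\<nu> \<le> \<mu>"
proof (rule ccontr)
  assume "\<not> \<nu> \<le> \<mu>"
  then have less: "\<mu> < \<nu>" by simp
  define F where "F = (\<lambda>e x. (f' e x - f e x * y' e x / y e x)\<^sup>2 + (\<nu> - \<mu>) * (f e x)\<^sup>2)"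
  note cf = graph_ode_continuous[OF f(1)] and cy = graph_ode_continuous[OF y(1)]
  have "edge_continuous G F"
    unfolding F_def edge_continuous_def
  proof
    fix e assume e: "e \<in> edges G"
    have "\<forall>x\<in>{0..elen G e}. y e x \<noteq> 0" using pos[OF e] by force
    then show "continuous_on {0..elen G e} (\<lambda>x. (f' e x - f e x * y' e x / y e x)\<^sup>2 + (\<nu> - \<mu>) * (f e x)\<^sup>2)"
      using cf cy e unfolding edge_continuous_def by (intro continuous_intros) auto
  qed
  moreover have "0 \<le> F e x" for e x using less by (simp add: F_def)
  moreover have "F e0 x0 \<noteq> 0"
  proof -
    have "0 < (\<nu> - \<mu>) * (f e0 x0)\<^sup>2" using less nz by simp
    then have "0 < F e0 x0" unfolding F_def by (simp add: add_nonneg_pos)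
    then show ?thesis by simp
  qed
  ultimately have "0 < edge_integral G F" using nz(1,2) by (intro edge_integral_pos) auto
  moreover have "edge_integral G F = (\<Sum>e\<in>edges G.
      (f e (elen G e) * f' e (elen G e) - (f e (elen G e))\<^sup>2 * y' e (elen G e) / y e (elen G e))
      - (f e 0 * f' e 0 - (f e 0)\<^sup>2 * y' e 0 / y e 0))"
  proof (rule edge_integral_derivative)
    fix e x assume e: "e \<in> edges G" and x: "x \<in> {0..elen G e}"
    have l: "lin_ode (elen G e) (\<lambda>x. q e x - \<mu>) (f e) (f' e)" "lin_ode (elen G e) (\<lambda>x. q e x - \<nu>) (y e) (y' e)"
      using f y e by (auto simp: graph_ode_def)
    note d = lin_odeD[OF l(1) x] lin_odeD[OF l(2) x]
    have y0: "y e x \<noteq> 0" using pos[OF e x] by simp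
    show "((\<lambda>x. f e x * f' e x - (f e x)\<^sup>2 * y' e x / y e x) has_real_derivative F e x) (at x within {0..elen G e})"
      using y0 by (auto intro!: derivative_eq_intros d simp: F_def field_simps power2_eq_square)
  qed
  \<comment> \<open>Continuity at the vertices turns the boundary terms into sums of fluxes weighted
    by the vertex functions h and h^2 / k.\<close>
  moreover have "\<dots> = (\<Sum>e\<in>edges G. f' e (elen G e) * h (etgt G e) - f' e 0 * h (esrc G e))
     - (\<Sum>e\<in>edges G. y' e (elen G e) * ((h (etgt G e))\<^sup>2 / k (etgt G e)) - y' e 0 * ((h (esrc G e))\<^sup>2 / k (esrc G e)))"
    unfolding sum_subtractf[symmetric]
    using f(1) y(1) by (intro sum.cong refl) (simp add: graph_ode_def mult.commute)
  moreover have "\<dots> = 0"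
    unfolding boundary_sum boundary_sum[of y' "\<lambda>w. (h w)\<^sup>2 / k w"] using f(2) y(2) by simp
  ultimately show False by simp
qed

text \<open>The Dirichlet energy equals a sum of fluxes times vertex values and hence vanishes. The
  function is then constant on each edge, and connectedness carries the constant across the
  graph.\<close>

lemma harmonic_constant:
  assumes s: "graph_ode G (\<lambda>e x. 0) h f f'" and fl: "\<And>w. w \<in> vertices G \<Longrightarrow> flux G f' w = 0"
    and v: "v \<in> vertices G" and e: "e \<in> edges G" "x \<in> {0..elen G e}"
  shows "f e x = h v"
proof -
  have l: "lin_ode (elen G e) (\<lambda>x. 0) (f e) (f' e)" if "e \<in> edges G" for e
    using s that by (simp add: graph_ode_def)
  have "edge_integral G (\<lambda>e x. (f' e x)\<^sup>2) = (\<Sum>e\<in>edges G. f' e (elen G e) * f e (elen G e) - f' e 0 * f e 0)"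
  proof (rule edge_integral_derivative)
    fix e x assume e: "e \<in> edges G" and x: "x \<in> {0..elen G e}"
    note d = lin_odeD[OF l[OF e] x]
    show "((\<lambda>x. f' e x * f e x) has_real_derivative (f' e x)\<^sup>2) (at x within {0..elen G e})"
      by (rule DERIV_cong[OF DERIV_mult[OF d(2) d(1)]]) (simp add: power2_eq_square)
  qed
  also have "\<dots> = (\<Sum>e\<in>edges G. f' e (elen G e) * h (etgt G e) - f' e 0 * h (esrc G e))"
    using s by (intro sum.cong) (auto simp: graph_ode_def)
  also have "\<dots> = 0" unfolding boundary_sum using fl by simp
  finally have I: "edge_integral G (\<lambda>e x. (f' e x)\<^sup>2) = 0" .
  have z: "f' e x = 0" if "e \<in> edges G" "x \<in> {0..elen G e}" for e x
  proof (rule ccontr)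
    assume "f' e x \<noteq> 0"
    then have "0 < edge_integral G (\<lambda>e x. (f' e x)\<^sup>2)"
      using that by (intro edge_integral_pos edge_cont graph_ode_continuous(2)[OF s]) auto
    with I show False by simp
  qed
  have c: "f e x = f e 0" if e: "e \<in> edges G" "x \<in> {0..elen G e}" for e x
  proof -
    have "(f e has_real_derivative 0) (at x within {0..elen G e})" if "x \<in> {0..elen G e}" for x
      using lin_odeD(1)[OF l[OF e(1)] that] z[OF e(1) that] by simp
    then obtain c where "\<forall>x\<in>{0..elen G e}. f e x = c"
      using has_field_derivative_zero_constant[OF convex_real_interval(5)] by metis
    then show ?thesis using e elen_pos[OF e(1)] by (auto simp: less_imp_le)
  qed
  have "h (esrc G e) = h (etgt G e)" if "e \<in> edges G" for e
    using c[OF that, of "elen G e"] elen_pos[OF that] s that by (auto simp: graph_ode_def less_imp_le)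
  moreover obtain ds where "walk G v ds (esrc G e)"
    using compact_metric_graph v endpoint_vertices(1)[OF e(1)] unfolding compact_metric_graph_def by blast
  ultimately have "h v = h (esrc G e)" using walk_constant by metis
  then show ?thesis using c[OF e] s e by (simp add: graph_ode_def)
qed

lemma constant_solution: "graph_ode G (\<lambda>e x. 0) (\<lambda>_. 1) (\<lambda>_ _. 1) (\<lambda>_ _. 0)" "flux G (\<lambda>_ _. 0) w = 0"
  by (auto simp: graph_ode_def lin_ode_def flux_def)

section \<open>Finiteness of the spectrum on bounded intervals and the counting function\<close>

lemma independent_eigenfunctions_finite:
  assumes q: "edge_continuous G (\<lambda>e x. q (pt G e x))" and B: "B \<subseteq> eigenspace G q \<mu>" "fun_space.independent B"
  shows "finite B"
proof (rule ccontr)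
  assume "infinite B"
  then obtain B0 where B0: "finite B0" "card B0 = Suc (card (vertices G <+> edges G))" "B0 \<subseteq> B"
    using infinite_arbitrarily_large by metis
  have "\<forall>u\<in>B0. \<exists>u'. graph_ode G (\<lambda>e x. q (pt G e x) - \<mu>) (\<lambda>w. u (Vertex w)) (\<lambda>e x. u (pt G e x)) u'"
    using eigenspace_imp_graph_ode[OF q] B B0 by blast
  then obtain D where D: "\<And>u. u \<in> B0 \<Longrightarrow>
      graph_ode G (\<lambda>e x. q (pt G e x) - \<mu>) (\<lambda>w. u (Vertex w)) (\<lambda>e x. u (pt G e x)) (D u)" by metis
  \<comment> \<open>The coordinates of an eigenfunction: vertex values and initial slopes. With one
    function more than coordinates, some nontrivial combination has zero data and hence is
    0.\<close>
  define A where "A = (\<lambda>j u. case j of Inl w \<Rightarrow> u (Vertex w) | Inr e \<Rightarrow> D u e 0)"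
  have "\<exists>c. (\<exists>u\<in>B0. c u \<noteq> 0) \<and> (\<forall>j\<in>vertices G <+> edges G. (\<Sum>u\<in>B0. A j u * c u) = 0)"
    by (rule underdetermined_system) (use finite_vertices finite_edges B0 in auto)
  then obtain c where c: "\<exists>u\<in>B0. c u \<noteq> 0" "\<forall>j\<in>vertices G <+> edges G. (\<Sum>u\<in>B0. A j u * c u) = 0"
    by blast
  have s: "graph_ode G (\<lambda>e x. q (pt G e x) - \<mu>) (\<lambda>w. \<Sum>u\<in>B0. c u * u (Vertex w))
      (\<lambda>e x. \<Sum>u\<in>B0. c u * u (pt G e x)) (\<lambda>e x. \<Sum>u\<in>B0. c u * D u e x)"
    by (rule graph_ode_sum[OF B0(1)]) (rule D)
  have "edge_continuous G (\<lambda>e x. q (pt G e x) - \<mu>)" by (intro edge_cont q)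
  from graph_ode_zero_iff[OF this s]
  have "\<forall>e\<in>edges G. \<forall>x\<in>{0..elen G e}. (\<Sum>u\<in>B0. c u * u (pt G e x)) = 0"
    using bspec[OF c(2) InlI] bspec[OF c(2) InrI] by (simp add: A_def mult.commute)
  then have z1: "(\<Sum>u\<in>B0. c u * u y) = 0" if "y \<in> points G" for y
    using points_eq_pt[OF that] by auto
  have z2: "(\<Sum>u\<in>B0. c u * u y) = 0" if "y \<notin> points G" for y
    using that B B0(3) by (intro sum.neutral ballI) (auto simp: eigenspace_def)
  have "(\<Sum>u\<in>B0. (\<lambda>y. c u * u y)) = 0"
  proof (intro ext)
    fix y
    have "(\<Sum>u\<in>S. (\<lambda>y. c u * u y)) y = (\<Sum>u\<in>S. c u * u y)" if "finite S" for S
      using that by (induction S rule: finite_induct) auto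
    with B0(1) show "(\<Sum>u\<in>B0. (\<lambda>y. c u * u y)) y = 0 y"
      using z1 z2 by (cases "y \<in> points G") auto
  qed
  then have "\<forall>u\<in>B0. c u = 0"
    using fun_space.independentD[OF B(2) B0(1,3)] by blast
  with c(1) show False by blast
qed

text \<open>A basis contains at least one element, but its cardinality is positive only because it
  is finite.\<close>

lemma multiplicity_pos:
  assumes q: "edge_continuous G (\<lambda>e x. q (pt G e x))" and u: "eigenfunction G q \<mu> u"
  shows "1 \<le> multiplicity G q \<mu>"
proof -
  obtain B where B: "B \<subseteq> eigenspace G q \<mu>" "fun_space.independent B" "eigenspace G q \<mu> \<subseteq> fun_space.span B"
    "card B = fun_space.dim (eigenspace G q \<mu>)"
    using fun_space.basis_exists by blast
  have "B \<noteq> {}" using B(3) u by (auto simp: eigenfunction_def)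
  then have "0 < card B" using independent_eigenfunctions_finite[OF q B(1,2)] by (simp add: card_gt_0_iff)
  then show ?thesis using B(4) by (simp add: multiplicity_def)
qed

text \<open>Eigenfunctions of distinct eigenvalues are orthogonal. Along accumulating eigenvalues,
  normalized ones subconverge uniformly to a nonzero limit, whose square integral would be close to
  the inner product 0 of two late members.\<close>

lemma finite_eigenvalues:
  assumes q: "edge_continuous G (\<lambda>e x. q (pt G e x))"
  shows "finite {\<mu>. m \<le> \<mu> \<and> \<mu> \<le> c \<and> (\<exists>u. eigenfunction G q \<mu> u)}" (is "finite ?S")
proof (rule ccontr)
  assume "infinite ?S"
  then obtain \<kappa>0 :: "nat \<Rightarrow> real" where \<kappa>0: "inj \<kappa>0" "range \<kappa>0 \<subseteq> ?S"
    using infinite_countable_subset by blast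
  have "bounded (range \<kappa>0)" using \<kappa>0(2) by (intro bounded_subset[OF bounded_closed_interval[of m c]]) auto
  then obtain \<mu> r where r: "strict_mono r" "(\<kappa>0 \<circ> r) \<longlonglongrightarrow> \<mu>"
    using bounded_imp_convergent_subsequence by blast
  define \<kappa> where "\<kappa> = \<kappa>0 \<circ> r"
  have inj: "inj \<kappa>" unfolding \<kappa>_def using \<kappa>0(1) strict_mono_imp_inj_on[OF r(1)] by (intro inj_compose)
  have cont: "edge_continuous G (\<lambda>e x. q (pt G e x) - \<nu>)" for \<nu> by (intro edge_cont q)
  have "\<exists>h f f'. graph_ode G (\<lambda>e x. q (pt G e x) - \<kappa> n) h f f' \<and> (\<forall>w\<in>vertices G. flux G f' w = 0) \<and>
      data_norm h f' = 1" for n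
  proof -
    have "\<exists>u. eigenfunction G q (\<kappa> n) u" using \<kappa>0(2) by (auto simp: \<kappa>_def)
    then obtain h f f' where s: "graph_ode G (\<lambda>e x. q (pt G e x) - \<kappa> n) h f f'"
      "\<forall>w\<in>vertices G. flux G f' w = 0" "\<exists>e\<in>edges G. \<exists>x\<in>{0..elen G e}. f e x \<noteq> 0"
      unfolding eigenvalue_iff[OF q] by blast
    have "data_norm h f' \<noteq> 0"
      using s(3) graph_ode_zero_iff[OF cont s(1)] by (auto simp: data_norm_eq_0_iff)
    then obtain a where a: "graph_ode G (\<lambda>e x. q (pt G e x) - \<kappa> n) (\<lambda>w. a * h w) (\<lambda>e x. a * f e x) (\<lambda>e x. a * f' e x)"
      "data_norm (\<lambda>w. a * h w) (\<lambda>e x. a * f' e x) = 1"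
      by (rule normalize_solution[OF s(1)]) (rule that)
    moreover have "flux G (\<lambda>e x. a * f' e x) w = 0" if "w \<in> vertices G" for w
      using flux_combine[of G a f' 0 f' w] s(2) that by simp
    ultimately show ?thesis by blast
  qed
  then obtain hn fn fn' where sol: "\<And>n. graph_ode G (\<lambda>e x. q (pt G e x) - \<kappa> n) (hn n) (fn n) (fn' n)"
    and fl: "\<And>n. \<forall>w\<in>vertices G. flux G (fn' n) w = 0" and norm: "\<And>n. data_norm (hn n) (fn' n) = 1"
    by metis
  have orth: "edge_integral G (\<lambda>e x. fn n e x * fn k e x) = 0" if "n \<noteq> k" for n k
  proof -
    have "edge_integral G (\<lambda>e x. (\<kappa> k - \<kappa> n) * (fn n e x * fn k e x))
        = edge_integral G (\<lambda>e x. (q (pt G e x) - \<kappa> n - (q (pt G e x) - \<kappa> k)) * fn n e x * fn k e x)"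
      by (intro edge_integral_cong) (simp add: algebra_simps)
    also have "\<dots> = 0" using green[OF sol[of n] sol[of k]] fl by simp
    finally have "(\<kappa> k - \<kappa> n) * edge_integral G (\<lambda>e x. fn n e x * fn k e x) = 0"
      unfolding edge_integral_cmult .
    moreover have "\<kappa> k \<noteq> \<kappa> n" using inj that by (auto dest: injD)
    ultimately show ?thesis by simp
  qed
  have "(\<lambda>n. \<bar>\<mu> - \<kappa> n\<bar>) \<longlonglongrightarrow> \<bar>\<mu> - \<mu>\<bar>"
    using r(2) unfolding \<kappa>_def by (intro tendsto_intros)
  then have \<delta>: "(\<lambda>n. \<bar>\<mu> - \<kappa> n\<bar>) \<longlonglongrightarrow> 0" by simp
  obtain s h f f' where s: "strict_mono (s :: nat \<Rightarrow> nat)" and lsol: "graph_ode G (\<lambda>e x. q (pt G e x) - \<mu>) h f f'"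
    and lnorm: "data_norm h f' = 1" and "\<And>w. w \<in> vertices G \<Longrightarrow> (\<lambda>n. hn (s n) w) \<longlonglongrightarrow> h w"
    and flim: "\<And>\<epsilon>. \<epsilon> > 0 \<Longrightarrow> \<forall>\<^sub>F n in sequentially. \<forall>e\<in>edges G. \<forall>x\<in>{0..elen G e}.
        \<bar>fn (s n) e x - f e x\<bar> < \<epsilon> \<and> \<bar>fn' (s n) e x - f' e x\<bar> < \<epsilon>"
    by (rule solution_subsequence[OF cont[of \<mu>], where pn = "\<lambda>n e x. q (pt G e x) - \<kappa> n" and hn = hn
          and fn = fn and fn' = fn' and \<delta> = "\<lambda>n. \<bar>\<mu> - \<kappa> n\<bar>"])
      (rule sol, rule norm, simp, rule \<delta>, rule that)
  note cf = graph_ode_continuous(1)[OF lsol]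
  obtain B where B: "B > 0" "\<And>e x. e \<in> edges G \<Longrightarrow> x \<in> {0..elen G e} \<Longrightarrow> \<bar>f e x\<bar> \<le> B"
    using edge_continuous_bounded[OF cf] by auto
  define L where "L = total_length G"
  have L: "L \<ge> 0" unfolding L_def total_length_def using elen_pos by (auto intro!: sum_nonneg simp: less_imp_le)
  define I where "I = edge_integral G (\<lambda>e x. (f e x)\<^sup>2)"
  have "data_norm h f' \<noteq> 0" using lnorm by simp
  then obtain e0 x0 where "e0 \<in> edges G" "x0 \<in> {0..elen G e0}" "f e0 x0 \<noteq> 0"
    unfolding data_norm_eq_0_iff using graph_ode_zero_iff[OF cont lsol] by blast
  then have "I > 0" unfolding I_def by (intro edge_integral_pos edge_cont cf) auto
  \<comment> \<open>If two functions are within \<epsilon> \<le> 1 of \<open>f\<close>, their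
    product is within \<epsilon> (B + 1) + B \<epsilon> = \<epsilon> K of the square of
    \<open>f\<close>. The choice of \<epsilon> below then yields the contradiction I \<le> I /
    2.\<close>
  define K where "K = 2 * B + 1"
  have K: "K > 0" using B(1) by (simp add: K_def)
  define R where "R = K * (L + 1)"
  have R: "R > 0" using K L by (simp add: R_def)
  define \<epsilon> where "\<epsilon> = min 1 (I / (2 * R))"
  have \<epsilon>: "\<epsilon> > 0" "\<epsilon> \<le> 1" using \<open>I > 0\<close> R by (auto simp: \<epsilon>_def)
  obtain n0 where n0: "\<And>n. n \<ge> n0 \<Longrightarrow> \<forall>e\<in>edges G. \<forall>x\<in>{0..elen G e}. \<bar>fn (s n) e x - f e x\<bar> < \<epsilon>"
    using flim[OF \<epsilon>(1)] unfolding eventually_sequentially by blast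
  define a b where "a = s n0" and "b = s (Suc n0)"
  have ab: "a \<noteq> b" using s by (simp add: a_def b_def strict_mono_eq)
  have cl: "\<bar>fn a e x - f e x\<bar> \<le> \<epsilon>" "\<bar>fn b e x - f e x\<bar> \<le> \<epsilon>" if "e \<in> edges G" "x \<in> {0..elen G e}" for e x
    using n0[of n0] n0[of "Suc n0"] that by (auto simp: a_def b_def less_imp_le)
  note ca = graph_ode_continuous(1)[OF sol[of a]] and cb = graph_ode_continuous(1)[OF sol[of b]]
  have "I = edge_integral G (\<lambda>e x. (f e x)\<^sup>2 - fn a e x * fn b e x)"
    unfolding I_def by (subst edge_integral_diff) (auto intro!: edge_cont cf ca cb simp: orth[OF ab])
  also have "\<dots> \<le> \<epsilon> * K * total_length G"
  proof (rule abs_le_D1, rule edge_integral_abs_bound)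
    show "edge_continuous G (\<lambda>e x. (f e x)\<^sup>2 - fn a e x * fn b e x)" by (intro edge_cont cf ca cb)
    fix e x assume e: "e \<in> edges G" "x \<in> {0..elen G e}"
    have "(f e x)\<^sup>2 - fn a e x * fn b e x = - ((fn a e x - f e x) * fn b e x + f e x * (fn b e x - f e x))"
      by (simp add: power2_eq_square algebra_simps)
    also have "\<bar>\<dots>\<bar> \<le> \<bar>fn a e x - f e x\<bar> * \<bar>fn b e x\<bar> + \<bar>f e x\<bar> * \<bar>fn b e x - f e x\<bar>"
      unfolding abs_minus_cancel by (metis abs_mult abs_triangle_ineq)
    also have "\<dots> \<le> \<epsilon> * (B + 1) + B * \<epsilon>"
      using cl[OF e] B(2)[OF e] B(1) \<epsilon> by (intro add_mono mult_mono) auto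
    also have "\<dots> = \<epsilon> * K" by (simp add: K_def algebra_simps)
    finally show "\<bar>(f e x)\<^sup>2 - fn a e x * fn b e x\<bar> \<le> \<epsilon> * K" .
  qed
  also have "\<dots> \<le> \<epsilon> * R" using \<epsilon> K unfolding L_def R_def by (simp add: mult_left_mono)
  also have "\<dots> \<le> I / (2 * R) * R"
    using R by (intro mult_right_mono) (auto simp: \<epsilon>_def)
  also have "\<dots> = I / 2" using R by simp
  finally show False using \<open>I > 0\<close> by simp
qed

lemma eigval_1:
  assumes q: "edge_continuous G (\<lambda>e x. q (pt G e x))"
    and \<mu>: "\<exists>u. eigenfunction G q \<mu> u" and low: "\<And>\<nu> u. eigenfunction G q \<nu> u \<Longrightarrow> \<mu> \<le> \<nu>"
  shows "eigval G q 1 = \<mu>"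
  unfolding eigval_def
proof (rule Least_equality)
  have "{\<nu>. \<nu> \<le> \<mu> \<and> (\<exists>u. eigenfunction G q \<nu> u)} = {\<mu>}"
    using \<mu> low by (auto intro: antisym)
  then show "1 \<le> eigenvalue_count G q \<mu>"
    using multiplicity_pos[OF q] \<mu> by (auto simp: eigenvalue_count_def)
  fix c assume "1 \<le> eigenvalue_count G q c"
  then have "{\<nu>. \<nu> \<le> c \<and> (\<exists>u. eigenfunction G q \<nu> u)} \<noteq> {}"
    unfolding eigenvalue_count_def by (metis not_one_le_zero sum.empty)
  then show "\<mu> \<le> c" using low by force
qed

text \<open>A \<open>LEAST\<close> over the reals is meaningful only if the minimum is attained. The
  counting function is a step function that changes only at eigenvalues, so the search reduces to
  the finitely many eigenvalues up to \<open>\<mu>'\<close>.\<close>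

lemma eigval_2_le:
  assumes q: "edge_continuous G (\<lambda>e x. q (pt G e x))"
    and \<mu>: "\<exists>u. eigenfunction G q \<mu> u" and low: "\<And>\<nu> u. eigenfunction G q \<nu> u \<Longrightarrow> \<mu> \<le> \<nu>"
    and \<mu>': "\<exists>u. eigenfunction G q \<mu>' u" "\<mu> < \<mu>'"
  shows "eigval G q 2 \<le> \<mu>'"
proof -
  define P where "P = (\<lambda>\<nu>. \<exists>u. eigenfunction G q \<nu> u)"
  define S where "S = (\<lambda>c. {\<nu>. \<nu> \<le> c \<and> P \<nu>})"
  define N where "N = (\<lambda>c. eigenvalue_count G q c)"
  have N: "N c = (\<Sum>\<nu>\<in>S c. multiplicity G q \<nu>)" for c
    by (simp add: N_def S_def P_def eigenvalue_count_def)
  have "S \<mu>' \<subseteq> {\<nu>. \<mu> \<le> \<nu> \<and> \<nu> \<le> \<mu>' \<and> (\<exists>u. eigenfunction G q \<nu> u)}"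
    using low by (auto simp: S_def P_def)
  then have fin: "finite (S \<mu>')" using finite_eigenvalues[OF q] finite_subset by blast
  have "2 \<le> (\<Sum>\<nu>\<in>{\<mu>, \<mu>'}. multiplicity G q \<nu>)"
  proof -
    have "1 \<le> multiplicity G q \<mu>" "1 \<le> multiplicity G q \<mu>'"
      using multiplicity_pos[OF q] \<mu> \<mu>' by blast+
    then show ?thesis using \<mu>' by simp
  qed
  also have "\<dots> \<le> N \<mu>'"
    unfolding N using fin \<mu> \<mu>' by (intro sum_mono2) (auto simp: S_def P_def)
  finally have N2: "2 \<le> N \<mu>'" .
  define T where "T = {c \<in> S \<mu>'. 2 \<le> N c}"
  have "\<mu>' \<in> S \<mu>'" using \<mu>' by (simp add: S_def P_def)
  then have T: "finite T" "\<mu>' \<in> T" using fin N2 by (auto simp: T_def)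
  have "eigval G q 2 = Min T"
    unfolding eigval_def N_def[symmetric]
  proof (rule Least_equality)
    have "Min T \<in> T" using T by (intro Min_in) auto
    then show "2 \<le> N (Min T)" by (simp add: T_def)
    fix c assume c: "2 \<le> N c"
    show "Min T \<le> c"
    proof (cases "\<mu>' \<le> c")
      case True
      then show ?thesis using Min_le[OF T] by simp
    next
      case False
      then have sub: "S c \<subseteq> S \<mu>'" by (auto simp: S_def)
      then have fc: "finite (S c)" using fin finite_subset by blast
      have "S c \<noteq> {}" using c unfolding N by auto
      \<comment> \<open>The largest eigenvalue not above \<open>c\<close> has the same count as
        \<open>c\<close>.\<close>
      define z where "z = Max (S c)"
      have z: "z \<in> S c" unfolding z_def using fc \<open>S c \<noteq> {}\<close> by (rule Max_in)
      have "S z = S c"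
        using z Max_ge[OF fc] by (auto simp: S_def z_def)
      then have "z \<in> T" using z sub c by (auto simp: T_def N)
      then have "Min T \<le> z" using T by simp
      also have "z \<le> c" using z by (simp add: S_def)
      finally show ?thesis .
    qed
  qed
  then show ?thesis using Min_le[OF T] by simp
qed

end

text \<open>Only the products with \<open>f\<close> are compared, so the potential may be changed
  wherever the solution vanishes.\<close>

lemma graph_ode_cong:
  assumes "graph_ode G p h f f'"
    "\<And>e x. e \<in> edges G \<Longrightarrow> x \<in> {0..elen G e} \<Longrightarrow> p e x * f e x = q e x * f e x"
  shows "graph_ode G q h f f'"
  using assms unfolding graph_ode_def lin_ode_def by simp

lemma edge_continuous_cong:
  assumes "edge_continuous G F" "\<And>e x. e \<in> edges G \<Longrightarrow> x \<in> {0..elen G e} \<Longrightarrow> F e x = H e x"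
  shows "edge_continuous G H"
  using assms unfolding edge_continuous_def by (metis (no_types, lifting) continuous_on_cong)

section \<open>The spectral gap to first order in the strength of the potential\<close>

context connected_graph
begin

lemma edge_continuous_zero: "edge_continuous G (\<lambda>e x. (\<lambda>_. 0) (pt G e x))"
  by (simp add: edge_continuous_const)

lemma free_eigenvalue_nonneg:
  assumes "eigenfunction G (\<lambda>_. 0) \<mu> u"
  shows "0 \<le> \<mu>"
proof -
  obtain h f f' where s: "graph_ode G (\<lambda>e x. 0 - \<mu>) h f f'" "\<forall>w\<in>vertices G. flux G f' w = 0"
    "\<exists>e\<in>edges G. \<exists>x\<in>{0..elen G e}. f e x \<noteq> 0"
    using iffD1[OF eigenvalue_iff[OF edge_continuous_zero] exI[of _ u], OF assms] by blast
  then obtain e x where e: "e \<in> edges G" "x \<in> {0..elen G e}" "f e x \<noteq> 0" by blast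
  have c: "graph_ode G (\<lambda>e x. 0 - 0) (\<lambda>_. 1) (\<lambda>_ _. 1) (\<lambda>_ _. 0)" using constant_solution(1) by simp
  show ?thesis
    by (rule positive_solution_lowest[OF edge_continuous_const s(1,2) e c]) (auto simp: constant_solution(2))
qed

lemma free_eigval_1:
  assumes "edges G \<noteq> {}"
  shows "eigval G (\<lambda>_. 0) 1 = 0"
proof (rule eigval_1[OF edge_continuous_zero])
  obtain e where e: "e \<in> edges G" using assms by blast
  show "\<exists>u. eigenfunction G (\<lambda>_. 0) 0 u"
    unfolding eigenvalue_iff[OF edge_continuous_zero]
    by (rule exI[of _ "\<lambda>_. 1"], rule exI[of _ "\<lambda>_ _. 1"], rule exI[of _ "\<lambda>_ _. 0"])
      (use constant_solution e elen_pos[OF e] in \<open>auto intro!: bexI[of _ e] bexI[of _ 0]\<close>)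
qed (rule free_eigenvalue_nonneg)

text \<open>Hypothesis \<open>less\<close> compares the u^2-weighted mean of \<open>\<psi>\<close>
  with its plain mean, cleared of denominators. Hypothesis \<open>supp\<close> says that the
  perturbation does not see eigenfunctions vanishing at \<open>v\<close>.\<close>

lemma spectral_gap_perturbation:
  fixes Q :: "real \<Rightarrow> ('v, 'e) point \<Rightarrow> real"
  assumes \<psi>: "edge_continuous G \<psi>" and v: "v \<in> vertices G"
    and Q: "\<And>t e x. e \<in> edges G \<Longrightarrow> x \<in> {0..elen G e} \<Longrightarrow> Q t (pt G e x) = t * \<psi> e x"
    and u: "eigenfunction G (\<lambda>_. 0) \<Lambda> u" and \<Lambda>: "0 < \<Lambda>"
    and supp: "\<And>h f f' e x. graph_ode G (\<lambda>e x. - \<Lambda>) h f f' \<Longrightarrow> \<forall>w\<in>vertices G. flux G f' w = 0 \<Longrightarrow>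
       h v = 0 \<Longrightarrow> e \<in> edges G \<Longrightarrow> x \<in> {0..elen G e} \<Longrightarrow> \<psi> e x * f e x = 0"
    and \<psi>0: "\<And>e x. e \<in> edges G \<Longrightarrow> x \<in> {0..elen G e} \<Longrightarrow> 0 \<le> \<psi> e x"
    and less: "edge_integral G (\<lambda>e x. \<psi> e x * (u (pt G e x))\<^sup>2) * total_length G
       < edge_integral G \<psi> * edge_integral G (\<lambda>e x. (u (pt G e x))\<^sup>2)"
  shows "\<exists>\<eta>>0. \<forall>t. 0 < t \<longrightarrow> t < \<eta> \<longrightarrow> spectral_gap G (Q t) < \<Lambda>"
proof -
  define U where "U = (\<lambda>e x. u (pt G e x))"
  obtain u' where u': "graph_ode G (\<lambda>e x. - \<Lambda>) (\<lambda>w. u (Vertex w)) U u'" "\<forall>w\<in>vertices G. flux G u' w = 0"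
    using eigenspace_imp_graph_ode[OF edge_continuous_zero, of u \<Lambda>] u by (auto simp: eigenfunction_def U_def)
  note cU = graph_ode_continuous(1)[OF u'(1)]
  obtain e0 x0 where nz: "e0 \<in> edges G" "x0 \<in> {0..elen G e0}" "U e0 x0 \<noteq> 0"
    using u eigenfunction_nonzero[of u "\<lambda>_. 0" \<Lambda>] by (auto simp: eigenfunction_def U_def)
  define L where "L = total_length G"
  have L: "L > 0" unfolding L_def total_length_def
    using nz(1) elen_pos finite_edges by (intro sum_pos) auto
  define I2 where "I2 = edge_integral G (\<lambda>e x. (U e x)\<^sup>2)"
  have I2: "I2 > 0" unfolding I2_def using nz by (intro edge_integral_pos edge_cont cU) auto
  define J where "J = edge_integral G (\<lambda>e x. \<psi> e x * (U e x)\<^sup>2)"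
  \<comment> \<open>The first order rates of growth of the lowest eigenvalue and of the branch
    starting at \<Lambda>.\<close>
  define \<kappa>1 \<kappa>2 where "\<kappa>1 = edge_integral G \<psi> / L" and "\<kappa>2 = J / I2"
  have J0: "J \<ge> 0"
  proof -
    have "edge_integral G (\<lambda>_ _. 0) \<le> J"
      unfolding J_def using \<psi>0 by (intro edge_integral_mono edge_cont cU \<psi>) auto
    then show ?thesis by (simp add: edge_integral_const)
  qed
  have \<kappa>: "\<kappa>2 < \<kappa>1" "0 \<le> \<kappa>2"
    using less L I2 J0 by (auto simp: \<kappa>1_def \<kappa>2_def L_def I2_def J_def U_def divide_simps mult.commute)
  \<comment> \<open>Dividing the interval between the rates into thirds leaves room on both sides:
    the upper branch grows at rate at most \<open>b2\<close>, the lowest eigenvalue at rate at least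
    \<open>a1\<close>, and \<open>b2 < a1\<close>.\<close>
  define d where "d = (\<kappa>1 - \<kappa>2) / 3"
  define b2 a1 where "b2 = \<kappa>2 + d" and "a1 = \<kappa>2 + 2 * d"
  have d: "0 < d" "\<kappa>1 = \<kappa>2 + 3 * d" using \<kappa> by (simp_all add: d_def field_simps)
  have ord: "\<kappa>2 < b2" "b2 < a1" "a1 < \<kappa>1" "0 < b2" using \<kappa> d unfolding b2_def a1_def by simp_all
  have free: "perturbation G \<psi> 0 v (\<lambda>_. 1) (\<lambda>_ _. 1) (\<lambda>_ _. 0)"
  proof
    fix h f f'
    assume "graph_ode G (\<lambda>e x. - 0) h f f'" "\<And>w. w \<in> vertices G \<Longrightarrow> flux G f' w = 0" "h v = 0"
    then show "\<forall>e\<in>edges G. \<forall>x\<in>{0..elen G e}. f e x = 0"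
      using harmonic_constant[of h f f' v] v by simp
  qed (use \<psi> v constant_solution in auto)
  \<comment> \<open>Closeness 1 / 2 to the constant 1 ensures positivity, hence that this branch is
    the lowest. The upper rate \<open>\<kappa>1 + 1\<close> serves only to keep it below the other
    branch.\<close>
  have "\<exists>\<eta>>0. \<forall>t. 0 < t \<longrightarrow> t < \<eta> \<longrightarrow> (\<exists>s h f f'. a1 * t \<le> s \<and> s \<le> (\<kappa>1 + 1) * t \<and>
     graph_ode G (\<lambda>e x. t * \<psi> e x - (0 + s)) h f f' \<and> (\<forall>w\<in>vertices G. flux G f' w = 0) \<and> h v = 1 \<and>
     (\<forall>e\<in>edges G. \<forall>x\<in>{0..elen G e}. \<bar>f e x - 1\<bar> \<le> 1 / 2))"
  proof (rule perturbation.eigenvalue_branch[OF free])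
    show "a1 * edge_integral G (\<lambda>e x. 1\<^sup>2) < edge_integral G (\<lambda>e x. \<psi> e x * 1\<^sup>2)"
      using ord(3) L by (simp add: edge_integral_const \<kappa>1_def L_def[symmetric] pos_less_divide_eq)
    show "edge_integral G (\<lambda>e x. \<psi> e x * 1\<^sup>2) < (\<kappa>1 + 1) * edge_integral G (\<lambda>e x. 1\<^sup>2)"
      using L by (simp add: edge_integral_const \<kappa>1_def L_def[symmetric] distrib_right)
  qed (use ord in auto)
  then obtain \<eta>1 where \<eta>1: "\<eta>1 > 0" and low: "\<And>t. 0 < t \<Longrightarrow> t < \<eta>1 \<Longrightarrow> \<exists>s h f f'. a1 * t \<le> s \<and> s \<le> (\<kappa>1 + 1) * t \<and>
     graph_ode G (\<lambda>e x. t * \<psi> e x - (0 + s)) h f f' \<and> (\<forall>w\<in>vertices G. flux G f' w = 0) \<and> h v = 1 \<and>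
     (\<forall>e\<in>edges G. \<forall>x\<in>{0..elen G e}. \<bar>f e x - 1\<bar> \<le> 1 / 2)" by blast
  have cQ: "edge_continuous G (\<lambda>e x. Q t (pt G e x))" for t
    by (rule edge_continuous_cong[of _ "\<lambda>e x. t * \<psi> e x"]) (auto intro!: edge_cont \<psi> simp: Q)
  have Qode: "graph_ode G (\<lambda>e x. Q t (pt G e x) - \<mu>) h f f'"
    if "graph_ode G (\<lambda>e x. t * \<psi> e x - \<mu>) h f f'" for t \<mu> h f f'
    by (rule graph_ode_cong[OF that]) (simp add: Q)
  \<comment> \<open>The lower rate \<open>-c\<close> is a crude bound that keeps the two branches
    apart; the upper rate \<open>b2\<close> is the one that enters the gap. An unaffected eigenvalue
    gives c = 0, a moving one c = 1.\<close>
  have "\<exists>c \<eta>2. 0 \<le> c \<and> \<eta>2 > 0 \<and> (\<forall>t. 0 < t \<longrightarrow> t < \<eta>2 \<longrightarrow>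
     (\<exists>\<mu>. \<Lambda> - c * t \<le> \<mu> \<and> \<mu> \<le> \<Lambda> + b2 * t \<and> (\<exists>u. eigenfunction G (Q t) \<mu> u)))"
  proof (cases "\<exists>h f f'. graph_ode G (\<lambda>e x. - \<Lambda>) h f f' \<and> (\<forall>w\<in>vertices G. flux G f' w = 0) \<and> h v = 0 \<and>
      (\<exists>e\<in>edges G. \<exists>x\<in>{0..elen G e}. f e x \<noteq> 0)")
    case True
    then obtain h f f' where s: "graph_ode G (\<lambda>e x. - \<Lambda>) h f f'" "\<forall>w\<in>vertices G. flux G f' w = 0" "h v = 0"
      "\<exists>e\<in>edges G. \<exists>x\<in>{0..elen G e}. f e x \<noteq> 0" by blast
    have "\<exists>u. eigenfunction G (Q t) \<Lambda> u" for t
    proof -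
      have "graph_ode G (\<lambda>e x. t * \<psi> e x - \<Lambda>) h f f'"
        by (rule graph_ode_cong[OF s(1)]) (use supp[OF s(1-3)] in \<open>simp add: left_diff_distrib\<close>)
      then show ?thesis unfolding eigenvalue_iff[OF cQ] using Qode s(2,4) by blast
    qed
    then show ?thesis using ord by (intro exI[of _ 0] exI[of _ 1]) (auto intro!: exI[of _ \<Lambda>])
  next
    case False
    define c where "c = u (Vertex v)"
    \<comment> \<open>In this case no nonzero eigenfunction vanishes at \<open>v\<close>, in
      particular not \<open>u\<close>.\<close>
    have c0: "c \<noteq> 0" using False u' nz unfolding c_def by blast
    have nondeg: "perturbation G \<psi> \<Lambda> v (\<lambda>w. u (Vertex w) / c) (\<lambda>e x. U e x / c) (\<lambda>e x. u' e x / c)"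
    proof
      show "graph_ode G (\<lambda>e x. - \<Lambda>) (\<lambda>w. u (Vertex w) / c) (\<lambda>e x. U e x / c) (\<lambda>e x. u' e x / c)"
        using graph_ode_combine[OF u'(1) u'(1), of "1 / c" 0] by simp
      show "flux G (\<lambda>e x. u' e x / c) w = 0" if "w \<in> vertices G" for w
        using flux_combine[of G "1 / c" u' 0 u' w] u'(2) that by simp
      show "u (Vertex v) / c = 1" using c0 by (simp add: c_def)
      fix h f f'
      assume "graph_ode G (\<lambda>e x. - \<Lambda>) h f f'" "\<And>w. w \<in> vertices G \<Longrightarrow> flux G f' w = 0" "h v = 0"
      then show "\<forall>e\<in>edges G. \<forall>x\<in>{0..elen G e}. f e x = 0" using False by blast
    qed (use \<psi> v in auto)
    have scaled: "edge_integral G (\<lambda>e x. (U e x / c)\<^sup>2) = I2 / c\<^sup>2"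
      "edge_integral G (\<lambda>e x. \<psi> e x * (U e x / c)\<^sup>2) = J / c\<^sup>2"
      using edge_integral_cmult[of G "1 / c\<^sup>2" "\<lambda>e x. (U e x)\<^sup>2"]
        edge_integral_cmult[of G "1 / c\<^sup>2" "\<lambda>e x. \<psi> e x * (U e x)\<^sup>2"]
      by (simp_all add: power_divide I2_def J_def)
    have J: "J = \<kappa>2 * I2" using I2 by (simp add: \<kappa>2_def)
    have "\<exists>\<eta>>0. \<forall>t. 0 < t \<longrightarrow> t < \<eta> \<longrightarrow> (\<exists>s h f f'. (\<kappa>2 - 1) * t \<le> s \<and> s \<le> b2 * t \<and>
       graph_ode G (\<lambda>e x. t * \<psi> e x - (\<Lambda> + s)) h f f' \<and> (\<forall>w\<in>vertices G. flux G f' w = 0) \<and> h v = 1 \<and>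
       (\<forall>e\<in>edges G. \<forall>x\<in>{0..elen G e}. \<bar>f e x - U e x / c\<bar> \<le> 1))"
    proof (rule perturbation.eigenvalue_branch[OF nondeg])
      have "(\<kappa>2 - 1) * I2 < J" "J < b2 * I2"
        unfolding J using I2 ord(1) by (simp_all add: mult_strict_right_mono)
      then show "(\<kappa>2 - 1) * edge_integral G (\<lambda>e x. (U e x / c)\<^sup>2) < edge_integral G (\<lambda>e x. \<psi> e x * (U e x / c)\<^sup>2)"
        "edge_integral G (\<lambda>e x. \<psi> e x * (U e x / c)\<^sup>2) < b2 * edge_integral G (\<lambda>e x. (U e x / c)\<^sup>2)"
        unfolding scaled times_divide_eq_right using c0 by (simp_all add: divide_strict_right_mono)
    qed (use ord in auto)
    then obtain \<eta>2 where \<eta>2: "\<eta>2 > 0" and br: "\<forall>t. 0 < t \<longrightarrow> t < \<eta>2 \<longrightarrow> (\<exists>s h f f'. (\<kappa>2 - 1) * t \<le> s \<and> s \<le> b2 * t \<and>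
       graph_ode G (\<lambda>e x. t * \<psi> e x - (\<Lambda> + s)) h f f' \<and> (\<forall>w\<in>vertices G. flux G f' w = 0) \<and> h v = 1 \<and>
       (\<forall>e\<in>edges G. \<forall>x\<in>{0..elen G e}. \<bar>f e x - U e x / c\<bar> \<le> 1))"
      by (elim exE conjE)
    have "\<exists>\<mu>. \<Lambda> - 1 * t \<le> \<mu> \<and> \<mu> \<le> \<Lambda> + b2 * t \<and> (\<exists>u. eigenfunction G (Q t) \<mu> u)" if t: "0 < t" "t < \<eta>2" for t
    proof -
      obtain s h f f' where s: "(\<kappa>2 - 1) * t \<le> s" "s \<le> b2 * t"
        "graph_ode G (\<lambda>e x. t * \<psi> e x - (\<Lambda> + s)) h f f'" "\<forall>w\<in>vertices G. flux G f' w = 0" "h v = 1"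
        using br[rule_format, OF t] by (elim exE conjE)
      have "- t \<le> s"
        using s(1) mult_right_mono[of "-1" "\<kappa>2 - 1" t] \<kappa>(2) t(1) by simp
      moreover have "\<exists>u. eigenfunction G (Q t) (\<Lambda> + s) u"
      proof -
        have "edge_continuous G (\<lambda>e x. t * \<psi> e x - (\<Lambda> + s))" by (intro edge_cont \<psi>)
        from graph_ode_zero_iff[OF this s(3)]
        have "\<exists>e\<in>edges G. \<exists>x\<in>{0..elen G e}. f e x \<noteq> 0"
          using s(5) v by (metis zero_neq_one)
        then show ?thesis unfolding eigenvalue_iff[OF cQ] using Qode[OF s(3)] s(4) by blast
      qed
      ultimately show ?thesis using s(2) by (intro exI[of _ "\<Lambda> + s"]) auto
    qed
    then show ?thesis using \<eta>2 by (intro exI[of _ 1] exI[of _ \<eta>2]) auto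
  qed
  then obtain c \<eta>2 where c: "0 \<le> c" and \<eta>2: "\<eta>2 > 0" and second: "\<And>t. 0 < t \<Longrightarrow> t < \<eta>2 \<Longrightarrow>
     \<exists>\<mu>. \<Lambda> - c * t \<le> \<mu> \<and> \<mu> \<le> \<Lambda> + b2 * t \<and> (\<exists>u. eigenfunction G (Q t) \<mu> u)" by blast
  \<comment> \<open>The last bound gives (\<kappa>1 + 1) t < \<Lambda> - c t, so the lowest
    eigenvalue stays strictly below the second branch.\<close>
  define \<eta> where "\<eta> = min (min \<eta>1 \<eta>2) (\<Lambda> / (\<kappa>1 + 1 + c))"
  have pos: "\<kappa>1 + 1 + c > 0" using \<kappa> c by linarith
  have "\<eta> > 0" using \<eta>1 \<eta>2 \<Lambda> pos by (simp add: \<eta>_def)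
  moreover have "spectral_gap G (Q t) < \<Lambda>" if t: "0 < t" "t < \<eta>" for t
  proof -
    have t1: "t < \<eta>1" "t < \<eta>2" "t * (\<kappa>1 + 1 + c) < \<Lambda>"
      using t pos by (auto simp: \<eta>_def pos_less_divide_eq)
    obtain s h f f' where s: "a1 * t \<le> s" "s \<le> (\<kappa>1 + 1) * t"
      "graph_ode G (\<lambda>e x. t * \<psi> e x - (0 + s)) h f f'" "\<forall>w\<in>vertices G. flux G f' w = 0"
      "\<forall>e\<in>edges G. \<forall>x\<in>{0..elen G e}. \<bar>f e x - 1\<bar> \<le> 1 / 2"
      using low[OF t(1) t1(1)] by blast
    obtain \<mu> where \<mu>: "\<Lambda> - c * t \<le> \<mu>" "\<mu> \<le> \<Lambda> + b2 * t" "\<exists>u. eigenfunction G (Q t) \<mu> u"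
      using second[OF t(1) t1(2)] by blast
    have fpos: "f e x > 0" if "e \<in> edges G" "x \<in> {0..elen G e}" for e x
      using bspec[OF bspec[OF s(5) that(1)] that(2)] by linarith
    have sQ: "graph_ode G (\<lambda>e x. Q t (pt G e x) - s) h f f'" using Qode[of t s] s(3) by simp
    have ex: "\<exists>u. eigenfunction G (Q t) s u"
      unfolding eigenvalue_iff[OF cQ] using sQ s(4) fpos[OF nz(1,2)] nz(1,2) by (metis less_irrefl)
    have lowest: "s \<le> \<nu>" if "eigenfunction G (Q t) \<nu> w" for \<nu> w
    proof -
      obtain h2 f2 f2' where 2: "graph_ode G (\<lambda>e x. Q t (pt G e x) - \<nu>) h2 f2 f2'" "\<forall>w\<in>vertices G. flux G f2' w = 0"
        "\<exists>e\<in>edges G. \<exists>x\<in>{0..elen G e}. f2 e x \<noteq> 0"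
        using \<open>eigenfunction G (Q t) \<nu> w\<close> eigenvalue_iff[OF cQ] by blast
      then obtain e x where e: "e \<in> edges G" "x \<in> {0..elen G e}" "f2 e x \<noteq> 0" by blast
      show ?thesis by (rule positive_solution_lowest[OF cQ 2(1,2) e sQ s(4) fpos])
    qed
    have "s < \<mu>"
    proof -
      have "(\<kappa>1 + 1) * t + c * t < \<Lambda>" using t1(3) by (simp add: algebra_simps)
      then show ?thesis using s(2) \<mu>(1) by linarith
    qed
    have "eigval G (Q t) 1 = s" by (rule eigval_1[OF cQ ex]) (rule lowest)
    moreover have "eigval G (Q t) 2 \<le> \<mu>" by (rule eigval_2_le[OF cQ ex _ \<mu>(3) \<open>s < \<mu>\<close>]) (rule lowest)
    ultimately have "spectral_gap G (Q t) \<le> \<Lambda> + b2 * t - a1 * t"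
      using s(1) \<mu>(2) by (simp add: spectral_gap_def)
    moreover have "b2 * t < a1 * t" using ord t(1) by simp
    ultimately show ?thesis by linarith
  qed
  ultimately show ?thesis by blast
qed

end

section \<open>Tent potentials at a leaf\<close>

text \<open>On a route between leaves the tent is a decreasing hinge, an increasing hinge or
  identically 0; the case c = 0 covers the last.\<close>

lemma convex_on_max_affine:
  fixes a b c :: real
  assumes "0 \<le> c" "convex S" "\<And>s. s \<in> S \<Longrightarrow> f s = c * max 0 (a + b * s)"
  shows "convex_on S f"
proof (rule convex_onI)
  fix u x y :: real assume u: "0 < u" "u < 1" and xy: "x \<in> S" "y \<in> S"
  have m: "(1 - u) *\<^sub>R x + u *\<^sub>R y \<in> S" using assms(2) u xy by (intro convexD) auto
  have "max 0 (a + b * ((1 - u) * x + u * y)) \<le> (1 - u) * max 0 (a + b * x) + u * max 0 (a + b * y)"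
  proof -
    have "a + b * ((1 - u) * x + u * y) = (1 - u) * (a + b * x) + u * (a + b * y)" by (simp add: algebra_simps)
    also have "\<dots> \<le> (1 - u) * max 0 (a + b * x) + u * max 0 (a + b * y)"
      using u by (intro add_mono mult_left_mono) auto
    finally show ?thesis using u by (simp add: add_nonneg_nonneg)
  qed
  then have "c * max 0 (a + b * ((1 - u) * x + u * y)) \<le> c * ((1 - u) * max 0 (a + b * x) + u * max 0 (a + b * y))"
    by (rule mult_left_mono) (rule assms(1))
  then show "f ((1 - u) *\<^sub>R x + u *\<^sub>R y) \<le> (1 - u) * f x + u * f y"
    using assms(3)[OF m] assms(3)[OF xy(1)] assms(3)[OF xy(2)] by (simp add: algebra_simps)
qed (rule assms(2))

lemma walk_append: "walk G a (xs @ ys) b \<longleftrightarrow> (\<exists>c. walk G a xs c \<and> walk G c ys b)"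
  by (induction xs arbitrary: a) auto

text \<open>The inequality of truth values in \<open>ends\<close> is an exclusive or: exactly one
  end of \<open>e\<close> is \<open>v\<close>, which rules out a loop. A width of at most the edge
  length makes the tent vanish at the other end, so that extension by 0 is continuous.\<close>

locale pendant_edge = connected_graph G for G :: "('v, 'e) metric_graph" +
  fixes v :: 'v and e :: 'e and \<delta> :: real
  assumes edge: "e \<in> edges G" and ends: "(esrc G e = v) \<noteq> (etgt G e = v)"
    and others: "\<And>e'. e' \<in> edges G \<Longrightarrow> e' \<noteq> e \<Longrightarrow> esrc G e' \<noteq> v \<and> etgt G e' \<noteq> v"
    and \<delta>: "0 < \<delta>" "\<delta> \<le> elen G e"
begin

definition leaf_distance :: "real \<Rightarrow> real" where
  "leaf_distance x = (if esrc G e = v then x else elen G e - x)"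

definition tent :: "'e \<Rightarrow> real \<Rightarrow> real" where
  "tent e' x = (if e' = e then max 0 (1 - leaf_distance x / \<delta>) else 0)"

definition tent_potential :: "real \<Rightarrow> ('v, 'e) point \<Rightarrow> real" where
  "tent_potential t y = (case y of Vertex w \<Rightarrow> if w = v then t else 0 | Interior e' x \<Rightarrow> t * tent e' x)"

lemma tent_potential_pt:
  assumes "e' \<in> edges G" "x \<in> {0..elen G e'}"
  shows "tent_potential t (pt G e' x) = t * tent e' x"
  using assms ends others[of e'] \<delta> elen_pos[of e']
  by (auto simp: tent_potential_def pt_def tent_def leaf_distance_def)

lemma tent_bounds: "0 \<le> tent e' x" "x \<in> {0..elen G e'} \<Longrightarrow> tent e' x \<le> 1"
  using \<delta> by (auto simp: tent_def leaf_distance_def)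

lemma tent_continuous: "edge_continuous G tent"
  unfolding edge_continuous_def
proof
  fix e' show "continuous_on {0..elen G e'} (tent e')"
    unfolding tent_def leaf_distance_def using \<delta> by (cases "e' = e"; cases "esrc G e = v") (auto intro!: continuous_intros)
qed

lemma vertex: "v \<in> vertices G"
  using edge ends by (auto simp: vertices_def)

lemma tent_potential_dart:
  assumes "fst d \<in> edges G" "0 \<le> s" "s \<le> elen G (fst d)"
  shows "fst d \<noteq> e \<Longrightarrow> tent_potential t (dart_point G d s) = 0"
    "dart_tail G d = v \<Longrightarrow> tent_potential t (dart_point G d s) = t * max 0 (1 - s / \<delta>)"
    "dart_head G d = v \<Longrightarrow> tent_potential t (dart_point G d s) = t * max 0 (1 - (elen G (fst d) - s) / \<delta>)"
  using assms tent_potential_pt[of "fst d" "if snd d then s else elen G (fst d) - s" t] ends others[of "fst d"]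
  by (auto simp: dart_point_def tent_def leaf_distance_def dart_tail_def dart_head_def split: if_splits)

lemma dart_at_leaf:
  assumes "fst d \<in> edges G"
  shows "fst d = e \<longleftrightarrow> dart_tail G d = v \<or> dart_head G d = v"
    "\<not> (dart_tail G d = v \<and> dart_head G d = v)"
  using assms ends others[of "fst d"] by (auto simp: dart_tail_def dart_head_def)

lemma dart_heads_tails:
  assumes "fst d = e" "fst d' = e" "dart_head G d = v" "dart_tail G d' = v"
  shows "dart_head G d' = dart_tail G d"
  using assms ends by (auto simp: dart_tail_def dart_head_def split: if_splits)

lemma route_length_nonneg: "walk G a ds b \<Longrightarrow> 0 \<le> route_length G ds"
proof (induction ds arbitrary: a)
  case (Cons d ds)
  then have "0 \<le> route_length G ds" "0 < elen G (fst d)" using elen_pos by auto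
  then show ?case by (simp add: route_length_def)
qed (simp add: route_length_def)

text \<open>Traversing \<open>e\<close> in either direction starts or ends at
  \<open>v\<close>.\<close>

lemma walk_avoiding_leaf:
  assumes "walk G a ds b" "a \<noteq> v" "v \<notin> set (map (dart_head G) ds)" "d \<in> set ds"
  shows "fst d \<noteq> e"
  using assms
proof (induction ds arbitrary: a)
  case (Cons d' ds)
  have d': "fst d' \<in> edges G" "dart_tail G d' = a" "dart_head G d' \<noteq> v" using Cons.prems by auto
  show ?case
  proof (cases "d = d'")
    case True
    then show ?thesis using d' dart_at_leaf(1)[OF d'(1)] Cons.prems(2) by simp
  next
    case False
    then show ?thesis using Cons.IH[of "dart_head G d'"] Cons.prems d' by auto
  qed
qed simp

text \<open>A route through \<open>v\<close> would have to leave \<open>v\<close> along the edge by which it arrived.\<close>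

lemma route_leaf_not_inner:
  assumes "walk G a ds b" "distinct (a # map (dart_head G) ds)" "a \<noteq> v" "b \<noteq> v"
  shows "v \<notin> set (map (dart_head G) ds)"
  using assms
proof (induction ds arbitrary: a)
  case (Cons d ds)
  have d: "fst d \<in> edges G" "dart_tail G d = a" "walk G (dart_head G d) ds b" using Cons.prems by auto
  have "dart_head G d \<noteq> v"
  proof
    assume h: "dart_head G d = v"
    then have "ds \<noteq> []" using d(3) Cons.prems(4) by auto
    then obtain d' ds' where ds: "ds = d' # ds'" by (cases ds) auto
    then have d': "fst d' \<in> edges G" "dart_tail G d' = v" using d(3) h by auto
    have "dart_head G d' = a"
      using dart_heads_tails[of d d'] dart_at_leaf(1)[OF d(1)] dart_at_leaf(1)[OF d'(1)] h d' d(2) by simp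
    then show False using Cons.prems(2) ds by simp
  qed
  then show ?case using Cons.IH[OF d(3)] Cons.prems by auto
qed simp

lemma route_avoiding_leaf:
  assumes "walk G a ds b" "\<forall>d\<in>set ds. fst d \<noteq> e" "ds \<noteq> []" "0 \<le> s" "s \<le> route_length G ds"
  shows "tent_potential t (route_point G ds s) = 0"
  using assms
proof (induction ds arbitrary: a s)
  case (Cons d ds)
  have d: "fst d \<in> edges G" "fst d \<noteq> e" using Cons.prems by auto
  show ?case
  proof (cases "ds = [] \<or> s \<le> elen G (fst d)")
    case True
    then have "s \<le> elen G (fst d)" using Cons.prems(5) by (auto simp: route_length_def)
    then show ?thesis using True tent_potential_dart(1)[OF d(1) Cons.prems(4)] d(2) by simp
  next
    case False
    then show ?thesis using Cons.IH[of "dart_head G d" "s - elen G (fst d)"] Cons.prems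
      by (auto simp: route_length_def)
  qed
qed simp

lemma route_from_leaf:
  assumes "walk G v (d # ds) b" "\<forall>d\<in>set ds. fst d \<noteq> e" "0 \<le> s" "s \<le> route_length G (d # ds)"
  shows "tent_potential t (route_point G (d # ds) s) = t * max 0 (1 - s / \<delta>)"
proof (cases "ds = [] \<or> s \<le> elen G (fst d)")
  case True
  then have "s \<le> elen G (fst d)" using assms(4) by (auto simp: route_length_def)
  then show ?thesis using True tent_potential_dart(2)[of d s t] assms by simp
next
  case False
  have d: "fst d = e" using assms(1) dart_at_leaf(1)[of d] by auto
  have "tent_potential t (route_point G ds (s - elen G (fst d))) = 0"
    by (rule route_avoiding_leaf[of "dart_head G d" _ b]) (use assms False in \<open>auto simp: route_length_def\<close>)
  \<comment> \<open>Past the first edge the distance from the leaf exceeds the length of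
    \<open>e\<close>, hence the width of the tent, and the hinge is 0 there.\<close>
  moreover have "1 - s / \<delta> \<le> 0" using False \<delta> d by (simp add: le_divide_eq)
  ultimately show ?thesis using False by (simp add: max_def)
qed

lemma route_to_leaf:
  assumes "walk G a (ds @ [d]) v" "\<forall>d\<in>set ds. fst d \<noteq> e" "0 \<le> s" "s \<le> route_length G (ds @ [d])"
  shows "tent_potential t (route_point G (ds @ [d]) s) = t * max 0 (1 - (route_length G (ds @ [d]) - s) / \<delta>)"
  using assms
proof (induction ds arbitrary: a s)
  case Nil
  then show ?case using tent_potential_dart(3)[of d s t] by (simp add: route_length_def)
next
  case (Cons d' ds)
  have d': "fst d' \<in> edges G" "fst d' \<noteq> e" "walk G (dart_head G d') (ds @ [d]) v" using Cons.prems by auto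
  obtain c where c: "walk G (dart_head G d') ds c" "walk G c [d] v" using d'(3) unfolding walk_append by blast
  have d: "fst d \<in> edges G" "fst d = e" using c(2) dart_at_leaf(1)[of d] by auto
  show ?case
  proof (cases "s \<le> elen G (fst d')")
    case True
    \<comment> \<open>On the first edge the whole last edge \<open>e\<close> still lies
      ahead.\<close>
    have "\<delta> \<le> route_length G ((d' # ds) @ [d]) - s"
      using route_length_nonneg[OF c(1)] True d(2) \<delta> by (simp add: route_length_def)
    then have "1 - (route_length G ((d' # ds) @ [d]) - s) / \<delta> \<le> 0" using \<delta> by (simp add: le_divide_eq)
    moreover have "tent_potential t (route_point G ((d' # ds) @ [d]) s) = 0"
      using True tent_potential_dart(1)[OF d'(1) Cons.prems(3)] d'(2) by simp
    ultimately show ?thesis by (simp add: max_def)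
  next
    case False
    then show ?thesis using Cons.IH[OF d'(3), of "s - elen G (fst d')"] Cons.prems
      by (simp add: route_length_def algebra_simps)
  qed
qed

lemma tent_potential_convex:
  assumes t: "0 \<le> t" "t \<le> M"
  shows "tent_potential t \<in> convex_potentials G M"
  unfolding convex_potentials_def
proof (intro CollectI conjI ballI allI impI)
  fix y assume "y \<in> points G"
  then obtain e' x where y: "e' \<in> edges G" "x \<in> {0..elen G e'}" "y = pt G e' x" using points_eq_pt by blast
  have "tent_potential t y = t * tent e' x" using tent_potential_pt y by simp
  moreover have "0 \<le> t * tent e' x" "t * tent e' x \<le> t * 1"
    using t tent_bounds(1)[of e' x] tent_bounds(2)[OF y(2)] by (auto intro: mult_left_mono simp del: mult_1_right)
  ultimately show "0 \<le> tent_potential t y" "tent_potential t y \<le> M" using t by auto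
next
  fix a b ds assume "a \<noteq> b \<and> simple_route G a ds b"
  then have w: "walk G a ds b" "a \<noteq> b" and dist: "distinct (a # map (dart_head G) ds)"
    by (auto simp: simple_route_def)
  have ne: "ds \<noteq> []" using w by auto
  let ?T = "route_length G ds"
  consider "a = v" | "b = v" "a \<noteq> v" | "a \<noteq> v" "b \<noteq> v" by blast
  then show "convex_on {0..?T} (\<lambda>s. tent_potential t (route_point G ds s))"
  proof cases
    case 1
    obtain d ds' where ds: "ds = d # ds'" using ne by (cases ds) auto
    have "fst d' \<noteq> e" if "d' \<in> set ds'" for d'
      by (rule walk_avoiding_leaf[of "dart_head G d" ds' b]) (use w(1) dist ds 1 that in auto)
    then show ?thesis
      using route_from_leaf[of d ds' b _ t] w(1) ds 1 t
      by (intro convex_on_max_affine[of t _ _ 1 "- 1 / \<delta>"]) auto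
  next
    case 2
    obtain d ds' where ds: "ds = ds' @ [d]" using ne by (metis rev_exhaust)
    obtain c where c: "walk G a ds' c" "walk G c [d] b" using w(1) unfolding ds walk_append by blast
    have "dart_head G d = v" using c(2) 2 by simp
    then have "fst d' \<noteq> e" if "d' \<in> set ds'" for d'
      using walk_avoiding_leaf[OF c(1) _ _ that] 2 dist ds by auto
    then show ?thesis
      using route_to_leaf[of a ds' d _ t] w(1) ds 2 t
      by (intro convex_on_max_affine[of t _ _ "1 - ?T / \<delta>" "1 / \<delta>"]) (auto simp: diff_divide_distrib)
  next
    case 3
    have "\<forall>d\<in>set ds. fst d \<noteq> e"
      using walk_avoiding_leaf[OF w(1)] route_leaf_not_inner[OF w(1) dist] 3 by blast
    then show ?thesis
      using route_avoiding_leaf[OF w(1)] ne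
      by (intro convex_on_max_affine[of 0 _ _ 0 0]) auto
  qed
qed

text \<open>At a vertex of degree one the Kirchhoff condition is a Neumann condition. Together with
  the value 0 it gives zero Cauchy data, and uniqueness finishes.\<close>

lemma vanishing_on_pendant_edge:
  assumes p: "edge_continuous G p" and s: "graph_ode G p h f f'" and fl: "flux G f' v = 0" and h: "h v = 0"
    and x: "x \<in> {0..elen G e}"
  shows "f e x = 0"
proof -
  have l: "lin_ode (elen G e) (p e) (f e) (f' e)" "f e 0 = h (esrc G e)" "f e (elen G e) = h (etgt G e)"
    using s edge by (auto simp: graph_ode_def)
  have pc: "continuous_on {0..elen G e} (p e)" using p edge by (simp add: edge_continuous_def)
  show ?thesis
  proof (cases "esrc G e = v")
    case True
    have sets: "{e' \<in> edges G. esrc G e' = v} = {e}" "{e' \<in> edges G. etgt G e' = v} = {}"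
      using True ends edge others by auto
    have "f' e 0 = 0" using fl unfolding flux_def sets by simp
    then show ?thesis
      using lin_ode_zero(1)[OF elen_pos[OF edge] pc l(1) _ _ x] l(2) h True by simp
  next
    case False
    then have "etgt G e = v" using ends by simp
    moreover have sets: "{e' \<in> edges G. esrc G e' = v} = {}" "{e' \<in> edges G. etgt G e' = v} = {e}"
      using False \<open>etgt G e = v\<close> edge others by auto
    have "f' e (elen G e) = 0" using fl unfolding flux_def sets by simp
    ultimately show ?thesis
      using lin_ode_zero_right[OF elen_pos[OF edge] pc l(1) _ _ x] l(3) h by simp
  qed
qed

end

section \<open>From the condition at a leaf to a potential with a smaller gap\<close>

lemma (in connected_graph) degree_one_edge:
  assumes "vertex_degree G v = 1"
  obtains e where "e \<in> edges G" "(esrc G e = v) \<noteq> (etgt G e = v)"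
    "\<And>e'. e' \<in> edges G \<Longrightarrow> e' \<noteq> e \<Longrightarrow> esrc G e' \<noteq> v \<and> etgt G e' \<noteq> v"
proof -
  let ?A = "{e \<in> edges G. esrc G e = v}" and ?B = "{e \<in> edges G. etgt G e = v}"
  have fin: "finite ?A" "finite ?B" using finite_edges by auto
  \<comment> \<open>A loop would be counted in both sets, so degree one leaves exactly one incidence
    and excludes loops.\<close>
  have "card ?A = 1 \<and> card ?B = 0 \<or> card ?A = 0 \<and> card ?B = 1"
    using assms by (auto simp: vertex_degree_def)
  then have "(\<exists>e. ?A = {e}) \<and> ?B = {} \<or> ?A = {} \<and> (\<exists>e. ?B = {e})"
    using fin by (simp add: card_1_singleton_iff)
  then show thesis
  proof (elim disjE conjE exE)
    fix e assume "?A = {e}" "?B = {}"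
    then show thesis by (intro that[of e]) auto
  next
    fix e assume "?A = {}" "?B = {e}"
    then show thesis by (intro that[of e]) auto
  qed
qed

lemma (in connected_graph) zero_potential_not_minimal:
  assumes u: "eigenfunction G (\<lambda>_. 0) (eigval G (\<lambda>_. 0) 2) u"
    and v: "v \<in> vertices G" "vertex_degree G v = 1"
    and less: "(u (Vertex v))\<^sup>2 < 1 / total_length G * graph_integral G (\<lambda>x. (u x)\<^sup>2)" and M: "M > 0"
  shows "\<not> is_arg_min (spectral_gap G) (\<lambda>q. q \<in> convex_potentials G M) (\<lambda>_. 0)"
proof -
  define \<mu> where "\<mu> = eigval G (\<lambda>_. 0) 2"
  define U where "U = (\<lambda>e x. u (pt G e x))"
  obtain u' where u': "graph_ode G (\<lambda>e x. - \<mu>) (\<lambda>w. u (Vertex w)) U u'" "\<forall>w\<in>vertices G. flux G u' w = 0"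
    using eigenspace_imp_graph_ode[OF edge_continuous_zero, of u \<mu>] u by (auto simp: eigenfunction_def U_def \<mu>_def)
  note cU = graph_ode_continuous(1)[OF u'(1)]
  define L where "L = total_length G"
  define A where "A = 1 / L * edge_integral G (\<lambda>e x. (U e x)\<^sup>2)"
  have "graph_integral G (\<lambda>x. (u x)\<^sup>2) = edge_integral G (\<lambda>e x. (U e x)\<^sup>2)"
    using graph_integral_eq_edge_integral[of "\<lambda>x. (u x)\<^sup>2"] edge_continuous_power[OF cU, of 2]
    by (simp add: U_def)
  then have less: "(u (Vertex v))\<^sup>2 < A" using less by (simp add: A_def L_def)
  obtain e where e: "e \<in> edges G" "(esrc G e = v) \<noteq> (etgt G e = v)"
    "\<And>e'. e' \<in> edges G \<Longrightarrow> e' \<noteq> e \<Longrightarrow> esrc G e' \<noteq> v \<and> etgt G e' \<noteq> v"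
    using degree_one_edge[OF v(2)] by blast
  have L: "L > 0" unfolding L_def total_length_def
    using e(1) elen_pos finite_edges by (intro sum_pos) auto
  have gap0: "spectral_gap G (\<lambda>_. 0) = \<mu>"
    using free_eigval_1 e(1) by (auto simp: spectral_gap_def \<mu>_def)
  \<comment> \<open>An eigenfunction for 0 is constant, so its square would equal its mean
    everywhere, against the strict inequality at \<open>v\<close>.\<close>
  have \<mu>: "\<mu> > 0"
  proof (rule ccontr)
    assume "\<not> \<mu> > 0"
    then have "\<mu> = 0" using free_eigenvalue_nonneg[OF u] by (simp add: \<mu>_def)
    then have "U e x = u (Vertex v)" if "e \<in> edges G" "x \<in> {0..elen G e}" for e x
      using harmonic_constant[of "\<lambda>w. u (Vertex w)" U u' v] u' v(1) that by simp
    then have "edge_integral G (\<lambda>e x. (U e x)\<^sup>2) = edge_integral G (\<lambda>e x. (u (Vertex v))\<^sup>2)"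
      by (intro edge_integral_cong) simp
    then show False using less L by (simp add: A_def edge_integral_const L_def)
  qed
  \<comment> \<open>A level strictly between u^2 at the leaf and its mean; by continuity u^2 stays
    below it near the leaf.\<close>
  define m where "m = ((u (Vertex v))\<^sup>2 + A) / 2"
  have m: "(u (Vertex v))\<^sup>2 < m" "m < A" using less by (auto simp: m_def)
  define x0 where "x0 = (if esrc G e = v then 0 else elen G e)"
  have x0: "x0 \<in> {0..elen G e}" using elen_pos[OF e(1)] by (auto simp: x0_def)
  have U0: "U e x0 = u (Vertex v)" using e(2) elen_pos[OF e(1)] by (auto simp: U_def x0_def pt_def)
  have "continuous_on {0..elen G e} (\<lambda>x. (U e x)\<^sup>2)"
    using cU e(1) unfolding edge_continuous_def by (intro continuous_intros) auto
  then obtain \<rho> where \<rho>: "\<rho> > 0" "\<And>x. x \<in> {0..elen G e} \<Longrightarrow> dist x x0 < \<rho> \<Longrightarrow> dist ((U e x)\<^sup>2) ((U e x0)\<^sup>2) < m - (u (Vertex v))\<^sup>2"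
    using x0 m(1) unfolding continuous_on_iff by (metis diff_gt_0_iff_gt)
  \<comment> \<open>The tent is supported where the continuity estimate holds, and fits on the
    edge.\<close>
  interpret pendant_edge G v e "min \<rho> (elen G e)"
    by unfold_locales (use e \<rho>(1) elen_pos[OF e(1)] in auto)
  have "tent e' x * (U e' x)\<^sup>2 \<le> m * tent e' x" if "e' \<in> edges G" "x \<in> {0..elen G e'}" for e' x
  proof (cases "e' = e \<and> leaf_distance x < min \<rho> (elen G e)")
    case True
    then have "dist x x0 < \<rho>" using that by (auto simp: leaf_distance_def x0_def dist_real_def split: if_splits)
    then have "(U e' x)\<^sup>2 \<le> m" using \<rho>(2)[of x] True that U0 by (auto simp: dist_real_def)
    then show ?thesis using tent_bounds(1)[of e' x] by (subst mult.commute) (rule mult_right_mono)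
  next
    case False
    then have "tent e' x = 0" using \<delta>(1) by (auto simp: tent_def max_def not_less le_divide_eq)
    then show ?thesis by simp
  qed
  then have "edge_integral G (\<lambda>e x. tent e x * (U e x)\<^sup>2) \<le> edge_integral G (\<lambda>e x. m * tent e x)"
    by (intro edge_integral_mono edge_cont tent_continuous cU edge_continuous_const)
  also have "\<dots> = m * edge_integral G tent" by (rule edge_integral_cmult)
  also have "\<dots> < A * edge_integral G tent"
  proof (rule mult_strict_right_mono[OF m(2)])
    have "tent e x0 = 1" by (simp add: tent_def leaf_distance_def x0_def)
    then show "0 < edge_integral G tent"
      using tent_bounds(1) e(1) x0 by (intro edge_integral_pos[of _ e x0] tent_continuous) auto
  qed
  finally have "edge_integral G (\<lambda>e x. tent e x * (U e x)\<^sup>2) * L < A * edge_integral G tent * L"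
    using L by (rule mult_strict_right_mono)
  also have "\<dots> = edge_integral G tent * edge_integral G (\<lambda>e x. (U e x)\<^sup>2)" using L by (simp add: A_def)
  finally have J: "edge_integral G (\<lambda>e x. tent e x * (U e x)\<^sup>2) * L < edge_integral G tent * edge_integral G (\<lambda>e x. (U e x)\<^sup>2)" .
  have "\<exists>\<eta>>0. \<forall>t. 0 < t \<longrightarrow> t < \<eta> \<longrightarrow> spectral_gap G (tent_potential t) < \<mu>"
  proof (rule spectral_gap_perturbation[OF tent_continuous vertex tent_potential_pt])
    show "eigenfunction G (\<lambda>_. 0) \<mu> u" using u by (simp add: \<mu>_def)
    fix h f f' e' x
    assume "graph_ode G (\<lambda>e x. - \<mu>) h f f'" "\<forall>w\<in>vertices G. flux G f' w = 0" "h v = 0" "e' \<in> edges G" "x \<in> {0..elen G e'}"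
    then show "tent e' x * f e' x = 0"
      using vanishing_on_pendant_edge[OF edge_continuous_const] vertex by (cases "e' = e") (auto simp: tent_def)
  qed (use \<mu> tent_bounds(1) J in \<open>simp_all add: U_def L_def\<close>)
  then obtain \<eta> where \<eta>: "\<eta> > 0" "\<And>t. 0 < t \<Longrightarrow> t < \<eta> \<Longrightarrow> spectral_gap G (tent_potential t) < \<mu>" by blast
  define t where "t = min M (\<eta> / 2)"
  have t: "0 < t" "t < \<eta>" "t \<le> M" using M \<eta>(1) by (auto simp: t_def)
  show ?thesis
    unfolding is_arg_min_def gap0 using \<eta>(2)[OF t(1,2)] tent_potential_convex[of t M] t by auto
qed

theorem lemma5p2:
  fixes G :: "('v, 'e) metric_graph" and L :: real
  assumes "metric_tree G" and "L = total_length G" and "L > 0"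
  shows "((\<exists>u2 v. eigenfunction G (\<lambda>_. 0) (eigval G (\<lambda>_. 0) 2) u2 \<and>
             v \<in> vertices G \<and> vertex_degree G v = 1 \<and>
             (u2 (Vertex v))\<^sup>2 < 1 / L * graph_integral G (\<lambda>x. (u2 x)\<^sup>2)) \<longrightarrow>
           (\<forall>M>0. \<not> is_arg_min (spectral_gap G) (\<lambda>q. q \<in> convex_potentials G M) (\<lambda>_. 0))) \<and>
         ((\<exists>u2 v. eigenfunction G (\<lambda>_. 0) (eigval G (\<lambda>_. 0) 2) u2 \<and>
             v \<in> vertices G \<and> vertex_degree G v = 1 \<and> u2 (Vertex v) = 0) \<longrightarrow>
           (\<forall>M>0. \<not> is_arg_min (spectral_gap G) (\<lambda>q. q \<in> convex_potentials G M) (\<lambda>_. 0)))"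
proof -
  interpret connected_graph G
    using assms(1) by unfold_locales (simp add: metric_tree_def)
  \<comment> \<open>Reduces the case \<open>u2 (Vertex v) = 0\<close> to the inequality: a nonzero
    eigenfunction has a positive mean square.\<close>
  have pos: "0 < 1 / L * graph_integral G (\<lambda>x. (u x)\<^sup>2)" if u: "eigenfunction G (\<lambda>_. 0) \<mu> u" for \<mu> u
  proof -
    have ue: "u \<in> eigenspace G (\<lambda>_. 0) \<mu>" "u \<noteq> 0" using u by (auto simp: eigenfunction_def)
    obtain u' where s: "graph_ode G (\<lambda>e x. 0 - \<mu>) (\<lambda>w. u (Vertex w)) (\<lambda>e x. u (pt G e x)) u'"
      using eigenspace_imp_graph_ode[OF edge_continuous_zero ue(1)] by blast
    note c = edge_continuous_power[OF graph_ode_continuous(1)[OF s], of 2]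
    obtain e x where e: "e \<in> edges G" "x \<in> {0..elen G e}" "u (pt G e x) \<noteq> 0"
      using eigenfunction_nonzero[OF ue(1)] ue(2) by blast
    have "graph_integral G (\<lambda>x. (u x)\<^sup>2) = edge_integral G (\<lambda>e x. (u (pt G e x))\<^sup>2)"
      using graph_integral_eq_edge_integral[of "\<lambda>x. (u x)\<^sup>2"] c by simp
    moreover have "0 < edge_integral G (\<lambda>e x. (u (pt G e x))\<^sup>2)"
      using e by (intro edge_integral_pos[OF c]) auto
    ultimately show ?thesis using assms(3) by simp
  qed
  have main: "\<not> is_arg_min (spectral_gap G) (\<lambda>q. q \<in> convex_potentials G M) (\<lambda>_. 0)"
    if "eigenfunction G (\<lambda>_. 0) (eigval G (\<lambda>_. 0) 2) u" "v \<in> vertices G" "vertex_degree G v = 1"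
      "(u (Vertex v))\<^sup>2 < 1 / L * graph_integral G (\<lambda>x. (u x)\<^sup>2)" "M > 0" for u v M
    using zero_potential_not_minimal that assms(2) by blast
  show ?thesis
  proof (intro conjI impI allI; elim exE conjE)
    fix M :: real and u v assume "M > 0" "eigenfunction G (\<lambda>_. 0) (eigval G (\<lambda>_. 0) 2) u" "v \<in> vertices G"
      "vertex_degree G v = 1" "(u (Vertex v))\<^sup>2 < 1 / L * graph_integral G (\<lambda>x. (u x)\<^sup>2)"
    then show "\<not> is_arg_min (spectral_gap G) (\<lambda>q. q \<in> convex_potentials G M) (\<lambda>_. 0)" using main by blast
  next
    fix M :: real and u v assume a: "M > 0" "eigenfunction G (\<lambda>_. 0) (eigval G (\<lambda>_. 0) 2) u" "v \<in> vertices G"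
      "vertex_degree G v = 1" "u (Vertex v) = 0"
    then have "(u (Vertex v))\<^sup>2 < 1 / L * graph_integral G (\<lambda>x. (u x)\<^sup>2)" using pos[OF a(2)] by simp
    with a show "\<not> is_arg_min (spectral_gap G) (\<lambda>q. q \<in> convex_potentials G M) (\<lambda>_. 0)" using main by blast
  qed
qed

end
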